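(* For every integer $s\ge 0$ there is a constant $C>0$ depending only on $d$, $D$ and $s$ such that for every real $r>2$ and every $f\in\ell^2(\mathbb Z)$, $$\Big\|\mathcal V^r\big(A_M f: M\in\mathcal G_s\big)\Big\|_{\ell^2(\mathbb Z)}\le C\,\frac{r}{r-2}\,\|f\|_{\ell^2(\mathbb Z)},$$ where $$A_M f(x):=\frac1M\sum_{m=0}^{M-1} f(x-\Phi(m)),\qquad \mathcal G_s:=\{uq^n: u,n\in\mathbb Z_{\ge 0},\ q^s\le u<q^{s+1}\},$$ and the times in $\mathcal G_s$ are read in increasing numerical order.
   Context: Let $d\ge 3$ be an integer and let $D\subsetneq\{0,1,\dots,d-1\}$ with $q:=|D|\ge 2$ and $0\in D$. Enumerate $D=\{\delta_0=0<\delta_1<\dots<\delta_{q-1}\}$. For $m\in\mathbb Z_{\ge 0}$ with base-$q$ expansion $m=\sum_{j=0}^J b_j q^j$, $0\le b_j<q$, define $\Phi(m):=\sum_{j=0}^J\delta_{b_j}d^j$. For $0<r<\infty$, the homogeneous $r$-variation of a scalar sequence $(a_n)$ indexed by an ordered set is $$\mathcal V^r(a_n:n):=\sup_{n_0<\dots<n_J}\Big(\sum_{j=1}^J|a_{n_j}-a_{n_{j-1}}|^r\Big)^{1/r},$$ the supremum being over all finite increasing subsequences of indices. For a sequence of functions it is defined pointwise: $\mathcal V^r(f_n:n)(x):=\mathcal V^r(f_n(x):n)$. *)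

theory Defs
  imports "HOL-Analysis.Analysis"
begin

definition digit_enum :: "nat set \<Rightarrow> nat \<Rightarrow> nat" where
  "digit_enum D b = sorted_list_of_set D ! b"

text \<open>
  The base-\<open>q\<close> digit of \<open>m\<close> at position \<open>j\<close> is \<open>m div q ^ j mod q\<close>, where \<open>q = card D\<close>.
  It vanishes for \<open>j > m\<close> when \<open>q \<ge> 2\<close>, and leading zeros contribute nothing to the sum when
  \<open>0 \<in> D\<close>, so summing over \<open>j \<le> m\<close> gives the digit map for any base-\<open>q\<close> expansion of \<open>m\<close>
  (lemma \<open>digit_map_expansion\<close>).
\<close>

definition digit_map :: "nat \<Rightarrow> nat set \<Rightarrow> nat \<Rightarrow> nat" where
  "digit_map d D m = (\<Sum>j\<le>m. digit_enum D (m div card D ^ j mod card D) * d ^ j)"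

definition digit_avg :: "nat \<Rightarrow> nat set \<Rightarrow> nat \<Rightarrow> (int \<Rightarrow> complex) \<Rightarrow> int \<Rightarrow> complex" where
  "digit_avg d D M f x = 1 / of_nat M * (\<Sum>m<M. f (x - int (digit_map d D m)))"

definition avg_times :: "nat \<Rightarrow> nat \<Rightarrow> nat set" where
  "avg_times q s = {u * q ^ n | u n. q ^ s \<le> u \<and> u < q ^ (s + 1)}"

text \<open>
  Homogeneous \<open>r\<close>-variation, for \<open>0 < r\<close>, of the sequence \<open>a\<close> indexed by \<open>S\<close> in increasing order;
  it may be infinite.
\<close>

definition variation :: "real \<Rightarrow> 'i::linorder set \<Rightarrow> ('i \<Rightarrow> 'a::real_normed_vector) \<Rightarrow> ennreal" where
  "variation r S a =
     (SUP (J, t) \<in> {(J :: nat, t :: nat \<Rightarrow> 'i). t ` {0..J} \<subseteq> S \<and> strict_mono_on {0..J} t}.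
        ennreal ((\<Sum>j=1..J. norm (a (t j) - a (t (j - 1))) powr r) powr (1 / r)))"

definition ennreal_sqrt :: "ennreal \<Rightarrow> ennreal" where
  "ennreal_sqrt y = (if y = \<infinity> then \<infinity> else ennreal (sqrt (enn2real y)))"

text \<open>
  The \<open>\<ell>\<^sup>2\<close> norm of \<open>[0,\<infinity>]\<close>-valued functions, so that it applies directly to variations;
  for a scalar function \<open>f\<close>, use \<open>\<lambda>x. ennreal (norm (f x))\<close>.
\<close>

definition l2norm :: "('b \<Rightarrow> ennreal) \<Rightarrow> ennreal" where
  "l2norm F = ennreal_sqrt (\<integral>\<^sup>+ x. F x ^ 2 \<partial>count_space UNIV)"

lemma base_digit:
  fixes b :: "nat \<Rightarrow> nat"
  assumes "\<And>j. j < n \<Longrightarrow> b j < q" "0 < q"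
  shows "(\<Sum>j<n. b j * q ^ j) div q ^ i mod q = (if i < n then b i else 0)"
  using assms(1)
proof (induction n arbitrary: b i)
  case 0
  show ?case by simp
next
  case (Suc n)
  define T where "T = (\<Sum>j<n. b (Suc j) * q ^ j)"
  have *: "(\<Sum>j<Suc n. b j * q ^ j) = b 0 + q * T"
    unfolding T_def sum.lessThan_Suc_shift sum_distrib_left by (simp add: mult_ac)
  have b0: "b 0 < q" using Suc.prems by simp
  show ?case
  proof (cases i)
    case 0
    then show ?thesis unfolding * using b0 by simp
  next
    case (Suc k)
    have "(b 0 + q * T) div q ^ Suc k = T div q ^ k"
      using b0 by (simp add: div_mult2_eq)
    moreover have "T div q ^ k mod q = (if k < n then b (Suc k) else 0)"
      unfolding T_def using Suc.IH[of "\<lambda>j. b (Suc j)"] Suc.prems by simp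
    ultimately show ?thesis unfolding * using Suc by simp
  qed
qed

lemma digit_map_expansion:
  assumes "finite D" "2 \<le> card D" "0 \<in> D"
    and "\<And>j. j \<le> J \<Longrightarrow> b j < card D"
    and m: "m = (\<Sum>j\<le>J. b j * card D ^ j)"
  shows "digit_map d D m = (\<Sum>j\<le>J. digit_enum D (b j) * d ^ j)"
proof -
  have z: "digit_enum D 0 = 0"
  proof -
    have "sorted_list_of_set D = insort 0 (sorted_list_of_set (D - {0}))"
      using assms by (metis sorted_list_of_set.fold_insort_key.remove)
    then have "sorted_list_of_set D = 0 # sorted_list_of_set (D - {0})"
      by (simp add: insort_is_Cons)
    then show ?thesis by (simp add: digit_enum_def)
  qed
  define g where "g j = digit_enum D (m div card D ^ j mod card D) * d ^ j" for j
  have dig: "m div card D ^ j mod card D = (if j \<le> J then b j else 0)" for j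
    unfolding m lessThan_Suc_atMost[symmetric]
    using base_digit[of "Suc J" b "card D" j] assms by (simp add: less_Suc_eq_le)
  have "g j = 0" if "j > m" for j
  proof -
    have "m < card D ^ j"
      using that assms(2) by (meson less_exp less_trans power_mono order_less_le_trans zero_le)
    then show ?thesis by (simp add: g_def z)
  qed
  then have "(\<Sum>j\<le>m. g j) = (\<Sum>j\<le>max m J. g j)"
    by (intro sum.mono_neutral_left) auto
  also have "\<dots> = (\<Sum>j\<le>J. g j)"
    by (intro sum.mono_neutral_right) (auto simp: g_def dig z)
  also have "\<dots> = (\<Sum>j\<le>J. digit_enum D (b j) * d ^ j)"
    by (simp add: g_def dig)
  finally show ?thesis by (simp add: digit_map_def g_def)
qed

end

theory Submission
  imports Defs
begin

text \<open>
  On the Fourier side \<open>A\<^bsub>q^n\<^esub>\<close> is multiplication by \<open>m\<^sub>n(\<theta>) =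
  (\<Prod>j<n. p(d^j \<theta>))\<close>, where \<open>p\<close> is the symbol of the uniform measure on
  \<open>D\<close>. Let \<open>g\<close> be the greatest common divisor of \<open>D\<close>, and call an
  index \<open>j\<close> \<^emph>\<open>active\<close> at \<open>\<theta>\<close> if \<open>g d^j
  \<theta>\<close> is not close to an integer. At an active index \<open>\<bar>p(d^j \<theta>)\<bar>\<close>
  is at most some fixed \<open>\<rho> < 1\<close>. Between two active indices the distance of \<open>g d^j
  \<theta>\<close> to the integers grows geometrically, so the factors \<open>p(d^j \<theta>)\<close> differ
  from \<open>1\<close> by amounts with bounded sum. Hence, up to an error whose squares have a bounded sum
  in \<open>n\<close>, the sequence \<open>m\<^sub>n(\<theta>)\<close> is constant on each block between
  active indices, and its modulus on the \<open>i\<close>-th block is at most \<open>\<rho>^i\<close>. A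
  square function likewise compares \<open>A\<^bsub>uq^n\<^esub>\<close> with
  \<open>A\<^bsub>q^n\<^esub>\<close> for the finitely many \<open>u\<close> with \<open>q^s \<le> u <
  q^(s+1)\<close>.

  What remains is the variation of \<open>n \<mapsto> H(\<theta>) 1[n \<le> j\<^sub>i(\<theta>)]\<close>,
  where \<open>j\<^sub>i\<close> is the \<open>i\<close>-th active index. If \<open>w\<^sub>j\<close> is the
  square of a Fejer multiplier in the variable \<open>g d^j \<theta>\<close>, then \<open>w\<^sub>j\<close>
  vanishes at every active index, the differences \<open>1 - w\<^sub>j\<close> have a bounded sum over each
  block of other indices, and for each set \<open>R\<close> of indices the partial products of
  \<open>w\<^sub>j\<close> over \<open>j \<in> R\<close> are conditional expectations of a reversed
  martingale (Rota's dilation, lemma \<open>rota_variation\<close>). Their variation is therefore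
  controlled, uniformly in \<open>R\<close>, by the inequality of Lepingle (lemma \<open>lepingle\<close>).
  Now let \<open>R\<close> be random, each index belonging to it independently with a small probability
  \<open>\<alpha>\<close>. The product over \<open>R\<close> is killed at the first active element of
  \<open>R\<close>, and a multiplier that depends on \<open>R\<close> and \<open>\<theta>\<close> but not on
  \<open>n\<close> costs no more than its size. Weighting by such a multiplier which depends on the first
  active element of \<open>R\<close> and averaging over \<open>R\<close> recovers \<open>m\<^sub>n\<close>,
  again up to a square summable error (\<open>expectation_coeff_thinned\<close>). Selecting the
  \<open>i\<close>-th active index has probability \<open>\<alpha> (1 - \<alpha>)^(i-1)\<close>, so by
  Cauchy-Schwarz the price is a factor \<open>(1 - \<alpha>)^(-i/2)\<close>; together with a loss \<open>(1
  - O(\<alpha>))^(-i)\<close> from the inactive elements of \<open>R\<close> it is absorbed by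
  \<open>\<rho>^i\<close> once \<open>\<alpha>\<close> is small (\<open>expectation_coeff_sq_le\<close>).

  All of this is carried out on a cyclic group of large order, where Fourier analysis and the martingales
  are finite sums; only finitely many times and points are involved at once, and monotone convergence gives
  the statement on the integers.
\<close>

section \<open>The variation seminorm on a finite range of times\<close>

lemma powr_sum_le_sum_powr:
  fixes v :: "'i \<Rightarrow> real"
  assumes "finite A" "0 < p" "p \<le> r" "\<And>i. i \<in> A \<Longrightarrow> 0 \<le> v i"
  shows "(\<Sum>i\<in>A. v i powr r) powr (1/r) \<le> (\<Sum>i\<in>A. v i powr p) powr (1/p)"
proof -
  define S where "S = (\<Sum>i\<in>A. v i powr p)"
  have S0: "0 \<le> S" unfolding S_def by (intro sum_nonneg) auto
  have "v i powr r \<le> v i powr p * S powr ((r-p)/p)" if i: "i \<in> A" for i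
  proof -
    have "v i powr p \<le> S" unfolding S_def using assms(1) i by (intro member_le_sum) auto
    then have "(v i powr p) powr ((r-p)/p) \<le> S powr ((r-p)/p)"
      using assms by (intro powr_mono2) auto
    moreover have "(v i powr p) powr ((r-p)/p) = v i powr (r-p)"
      using assms by (simp add: powr_powr)
    moreover have "v i powr r = v i powr p * v i powr (r-p)"
      by (simp add: powr_add[symmetric])
    ultimately show ?thesis by (simp add: mult_left_mono)
  qed
  then have "(\<Sum>i\<in>A. v i powr r) \<le> S * S powr ((r-p)/p)"
    unfolding S_def sum_distrib_right by (intro sum_mono) auto
  also have "\<dots> = S powr (r/p)"
  proof (cases "S = 0")
    case False
    then have "S * S powr ((r-p)/p) = S powr (1 + (r-p)/p)"
      using S0 by (simp add: powr_add)
    also have "1 + (r-p)/p = r/p" using assms by (simp add: field_simps)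
    finally show ?thesis .
  qed auto
  finally have "(\<Sum>i\<in>A. v i powr r) powr (1/r) \<le> (S powr (r/p)) powr (1/r)"
    using assms by (intro powr_mono2 sum_nonneg) auto
  also have "\<dots> = S powr (1/p)" using assms by (simp add: powr_powr)
  finally show ?thesis unfolding S_def .
qed

lemma powr_convex_combination:
  fixes x y u v :: real
  assumes "1 \<le> r" "0 \<le> x" "0 \<le> y" "0 \<le> u" "0 \<le> v" "u + v = 1"
  shows "(u * x + v * y) powr r \<le> u * x powr r + v * y powr r"
proof -
  have zero: "(u * x) powr r \<le> u * x powr r" if "0 \<le> u" "u \<le> 1" "0 \<le> x" for u x :: real
  proof -
    have "u powr r \<le> u" using powr_mono'[of 1 r u] that assms(1) by auto
    then show ?thesis using that by (simp add: powr_mult mult_right_mono)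
  qed
  show ?thesis
  proof (cases "x = 0 \<or> y = 0")
    case True
    then show ?thesis using zero[of u x] zero[of v y] assms by auto
  next
    case False
    then show ?thesis
      using convex_onD[OF powr_convex[OF assms(1)], of v x y] assms
      by (simp add: eq_diff_eq[symmetric])
  qed
qed

lemma powr_norm_triangle:
  fixes x y :: "'i \<Rightarrow> 'a::real_normed_vector"
  assumes "finite A" "1 \<le> r"
  shows "(\<Sum>i\<in>A. norm (x i + y i) powr r) powr (1/r)
    \<le> (\<Sum>i\<in>A. norm (x i) powr r) powr (1/r) + (\<Sum>i\<in>A. norm (y i) powr r) powr (1/r)"
proof -
  define a where "a = (\<Sum>i\<in>A. norm (x i) powr r) powr (1/r)"
  define b where "b = (\<Sum>i\<in>A. norm (y i) powr r) powr (1/r)"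
  have ar: "a powr r = (\<Sum>i\<in>A. norm (x i) powr r)" and br: "b powr r = (\<Sum>i\<in>A. norm (y i) powr r)"
    unfolding a_def b_def using assms by (simp_all add: powr_powr sum_nonneg)
  have a0: "0 \<le> a" and b0: "0 \<le> b" unfolding a_def b_def by auto
  have zero: "z i = 0" if "(\<Sum>i\<in>A. norm (z i) powr r) powr (1/r) = 0" "i \<in> A" for i and z :: "'i \<Rightarrow> 'a"
  proof -
    have "(\<Sum>i\<in>A. norm (z i) powr r) = 0" using that by simp
    then show ?thesis using that assms by (subst (asm) sum_nonneg_eq_0_iff) auto
  qed
  show ?thesis
  proof (cases "a = 0 \<or> b = 0")
    case True
    then show ?thesis
    proof
      assume "a = 0"
      then have "x i = 0" if "i \<in> A" for i using zero that unfolding a_def by blast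
      then show ?thesis by simp
    next
      assume "b = 0"
      then have "y i = 0" if "i \<in> A" for i using zero that unfolding b_def by blast
      then show ?thesis by simp
    qed
  next
    case False
    then have a: "0 < a" and b: "0 < b" using a0 b0 by auto
    have "norm (x i + y i) powr r \<le> (a+b) powr r *
        (a/(a+b) * (norm (x i)/a) powr r + b/(a+b) * (norm (y i)/b) powr r)" for i
    proof -
      have "norm (x i + y i) \<le> (a+b) * (a/(a+b) * (norm (x i)/a) + b/(a+b) * (norm (y i)/b))"
        using a b norm_triangle_ineq[of "x i" "y i"] by (simp add: distrib_left)
      then have "norm (x i + y i) powr r \<le> ((a+b) * (a/(a+b) * (norm (x i)/a) + b/(a+b) * (norm (y i)/b))) powr r"
        using assms by (intro powr_mono2) auto
      also have "\<dots> = (a+b) powr r * (a/(a+b) * (norm (x i)/a) + b/(a+b) * (norm (y i)/b)) powr r"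
        using a b by (intro powr_mult) 
      also have "(a/(a+b) * (norm (x i)/a) + b/(a+b) * (norm (y i)/b)) powr r
         \<le> a/(a+b) * (norm (x i)/a) powr r + b/(a+b) * (norm (y i)/b) powr r"
        using a b assms by (intro powr_convex_combination) (auto simp: add_divide_distrib[symmetric])
      finally show ?thesis by (simp add: mult_left_mono)
    qed
    then have "(\<Sum>i\<in>A. norm (x i + y i) powr r) \<le> (\<Sum>i\<in>A. (a+b) powr r *
        (a/(a+b) * (norm (x i)/a) powr r + b/(a+b) * (norm (y i)/b) powr r))"
      by (intro sum_mono)
    also have "\<dots> = (a+b) powr r * (a/(a+b) * ((\<Sum>i\<in>A. norm (x i) powr r) / a powr r)
        + b/(a+b) * ((\<Sum>i\<in>A. norm (y i) powr r) / b powr r))"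
      using a b unfolding sum_distrib_left[symmetric] sum.distrib
      by (simp add: sum_divide_distrib powr_divide sum_distrib_left)
    also have "\<dots> = (a+b) powr r"
      unfolding ar[symmetric] br[symmetric] using a b by (simp add: add_divide_distrib[symmetric])
    finally have "(\<Sum>i\<in>A. norm (x i + y i) powr r) powr (1/r) \<le> ((a+b) powr r) powr (1/r)"
      using assms by (intro powr_mono2 sum_nonneg) auto
    also have "\<dots> = a + b" using assms a b by (simp add: powr_powr)
    finally show ?thesis unfolding a_def b_def .
  qed
qed

lemma sum_mono_blocks:
  fixes h :: "nat \<Rightarrow> 'a::comm_monoid_add"
  assumes "mono t"
  shows "(\<Sum>j<J. \<Sum>n\<in>{t j..<t (Suc j)}. h n) = (\<Sum>n\<in>{t 0..<t J}. h n)"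
proof (induction J)
  case (Suc J)
  have "t 0 \<le> t J" "t J \<le> t (Suc J)" using assms by (auto simp: mono_def)
  then show ?case using Suc by (simp add: sum.atLeastLessThan_concat)
qed auto

text \<open>
  The \<open>r\<close>-variation of the finite sequence \<open>a 0, \<dots>, a N\<close>, as a real number.
  Times are only required to be weakly increasing: repeated times contribute nothing, and a weakly monotone
  reparametrisation of the index set then never increases the value.
\<close>
definition pvar :: "real \<Rightarrow> nat \<Rightarrow> (nat \<Rightarrow> complex) \<Rightarrow> real" where
  "pvar r N a = (SUP (J, t) \<in> {(J :: nat, t :: nat \<Rightarrow> nat). mono t \<and> (\<forall>j. t j \<le> N)}.
     (\<Sum>j<J. norm (a (t (Suc j)) - a (t j)) powr r) powr (1/r))"

lemma powr_sum_increments_le_square: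
  fixes a :: "nat \<Rightarrow> complex"
  assumes "2 \<le> r" "mono t" "\<And>j. t j \<le> N"
  shows "(\<Sum>j<J. norm (a (t (Suc j)) - a (t j)) powr r) powr (1/r) \<le> 2 * sqrt (\<Sum>n\<le>N. (norm (a n))\<^sup>2)"
proof -
  let ?S = "\<Sum>n\<le>N. (norm (a n))\<^sup>2"
  have step: "(norm (a (t (Suc j)) - a (t j)))\<^sup>2 \<le>
      2 * (\<Sum>n\<in>{t j..<t (Suc j)}. (norm (a n))\<^sup>2) + 2 * (\<Sum>n\<in>{t j..<t (Suc j)}. (norm (a (Suc n)))\<^sup>2)" for j
  proof (cases "t j = t (Suc j)")
    case False
    then have lt: "t j < t (Suc j)" using assms(2) by (metis lessI less_imp_le_nat mono_def order_le_less)
    then obtain k where k: "t (Suc j) = Suc k" "t j \<le> k" by (metis less_Suc_eq_le less_imp_Suc_add add_Suc_right le_add1)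
    \<comment> \<open>a strict step is charged to the half-open interval it covers; these intervals are disjoint\<close>
    have "(norm (a (t j)))\<^sup>2 \<le> (\<Sum>n\<in>{t j..<t (Suc j)}. (norm (a n))\<^sup>2)"
      using lt by (intro member_le_sum) auto
    moreover have "(norm (a (Suc k)))\<^sup>2 \<le> (\<Sum>n\<in>{t j..<t (Suc j)}. (norm (a (Suc n)))\<^sup>2)"
      using k by (intro member_le_sum) auto
    moreover have "(norm (a (t (Suc j)) - a (t j)))\<^sup>2 \<le> (norm (a (t (Suc j))) + norm (a (t j)))\<^sup>2"
      by (intro power_mono norm_triangle_ineq4) auto
    moreover have "\<dots> \<le> 2 * (norm (a (t (Suc j))))\<^sup>2 + 2 * (norm (a (t j)))\<^sup>2"
      using sum_squares_bound[of "norm (a (t (Suc j)))" "norm (a (t j))"] by (simp add: power2_sum)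
    ultimately show ?thesis unfolding k(1) by linarith
  qed (simp add: sum_nonneg)
  have "(\<Sum>j<J. (norm (a (t (Suc j)) - a (t j)))\<^sup>2) \<le>
     2 * (\<Sum>n\<in>{t 0..<t J}. (norm (a n))\<^sup>2) + 2 * (\<Sum>n\<in>{t 0..<t J}. (norm (a (Suc n)))\<^sup>2)"
    unfolding sum_mono_blocks[OF assms(2), symmetric] sum_distrib_left sum.distrib[symmetric]
    using step by (intro sum_mono) (simp add: sum_distrib_left sum.distrib)
  also have "(\<Sum>n\<in>{t 0..<t J}. (norm (a n))\<^sup>2) \<le> ?S"
    using assms(3)[of J] by (intro sum_mono2) auto
  also have "(\<Sum>n\<in>{t 0..<t J}. (norm (a (Suc n)))\<^sup>2) = (\<Sum>n\<in>Suc ` {t 0..<t J}. (norm (a n))\<^sup>2)"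
    by (simp add: sum.reindex del: image_Suc_atLeastLessThan)
  also have "\<dots> \<le> ?S"
    using assms(3)[of J] by (intro sum_mono2) auto
  finally have *: "(\<Sum>j<J. (norm (a (t (Suc j)) - a (t j)))\<^sup>2) \<le> 2\<^sup>2 * ?S" by simp
  have "(\<Sum>j<J. norm (a (t (Suc j)) - a (t j)) powr r) powr (1/r)
      \<le> (\<Sum>j<J. norm (a (t (Suc j)) - a (t j)) powr 2) powr (1/2)"
    using assms by (intro powr_sum_le_sum_powr) auto
  also have "\<dots> = sqrt (\<Sum>j<J. (norm (a (t (Suc j)) - a (t j)))\<^sup>2)"
    by (simp add: powr_half_sqrt sum_nonneg)
  also have "\<dots> \<le> sqrt (2\<^sup>2 * ?S)" using * by (rule real_sqrt_le_mono)
  also have "\<dots> = 2 * sqrt ?S" by (simp add: real_sqrt_mult)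
  finally show ?thesis .
qed

lemma pvar_upper:
  assumes "2 \<le> r" "mono t" "\<And>j. t j \<le> N"
  shows "(\<Sum>j<J. norm (a (t (Suc j)) - a (t j)) powr r) powr (1/r) \<le> pvar r N a"
proof -
  have "bdd_above ((\<lambda>(J, t). (\<Sum>j<J. norm (a (t (Suc j)) - a (t j)) powr r) powr (1/r))
     ` {(J :: nat, t :: nat \<Rightarrow> nat). mono t \<and> (\<forall>j. t j \<le> N)})"
    using powr_sum_increments_le_square[OF assms(1), of _ N a]
    by (intro bdd_aboveI2[where M = "2 * sqrt (\<Sum>n\<le>N. (norm (a n))\<^sup>2)"]) auto
  from cSUP_upper[OF _ this, of "(J, t)"] show ?thesis using assms by (simp add: pvar_def)
qed

lemma pvar_least:
  assumes "\<And>J t. mono t \<Longrightarrow> (\<And>j. t j \<le> N) \<Longrightarrow>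
     (\<Sum>j<J. norm (a (t (Suc j)) - a (t j)) powr r) powr (1/r) \<le> B"
  shows "pvar r N a \<le> B"
proof -
  have "(0::nat, \<lambda>_. 0) \<in> {(J :: nat, t :: nat \<Rightarrow> nat). mono t \<and> (\<forall>j. t j \<le> N)}" by (auto simp: mono_def)
  then show ?thesis unfolding pvar_def by (intro cSUP_least) (use assms in \<open>auto simp del: powr_eq_0_iff\<close>)
qed

lemma pvar_nonneg: "2 \<le> r \<Longrightarrow> 0 \<le> pvar r N a"
  using pvar_upper[of r "\<lambda>_. 0" N a 0] by (simp add: mono_def)

lemma pvar_le_square: "2 \<le> r \<Longrightarrow> pvar r N a \<le> 2 * sqrt (\<Sum>n\<le>N. (norm (a n))\<^sup>2)"
  by (intro pvar_least powr_sum_increments_le_square)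

lemma pvar_add:
  assumes "2 \<le> r"
  shows "pvar r N (\<lambda>n. a n + b n) \<le> pvar r N a + pvar r N b"
proof (rule pvar_least)
  fix J :: nat and t :: "nat \<Rightarrow> nat" assume t: "mono t" "\<And>j. t j \<le> N"
  have "(\<Sum>j<J. norm (a (t (Suc j)) + b (t (Suc j)) - (a (t j) + b (t j))) powr r) powr (1/r)
     = (\<Sum>j<J. norm ((a (t (Suc j)) - a (t j)) + (b (t (Suc j)) - b (t j))) powr r) powr (1/r)"
    by (simp add: algebra_simps)
  also have "\<dots> \<le> (\<Sum>j<J. norm (a (t (Suc j)) - a (t j)) powr r) powr (1/r)
      + (\<Sum>j<J. norm (b (t (Suc j)) - b (t j)) powr r) powr (1/r)"
    using assms by (intro powr_norm_triangle) auto
  also have "\<dots> \<le> pvar r N a + pvar r N b"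
    using pvar_upper[OF assms t] by (intro add_mono) auto
  finally show "(\<Sum>j<J. norm (a (t (Suc j)) + b (t (Suc j)) - (a (t j) + b (t j))) powr r) powr (1/r)
     \<le> pvar r N a + pvar r N b" .
qed

lemma pvar_scale:
  assumes "2 \<le> r" "0 \<le> k"
  shows "pvar r N (\<lambda>n. of_real k * a n) \<le> k * pvar r N a"
proof (rule pvar_least)
  fix J :: nat and t :: "nat \<Rightarrow> nat" assume t: "mono t" "\<And>j. t j \<le> N"
  have "(\<Sum>j<J. norm (of_real k * a (t (Suc j)) - of_real k * a (t j)) powr r) powr (1/r)
     = (\<Sum>j<J. k powr r * norm (a (t (Suc j)) - a (t j)) powr r) powr (1/r)"
    using assms by (simp add: right_diff_distrib[symmetric] norm_mult powr_mult)
  also have "\<dots> = k * (\<Sum>j<J. norm (a (t (Suc j)) - a (t j)) powr r) powr (1/r)"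
    using assms by (simp add: sum_distrib_left[symmetric] powr_mult sum_nonneg powr_powr)
  also have "\<dots> \<le> k * pvar r N a"
    using pvar_upper[OF assms(1) t] assms by (intro mult_left_mono) auto
  finally show "(\<Sum>j<J. norm (of_real k * a (t (Suc j)) - of_real k * a (t j)) powr r) powr (1/r)
     \<le> k * pvar r N a" .
qed

lemma pvar_weighted_sum:
  assumes "2 \<le> r" "finite I" "\<And>i. i \<in> I \<Longrightarrow> 0 \<le> w i"
  shows "pvar r N (\<lambda>n. \<Sum>i\<in>I. of_real (w i) * a i n) \<le> (\<Sum>i\<in>I. w i * pvar r N (a i))"
  using assms(2,3)
proof (induction I rule: finite_induct)
  case empty
  show ?case using pvar_le_square[OF assms(1), of N "\<lambda>_. 0"] by simp
next
  case (insert i I)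
  have "pvar r N (\<lambda>n. of_real (w i) * a i n + (\<Sum>i\<in>I. of_real (w i) * a i n))
    \<le> pvar r N (\<lambda>n. of_real (w i) * a i n) + pvar r N (\<lambda>n. \<Sum>i\<in>I. of_real (w i) * a i n)"
    by (rule pvar_add[OF assms(1)])
  also have "\<dots> \<le> w i * pvar r N (a i) + (\<Sum>i\<in>I. w i * pvar r N (a i))"
    using insert.IH insert.prems by (intro add_mono pvar_scale assms(1)) auto
  finally show ?case using insert by simp
qed

section \<open>The variational inequality of Lepingle\<close>

text \<open>
  The following three functions are pathwise: \<open>rmax x t\<close> is the running maximum of
  \<open>\<bar>x\<bar>\<close> up to time \<open>t\<close>.
\<close>
primrec rmax :: "(nat \<Rightarrow> complex) \<Rightarrow> nat \<Rightarrow> real" where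
  "rmax x 0 = norm (x 0)"
| "rmax x (Suc t) = max (rmax x t) (norm (x (Suc t)))"

text \<open>
  The anchor is the value of the path at the last stopping time. The next stopping time is the first time at
  which the path is at distance at least \<open>\<theta>\<close> times the \<^emph>\<open>current\<close>
  running maximum from the anchor. Measuring jumps against the running maximum makes the threshold adapted;
  since no increment exceeds twice the running maximum, only small \<open>\<theta>\<close> matter.
\<close>
primrec anchor :: "real \<Rightarrow> (nat \<Rightarrow> complex) \<Rightarrow> nat \<Rightarrow> complex" where
  "anchor \<theta> x 0 = x 0"
| "anchor \<theta> x (Suc t) =
    (if \<theta> * rmax x (Suc t) \<le> norm (x (Suc t) - anchor \<theta> x t) then x (Suc t) else anchor \<theta> x t)"

text \<open>
  The sum of the squared jumps between consecutive stopping times up to time \<open>t\<close>.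
\<close>
primrec jump_sq :: "real \<Rightarrow> (nat \<Rightarrow> complex) \<Rightarrow> nat \<Rightarrow> real" where
  "jump_sq \<theta> x 0 = 0"
| "jump_sq \<theta> x (Suc t) = jump_sq \<theta> x t +
    (if \<theta> * rmax x (Suc t) \<le> norm (x (Suc t) - anchor \<theta> x t)
     then (norm (x (Suc t) - anchor \<theta> x t))\<^sup>2 else 0)"

lemma rmax_nonneg: "0 \<le> rmax x t"
  by (induction t) (auto simp: le_max_iff_disj)

lemma rmax_mono: "s \<le> t \<Longrightarrow> rmax x s \<le> rmax x t"
  by (rule lift_Suc_mono_le) auto

lemma norm_le_rmax: "s \<le> t \<Longrightarrow> norm (x s) \<le> rmax x t"
proof -
  have "norm (x s) \<le> rmax x s" by (cases s) auto
  then show "s \<le> t \<Longrightarrow> norm (x s) \<le> rmax x t" using rmax_mono[of s t x] by linarith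
qed

lemma rmax_attained: "\<exists>s\<le>t. rmax x t = norm (x s)"
proof (induction t)
  case (Suc t)
  then show ?case by (auto simp: max_def intro: le_SucI)
qed auto

lemma jump_sq_mono: "s \<le> t \<Longrightarrow> jump_sq \<theta> x s \<le> jump_sq \<theta> x t"
  by (rule lift_Suc_mono_le) auto

lemma jump_sq_nonneg: "0 \<le> jump_sq \<theta> x t"
  using jump_sq_mono[of 0 t \<theta> x] by simp

lemma norm_diff_anchor_le:
  assumes "0 < \<theta>" shows "norm (x t - anchor \<theta> x t) \<le> \<theta> * rmax x t"
  using assms rmax_nonneg[of x t] by (cases t) auto

text \<open>
  Either no stopping time in \<open>(t, t']\<close> moves the anchor, or \<open>s\<close> is the last
  stopping time in that interval.
\<close>
lemma anchor_cases:
  assumes "0 < \<theta>" "t \<le> t'"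
  shows "anchor \<theta> x t' = anchor \<theta> x t \<or>
    (\<exists>s. t < s \<and> s \<le> t' \<and> (\<forall>v. s \<le> v \<longrightarrow> v \<le> t' \<longrightarrow> anchor \<theta> x v = x s) \<and>
      (\<theta> * rmax x s)\<^sup>2 \<le> jump_sq \<theta> x t' - jump_sq \<theta> x t)"
  using assms(2)
proof (induction t' rule: dec_induct)
  case (step n)
  show ?case
  proof (cases "\<theta> * rmax x (Suc n) \<le> norm (x (Suc n) - anchor \<theta> x n)")
    case True
    then have "(\<theta> * rmax x (Suc n))\<^sup>2 \<le> jump_sq \<theta> x (Suc n) - jump_sq \<theta> x n"
      using assms(1) rmax_nonneg[of x "Suc n"] by (auto intro!: power_mono simp del: rmax.simps)
    then have "(\<theta> * rmax x (Suc n))\<^sup>2 \<le> jump_sq \<theta> x (Suc n) - jump_sq \<theta> x t"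
      using jump_sq_mono[OF step(1), of \<theta> x] by linarith
    then show ?thesis using True step(1)
      by (intro disjI2 exI[of _ "Suc n"]) (auto simp del: rmax.simps jump_sq.simps simp: le_antisym)
  next
    case False
    then have a: "anchor \<theta> x (Suc n) = anchor \<theta> x n" and j: "jump_sq \<theta> x (Suc n) = jump_sq \<theta> x n"
      by (auto simp del: rmax.simps)
    from step.IH show ?thesis
    proof
      assume "anchor \<theta> x n = anchor \<theta> x t"
      then show ?thesis using a by simp
    next
      assume "\<exists>s. t < s \<and> s \<le> n \<and> (\<forall>v. s \<le> v \<longrightarrow> v \<le> n \<longrightarrow> anchor \<theta> x v = x s) \<and>
          (\<theta> * rmax x s)\<^sup>2 \<le> jump_sq \<theta> x n - jump_sq \<theta> x t"
      then obtain s where s: "t < s" "s \<le> n" "\<forall>v. s \<le> v \<longrightarrow> v \<le> n \<longrightarrow> anchor \<theta> x v = x s"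
        "(\<theta> * rmax x s)\<^sup>2 \<le> jump_sq \<theta> x n - jump_sq \<theta> x t" by blast
      have "anchor \<theta> x v = x s" if "s \<le> v" "v \<le> Suc n" for v
        using s(2,3) that a by (cases "v = Suc n") auto
      then show ?thesis using s j by (intro disjI2 exI[of _ s]) auto
    qed
  qed
qed auto

text \<open>
  An increment that is large compared with the running maximum forces a jump of comparable size within the
  same time interval. Summed over disjoint intervals the right-hand sides telescope.
\<close>
lemma large_increment_le_jump_sq:
  assumes \<theta>: "0 < \<theta>" "\<theta> \<le> 1/4" and t: "t \<le> t'"
    and big: "2 * \<theta> * rmax x t' < norm (x t' - x t)"
  shows "(\<theta> * rmax x t')\<^sup>2 \<le> 4 * (jump_sq \<theta> x t' - jump_sq \<theta> x t)"
proof -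
  have "\<theta> * rmax x t \<le> \<theta> * rmax x t'" using \<theta> rmax_mono[OF t] by simp
  then have near: "norm (x t - anchor \<theta> x t) \<le> \<theta> * rmax x t'"
    "norm (x t' - anchor \<theta> x t') \<le> \<theta> * rmax x t'"
    using norm_diff_anchor_le[OF \<theta>(1), of x t] norm_diff_anchor_le[OF \<theta>(1), of x t'] by linarith+
  have "anchor \<theta> x t' \<noteq> anchor \<theta> x t"
  proof
    assume "anchor \<theta> x t' = anchor \<theta> x t"
    then have "x t' - x t = (x t' - anchor \<theta> x t') - (x t - anchor \<theta> x t)" by simp
    then have "norm (x t' - x t) \<le> norm (x t' - anchor \<theta> x t') + norm (x t - anchor \<theta> x t)"
      by (metis norm_triangle_ineq4)
    then show False using near big by linarith
  qed
  then obtain s where s: "t < s" "s \<le> t'" "\<And>v. s \<le> v \<Longrightarrow> v \<le> t' \<Longrightarrow> anchor \<theta> x v = x s"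
     "(\<theta> * rmax x s)\<^sup>2 \<le> jump_sq \<theta> x t' - jump_sq \<theta> x t"
    using anchor_cases[OF \<theta>(1) t, of x] by auto
  obtain v where v: "v \<le> t'" "rmax x t' = norm (x v)" using rmax_attained by blast
  \<comment> \<open>after the last stopping time the path stays near the anchor, so the maximum cannot have doubled\<close>
  have "rmax x t' \<le> 2 * rmax x s"
  proof (cases "v \<le> s")
    case True
    then show ?thesis using v norm_le_rmax[of v s x] rmax_nonneg[of x s] by linarith
  next
    case False
    then have "norm (x v - x s) \<le> \<theta> * rmax x v"
      using norm_diff_anchor_le[OF \<theta>(1), of x v] s(3)[of v] v by auto
    also have "\<dots> \<le> 1/4 * rmax x t'"
      using \<theta> rmax_mono[OF v(1), of x] rmax_nonneg[of x v] by (intro mult_mono) auto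
    finally have "norm (x v) \<le> norm (x s) + 1/4 * rmax x t'"
      using norm_triangle_ineq2[of "x v" "x s"] by linarith
    then show ?thesis using v norm_le_rmax[of s s x] rmax_nonneg[of x s] by simp
  qed
  then have "(\<theta> * rmax x t')\<^sup>2 \<le> (\<theta> * (2 * rmax x s))\<^sup>2"
    using \<theta> rmax_nonneg[of x t'] by (intro power_mono mult_left_mono) auto
  also have "\<dots> = 4 * (\<theta> * rmax x s)\<^sup>2" by (simp add: power2_eq_square)
  also have "\<dots> \<le> 4 * (jump_sq \<theta> x t' - jump_sq \<theta> x t)" using s(4) by (rule mult_left_mono) simp
  finally show ?thesis .
qed

text \<open>
  Every nonzero increment is seen at one of the dyadic thresholds \<open>2^(-l)/4\<close>.
\<close>
lemma increment_scale_exists: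
  assumes "t \<le> t'" "x t' \<noteq> x t"
  shows "\<exists>l::nat. norm (x t' - x t) \<le> 2 * (1/2)^l * rmax x t' \<and>
     (norm (x t' - x t))\<^sup>2 \<le> 256 * (jump_sq ((1/2)^l/4) x t' - jump_sq ((1/2)^l/4) x t)"
proof -
  define \<Delta> where "\<Delta> = norm (x t' - x t)"
  define R where "R = rmax x t'"
  have \<Delta>: "0 < \<Delta>" using assms by (simp add: \<Delta>_def)
  have "\<Delta> \<le> 2 * R"
    unfolding \<Delta>_def R_def using norm_triangle_ineq4[of "x t'" "x t"] norm_le_rmax[OF assms(1), of x]
      norm_le_rmax[of t' t' x] by simp
  then have R: "0 < R" using \<Delta> by linarith
  obtain n where n: "(1/2::real)^n < \<Delta> / (2*R)"
    using real_arch_pow_inv[of "\<Delta> / (2*R)" "1/2"] \<Delta> R by auto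
  define k where "k = (LEAST n. (1/2::real)^n < \<Delta> / (2*R))"
  have k: "(1/2::real)^k < \<Delta> / (2*R)" unfolding k_def using n by (rule LeastI)
  have "\<Delta> / (2*R) \<le> 1" using \<open>\<Delta> \<le> 2 * R\<close> R by simp
  then have "k \<noteq> 0" using k by (intro notI) simp
  then obtain l where l: "k = Suc l" by (cases k) auto
  have "\<not> (1/2::real)^l < \<Delta> / (2*R)" using not_less_Least[of l "\<lambda>n. (1/2::real)^n < \<Delta> / (2*R)"] l k_def by simp
  then have up: "\<Delta> \<le> 2 * (1/2)^l * R" using R by (simp add: field_simps)
  have lo: "(1/2)^l * R < \<Delta>" using k l R by (simp add: field_simps)
  have "((1/2)^l/4 * R)\<^sup>2 \<le> 4 * (jump_sq ((1/2)^l/4) x t' - jump_sq ((1/2)^l/4) x t)"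
    unfolding R_def
  proof (rule large_increment_le_jump_sq[OF _ _ assms(1)])
    show "(1/2::real)^l/4 \<le> 1/4" by (simp add: power_le_one)
    show "2 * ((1/2)^l/4) * rmax x t' < norm (x t' - x t)"
      using lo R \<Delta> unfolding R_def[symmetric] \<Delta>_def[symmetric] by linarith
  qed auto
  moreover have "\<Delta>\<^sup>2 \<le> (8 * ((1/2)^l/4 * R))\<^sup>2" using up \<Delta> by (intro power_mono) (auto simp: mult_ac)
  ultimately have "\<Delta>\<^sup>2 \<le> 256 * (jump_sq ((1/2)^l/4) x t' - jump_sq ((1/2)^l/4) x t)"
    unfolding power_mult_distrib by simp
  then show ?thesis using up unfolding \<Delta>_def R_def by blast
qed

text \<open>
  A pathwise form of Doob's \<open>L\<^sup>2\<close> maximal inequality: the last sum has nonnegative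
  expectation for a martingale.
\<close>
lemma rmax_sq_le:
  "(rmax x T)\<^sup>2 \<le> 4 * (norm (x T))\<^sup>2 - 4 * (\<Sum>t<T. rmax x t * (norm (x (Suc t)) - norm (x t)))"
proof -
  have "(rmax x T)\<^sup>2 / 2 + (norm (x 0))\<^sup>2 / 2 + (\<Sum>t<T. rmax x t * (norm (x (Suc t)) - norm (x t))) \<le> rmax x T * norm (x T)"
  proof (induction T)
    case 0
    show ?case by (simp add: power2_eq_square)
  next
    case (Suc T)
    let ?m = "rmax x T" and ?y = "norm (x (Suc T))"
    have "rmax x T * norm (x T) - ?m\<^sup>2/2 + ?m * (?y - norm (x T)) \<le> max ?m ?y * ?y - (max ?m ?y)\<^sup>2/2"
    proof (cases "?y \<le> ?m")
      case False
      have "0 \<le> (?y - ?m)\<^sup>2" by simp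
      then show ?thesis using False by (simp add: max_def power2_eq_square algebra_simps)
    qed (simp add: max_def algebra_simps)
    then show ?case using Suc.IH by simp
  qed
  moreover have "0 \<le> (rmax x T / 2 - norm (x T))\<^sup>2" by simp
  then have "rmax x T * norm (x T) \<le> (rmax x T)\<^sup>2 / 4 + (norm (x T))\<^sup>2"
    by (simp add: power2_eq_square algebra_simps)
  moreover have "0 \<le> (norm (x 0))\<^sup>2" by simp
  ultimately show ?thesis by linarith
qed

lemma rmax_stopped: "s \<le> t \<Longrightarrow> rmax (\<lambda>u. x (min u t)) s = rmax x s"
  by (induction s) auto

lemma anchor_stopped: "s \<le> t \<Longrightarrow> anchor \<theta> (\<lambda>u. x (min u t)) s = anchor \<theta> x s"
proof (induction s)
  case (Suc s)
  then have "rmax (\<lambda>u. x (min u t)) (Suc s) = rmax x (Suc s)" by (intro rmax_stopped)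
  then show ?case using Suc by (simp del: rmax.simps)
qed auto

text \<open>
  A martingale on a finite measure space, without a filtration: the increments are orthogonal to all
  functions of the past of the process. The function \<open>a\<close> receives the stopped path, which
  carries exactly the values up to time \<open>t\<close>.
\<close>
locale finite_martingale =
  fixes \<Omega> :: "'w set" and \<mu> :: "'w \<Rightarrow> real" and X :: "nat \<Rightarrow> 'w \<Rightarrow> complex" and T :: nat
  assumes finite_space: "finite \<Omega>" and weight_nonneg: "\<omega> \<in> \<Omega> \<Longrightarrow> 0 \<le> \<mu> \<omega>"
    and orthogonal: "t < T \<Longrightarrow>
      (\<Sum>\<omega>\<in>\<Omega>. of_real (\<mu> \<omega>) * ((X (Suc t) \<omega> - X t \<omega>) * cnj (a (\<lambda>s. X (min s t) \<omega>)))) = 0"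
begin

lemma orthogonal_Re:
  assumes "t < T"
  shows "(\<Sum>\<omega>\<in>\<Omega>. \<mu> \<omega> * Re ((X (Suc t) \<omega> - X t \<omega>) * cnj (a (\<lambda>s. X (min s t) \<omega>)))) = 0"
  using arg_cong[where f = Re, OF orthogonal[OF assms, of a]] by (simp only: Re_sum Re_complex_of_real zero_complex.sel) (simp add: algebra_simps)

text \<open>
  With \<open>Y t = jump_sq t + \<bar>X t - anchor t\<bar>\<^sup>2\<close> one has \<open>Y (t + 1) - Y t =
  \<bar>X (t + 1) - anchor t\<bar>\<^sup>2 - \<bar>X t - anchor t\<bar>\<^sup>2\<close>, whether or not
  \<open>t + 1\<close> is a stopping time; by orthogonality this has the expectation of \<open>\<bar>X (t +
  1)\<bar>\<^sup>2 - \<bar>X t\<bar>\<^sup>2\<close>, and no stopping times need to be enumerated.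
\<close>
lemma jump_sq_expectation_le:
  assumes "0 < \<theta>"
  shows "(\<Sum>\<omega>\<in>\<Omega>. \<mu> \<omega> * jump_sq \<theta> (\<lambda>t. X t \<omega>) T) \<le> (\<Sum>\<omega>\<in>\<Omega>. \<mu> \<omega> * (norm (X T \<omega>))\<^sup>2)"
proof -
  define Y where "Y t \<omega> = jump_sq \<theta> (\<lambda>t. X t \<omega>) t + (norm (X t \<omega> - anchor \<theta> (\<lambda>t. X t \<omega>) t))\<^sup>2" for t \<omega>
  have Ystep: "Y (Suc t) \<omega> = jump_sq \<theta> (\<lambda>t. X t \<omega>) t + (norm (X (Suc t) \<omega> - anchor \<theta> (\<lambda>t. X t \<omega>) t))\<^sup>2" for t \<omega>
    by (simp add: Y_def)
  have sq: "(norm (u - c))\<^sup>2 - (norm (v - c))\<^sup>2 = (norm u)\<^sup>2 - (norm v)\<^sup>2 - 2 * Re ((u - v) * cnj c)" for u v c :: complex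
    unfolding cmod_power2 by (simp add: power2_eq_square algebra_simps)
  have "(\<Sum>\<omega>\<in>\<Omega>. \<mu> \<omega> * Y t \<omega>) \<le> (\<Sum>\<omega>\<in>\<Omega>. \<mu> \<omega> * (norm (X t \<omega>))\<^sup>2)" if "t \<le> T" for t
    using that
  proof (induction t)
    case 0
    show ?case by (auto simp: Y_def intro!: sum_nonneg mult_nonneg_nonneg weight_nonneg)
  next
    case (Suc t)
    have anc: "anchor \<theta> (\<lambda>s. X (min s t) \<omega>) t = anchor \<theta> (\<lambda>s. X s \<omega>) t" for \<omega>
      using anchor_stopped[OF order_refl, of \<theta> "\<lambda>s. X s \<omega>" t] by simp
    have "(\<Sum>\<omega>\<in>\<Omega>. \<mu> \<omega> * Y (Suc t) \<omega>) - (\<Sum>\<omega>\<in>\<Omega>. \<mu> \<omega> * Y t \<omega>) =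
       (\<Sum>\<omega>\<in>\<Omega>. \<mu> \<omega> * ((norm (X (Suc t) \<omega>))\<^sup>2 - (norm (X t \<omega>))\<^sup>2
         - 2 * Re ((X (Suc t) \<omega> - X t \<omega>) * cnj (anchor \<theta> (\<lambda>t. X t \<omega>) t))))"
      unfolding sum_subtractf[symmetric] right_diff_distrib[symmetric] Ystep
      unfolding Y_def sq[symmetric] by (simp add: algebra_simps)
    also have "\<dots> = (\<Sum>\<omega>\<in>\<Omega>. \<mu> \<omega> * (norm (X (Suc t) \<omega>))\<^sup>2) - (\<Sum>\<omega>\<in>\<Omega>. \<mu> \<omega> * (norm (X t \<omega>))\<^sup>2)
       - 2 * (\<Sum>\<omega>\<in>\<Omega>. \<mu> \<omega> * Re ((X (Suc t) \<omega> - X t \<omega>) * cnj (anchor \<theta> (\<lambda>s. X (min s t) \<omega>) t)))"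
      unfolding anc by (simp add: right_diff_distrib sum_subtractf sum_distrib_left mult.left_commute)
    also have "(\<Sum>\<omega>\<in>\<Omega>. \<mu> \<omega> * Re ((X (Suc t) \<omega> - X t \<omega>) * cnj (anchor \<theta> (\<lambda>s. X (min s t) \<omega>) t))) = 0"
      using orthogonal_Re[of t "\<lambda>x. anchor \<theta> x t"] Suc.prems by simp
    finally show ?case using Suc by linarith
  qed
  from this[OF order_refl]
  have "(\<Sum>\<omega>\<in>\<Omega>. \<mu> \<omega> * Y T \<omega>) \<le> (\<Sum>\<omega>\<in>\<Omega>. \<mu> \<omega> * (norm (X T \<omega>))\<^sup>2)" .
  moreover have "(\<Sum>\<omega>\<in>\<Omega>. \<mu> \<omega> * jump_sq \<theta> (\<lambda>t. X t \<omega>) T) \<le> (\<Sum>\<omega>\<in>\<Omega>. \<mu> \<omega> * Y T \<omega>)"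
    by (intro sum_mono mult_left_mono weight_nonneg) (auto simp: Y_def)
  ultimately show ?thesis by linarith
qed

lemma doob_maximal:
  "(\<Sum>\<omega>\<in>\<Omega>. \<mu> \<omega> * (rmax (\<lambda>t. X t \<omega>) T)\<^sup>2) \<le> 4 * (\<Sum>\<omega>\<in>\<Omega>. \<mu> \<omega> * (norm (X T \<omega>))\<^sup>2)"
proof -
  let "?d t \<omega>" = "rmax (\<lambda>t. X t \<omega>) t * (norm (X (Suc t) \<omega>) - norm (X t \<omega>))"
  define a where "a t x = of_real (rmax x t) * sgn (x t)" for t and x :: "nat \<Rightarrow> complex"
  have norm_diff: "rmax x t * (norm u - norm (x t)) \<ge> Re ((u - x t) * cnj (a t x))" for u x t
  proof -
    have "Re (u * cnj (sgn (x t))) \<le> norm u"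
    proof -
      have "Re (u * cnj (sgn (x t))) \<le> norm (u * cnj (sgn (x t)))" by (rule complex_Re_le_cmod)
      also have "\<dots> \<le> norm u" by (simp add: norm_mult norm_sgn)
      finally show ?thesis .
    qed
    moreover have "Re (x t * cnj (sgn (x t))) = norm (x t)"
    proof (cases "x t = 0")
      case False
      then show ?thesis
        by (simp add: sgn_eq complex_norm_square[symmetric] power2_eq_square)
    qed auto
    ultimately have "Re ((u - x t) * cnj (sgn (x t))) \<le> norm u - norm (x t)"
      by (simp add: left_diff_distrib)
    from mult_left_mono[OF this rmax_nonneg[of x t]] show ?thesis
      unfolding a_def by (simp add: algebra_simps)
  qed
  have sub: "0 \<le> (\<Sum>\<omega>\<in>\<Omega>. \<mu> \<omega> * (?d t \<omega>))" if "t < T" for t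
  proof -
    have "a t (\<lambda>s. X (min s t) \<omega>) = a t (\<lambda>s. X s \<omega>)" for \<omega>
      unfolding a_def using rmax_stopped[OF order_refl, of "\<lambda>s. X s \<omega>" t] by simp
    then have "0 = (\<Sum>\<omega>\<in>\<Omega>. \<mu> \<omega> * Re ((X (Suc t) \<omega> - X t \<omega>) * cnj (a t (\<lambda>s. X s \<omega>))))"
      using orthogonal_Re[OF that, of "a t"] by simp
    also have "\<dots> \<le> (\<Sum>\<omega>\<in>\<Omega>. \<mu> \<omega> * (?d t \<omega>))"
      using norm_diff[of _ "\<lambda>t. X t _" t] by (intro sum_mono mult_left_mono weight_nonneg) auto
    finally show ?thesis .
  qed
  have "(\<Sum>\<omega>\<in>\<Omega>. \<mu> \<omega> * (rmax (\<lambda>t. X t \<omega>) T)\<^sup>2) \<le> (\<Sum>\<omega>\<in>\<Omega>. \<mu> \<omega> * (4 * (norm (X T \<omega>))\<^sup>2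
     - 4 * (\<Sum>t<T. ?d t \<omega>)))"
    by (intro sum_mono mult_left_mono rmax_sq_le weight_nonneg)
  also have "\<dots> = 4 * (\<Sum>\<omega>\<in>\<Omega>. \<mu> \<omega> * (norm (X T \<omega>))\<^sup>2)
     - 4 * (\<Sum>\<omega>\<in>\<Omega>. \<Sum>t<T. \<mu> \<omega> * (?d t \<omega>))"
    by (simp add: right_diff_distrib sum_subtractf sum_distrib_left mult.left_commute)
  also have "(\<Sum>\<omega>\<in>\<Omega>. \<Sum>t<T. \<mu> \<omega> * (?d t \<omega>))
     = (\<Sum>t<T. \<Sum>\<omega>\<in>\<Omega>. \<mu> \<omega> * (?d t \<omega>))"
    by (rule sum.swap)
  moreover have "0 \<le> (\<Sum>t<T. \<Sum>\<omega>\<in>\<Omega>. \<mu> \<omega> * (?d t \<omega>))"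
    by (rule sum_nonneg) (use sub in auto)
  ultimately show ?thesis by linarith
qed

end

lemma two_powr_geometric:
  fixes s :: real assumes "0 < s" shows "1 / (1 - (1/2) powr s) \<le> (s + 2) / s"
proof -
  have "1 + s * ln 2 \<le> exp (s * ln 2)" by (rule exp_ge_add_one_self)
  moreover have "s * (1/2) \<le> s * ln 2" using ln2_ge_two_thirds assms by (intro mult_left_mono) auto
  moreover have "2 powr s = exp (s * ln 2)" by (simp add: powr_def)
  ultimately have A: "1 + s/2 \<le> 2 powr s" by linarith
  have "(1/2) powr s = 1 / 2 powr s" by (simp add: powr_divide)
  also have "\<dots> \<le> 1 / (1 + s/2)" using A assms by (intro divide_left_mono) auto
  finally have "s / (s+2) \<le> 1 - (1/2) powr s" using assms by (simp add: field_simps)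
  moreover have "0 < s / (s+2)" using assms by simp
  ultimately have "1 / (1 - (1/2) powr s) \<le> 1 / (s / (s+2))"
    by (intro frac_le) simp_all
  then show ?thesis by simp
qed

lemma powr_interpolate:
  fixes a b :: real
  assumes "0 \<le> a" "0 \<le> b" "2 < r"
  shows "a powr ((r-2)/r) * b powr (2/r) \<le> a + b"
proof -
  let ?m = "max a b"
  have "a powr ((r-2)/r) * b powr (2/r) \<le> ?m powr ((r-2)/r) * ?m powr (2/r)"
    using assms by (intro mult_mono powr_mono2) auto
  also have "\<dots> = ?m powr 1" using assms by (simp add: powr_add[symmetric] diff_divide_distrib)
  also have "\<dots> \<le> a + b" using assms by (simp add: max_def)
  finally show ?thesis .
qed

text \<open>
  The pathwise core of the inequality. For \<open>\<Delta> \<le> 2^(1-l) R\<close> one writes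
  \<open>\<Delta>^r = \<Delta>^(r-2) \<Delta>\<^sup>2\<close>, bounds the first factor by the scale and the
  second by the jumps at that scale. Time is reversed because the martingales below run backwards; this does
  not change the variation. The number \<open>L\<close> of scales is finite, as a single path has finitely
  many increments.
\<close>
lemma pvar_reversed_path_le:
  assumes r: "2 < r"
  shows "\<exists>L. (pvar r T (\<lambda>n. x (T - n)))\<^sup>2 \<le>
     1024 * ((rmax x T)\<^sup>2 + (\<Sum>l<L. ((1/2) powr (r-2))^l * jump_sq ((1/2)^l/4) x T))"
proof -
  let ?j = "\<lambda>l t. jump_sq ((1/2)^l/4) x t"
  define good where "good l t t' \<longleftrightarrow> norm (x t' - x t) \<le> 2 * (1/2)^l * rmax x t' \<and>
     (norm (x t' - x t))\<^sup>2 \<le> 256 * (?j l t' - ?j l t)" for l t t'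
  have "\<exists>L. \<forall>t'\<le>T. \<forall>t\<le>t'. x t' \<noteq> x t \<longrightarrow> (\<exists>l<L. good l t t')"
  proof -
    have "\<forall>p\<in>{(t, t'). t \<le> t' \<and> t' \<le> T \<and> x t' \<noteq> x t}. \<exists>l. good l (fst p) (snd p)"
    proof (clarify, unfold fst_conv snd_conv)
      fix t t' assume "t \<le> t'" "x t' \<noteq> x t"
      from increment_scale_exists[OF this] show "\<exists>l. good l t t'" unfolding good_def .
    qed
    from bchoice[OF this] obtain lf
      where lf: "\<forall>p\<in>{(t, t'). t \<le> t' \<and> t' \<le> T \<and> x t' \<noteq> x t}. good (lf p) (fst p) (snd p)" by blast
    have "finite {(t, t'). t \<le> t' \<and> t' \<le> T \<and> x t' \<noteq> x t}"
      by (rule finite_subset[of _ "{..T} \<times> {..T}"]) auto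
    then have fin: "finite (lf ` {(t, t'). t \<le> t' \<and> t' \<le> T \<and> x t' \<noteq> x t})" by blast
    define L where "L = Suc (Max (lf ` {(t, t'). t \<le> t' \<and> t' \<le> T \<and> x t' \<noteq> x t}))"
    have "lf (t, t') < L \<and> good (lf (t, t')) t t'" if "t \<le> t'" "t' \<le> T" "x t' \<noteq> x t" for t t'
    proof
      show "lf (t, t') < L" unfolding L_def using that by (intro le_imp_less_Suc Max_ge[OF fin]) auto
      show "good (lf (t, t')) t t'" using bspec[OF lf, of "(t, t')"] that by simp
    qed
    then show ?thesis by blast
  qed
  then obtain L where L: "\<And>t t'. t \<le> t' \<Longrightarrow> t' \<le> T \<Longrightarrow> x t' \<noteq> x t \<Longrightarrow> \<exists>l<L. good l t t'" by blast
  define R where "R = rmax x T"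
  let ?A = "2 powr (r-2) * R powr (r-2) * 256"
  define c where "c = (1/2::real) powr (r-2)"
  have R0: "0 \<le> R" unfolding R_def by (rule rmax_nonneg)
  define S where "S = (\<Sum>l<L. c^l * ?j l T)"
  have S0: "0 \<le> S" unfolding S_def c_def by (intro sum_nonneg mult_nonneg_nonneg jump_sq_nonneg) auto
  have incr: "norm (x t' - x t) powr r \<le> (\<Sum>l<L. ?A * (c^l * (?j l t' - ?j l t)))"
    if t: "t \<le> t'" "t' \<le> T" for t t'
  proof -
    have nn: "0 \<le> ?A * (c^l * (?j l t' - ?j l t))" for l
      using jump_sq_mono[OF t(1), of _ x] by (intro mult_nonneg_nonneg) (auto simp: c_def)
    show ?thesis
    proof (cases "x t' = x t")
      case True
      then show ?thesis using nn by (simp add: sum_nonneg)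
    next
      case False
      then obtain l where l: "l < L" "good l t t'" using L t by blast
      let ?\<Delta> = "norm (x t' - x t)"
      have "?\<Delta> \<le> 2 * (1/2)^l * R"
        using l(2) rmax_mono[OF t(2), of x] unfolding good_def R_def
        by (meson mult_left_mono order_trans zero_le_mult_iff zero_le_numeral zero_le_power zero_le_divide_1_iff)
      then have "?\<Delta> powr (r-2) \<le> (2 * (1/2)^l * R) powr (r-2)" using r by (intro powr_mono2) auto
      also have "\<dots> = 2 powr (r-2) * c^l * R powr (r-2)"
        by (simp add: powr_mult c_def powr_powr mult.commute powr_realpow[symmetric])
      finally have 1: "?\<Delta> powr (r-2) \<le> 2 powr (r-2) * c^l * R powr (r-2)" .
      have "?\<Delta> powr r = ?\<Delta> powr (r-2) * ?\<Delta>\<^sup>2"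
        using False by (simp add: powr_diff)
      also have "\<dots> \<le> (2 powr (r-2) * c^l * R powr (r-2)) * (256 * (?j l t' - ?j l t))"
        using 1 l(2) by (intro mult_mono) (auto simp: good_def c_def)
      also have "\<dots> = ?A * (c^l * (?j l t' - ?j l t))" by simp
      also have "\<dots> \<le> (\<Sum>l<L. ?A * (c^l * (?j l t' - ?j l t)))"
        using l(1) nn by (intro member_le_sum) auto
      finally show ?thesis .
    qed
  qed
  have "pvar r T (\<lambda>n. x (T - n)) \<le> (?A * S) powr (1/r)"
  proof (rule pvar_least)
    fix J :: nat and t :: "nat \<Rightarrow> nat" assume t: "mono t" "\<And>j. t j \<le> T"
    have "(\<Sum>j<J. norm (x (T - t (Suc j)) - x (T - t j)) powr r)
       = (\<Sum>j<J. norm (x (T - t j) - x (T - t (Suc j))) powr r)"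
      by (simp add: norm_minus_commute)
    also have "\<dots> \<le> (\<Sum>j<J. \<Sum>l<L. ?A * (c^l * (?j l (T - t j) - ?j l (T - t (Suc j)))))"
      using t(1) by (intro sum_mono incr) (auto simp: mono_def intro: diff_le_mono2)
    also have "\<dots> = (\<Sum>l<L. ?A * (c^l * (\<Sum>j<J. ?j l (T - t j) - ?j l (T - t (Suc j)))))"
      by (subst sum.swap) (simp add: sum_distrib_left)
    also have "\<dots> \<le> (\<Sum>l<L. ?A * (c^l * ?j l T))"
    proof (intro sum_mono mult_left_mono)
      fix l
      have "(\<Sum>j<J. ?j l (T - t j) - ?j l (T - t (Suc j))) = ?j l (T - t 0) - ?j l (T - t J)"
        by (rule sum_lessThan_telescope')
      also have "\<dots> \<le> ?j l T" using jump_sq_nonneg[of _ x "T - t J"] jump_sq_mono[of "T - t 0" T _ x]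
        by (smt (verit) diff_le_self)
      finally show "(\<Sum>j<J. ?j l (T - t j) - ?j l (T - t (Suc j))) \<le> ?j l T" .
    qed (auto simp: c_def)
    also have "\<dots> = ?A * S" by (simp add: S_def sum_distrib_left)
    finally show "(\<Sum>j<J. norm (x (T - t (Suc j)) - x (T - t j)) powr r) powr (1/r)
        \<le> (?A * S) powr (1/r)"
      using r by (intro powr_mono2 sum_nonneg) auto
  qed
  then have "(pvar r T (\<lambda>n. x (T - n)))\<^sup>2 \<le> ((?A * S) powr (1/r))\<^sup>2"
    using r by (intro power_mono pvar_nonneg) auto
  also have "\<dots> = (?A * S) powr (2/r)"
    by (simp add: power2_eq_square powr_add[symmetric])
  also have "\<dots> = 2 powr (2*(r-2)/r) * 256 powr (2/r) * ((R\<^sup>2) powr ((r-2)/r) * S powr (2/r))"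
  proof -
    have "(R powr (r-2)) powr (2/r) = (R\<^sup>2) powr ((r-2)/r)"
    proof -
      have "R\<^sup>2 = R powr 2" using R0 by simp
      then show ?thesis by (simp only: powr_powr) (simp add: field_simps)
    qed
    moreover have "((2::real) powr (r-2)) powr (2/r) = 2 powr (2*(r-2)/r)"
      by (simp add: powr_powr field_simps)
    ultimately show ?thesis using S0 R0 by (simp add: powr_mult)
  qed
  also have "\<dots> \<le> 4 * 256 * (R\<^sup>2 + S)"
  proof (intro mult_mono)
    have "2 powr (2*(r-2)/r) \<le> (2::real) powr 2" using r by (intro powr_mono) (auto simp: field_simps)
    then show "2 powr (2*(r-2)/r) \<le> (4::real)" by simp
    have "256 powr (2/r) \<le> (256::real) powr 1" using r by (intro powr_mono) (auto simp: field_simps)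
    then show "256 powr (2/r) \<le> (256::real)" by simp
    show "(R\<^sup>2) powr ((r-2)/r) * S powr (2/r) \<le> R\<^sup>2 + S" using S0 r by (intro powr_interpolate) auto
  qed auto
  finally have "(pvar r T (\<lambda>n. x (T - n)))\<^sup>2 \<le> 1024 * (R\<^sup>2 + S)" by simp
  then show ?thesis unfolding R_def S_def c_def by blast
qed

text \<open>
  Lepingle's inequality in \<open>L\<^sup>2\<close>. The geometric series over the scales
  \<open>2^(-l(r-2))\<close> produces the factor \<open>r/(r-2)\<close>, here even for the square of the
  variation.
\<close>
lemma (in finite_martingale) lepingle:
  assumes r: "2 < r"
  shows "(\<Sum>\<omega>\<in>\<Omega>. \<mu> \<omega> * (pvar r T (\<lambda>n. X (T - n) \<omega>))\<^sup>2) \<le>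
     5120 * (r / (r-2)) * (\<Sum>\<omega>\<in>\<Omega>. \<mu> \<omega> * (norm (X T \<omega>))\<^sup>2)"
proof -
  define c where "c = (1/2::real) powr (r-2)"
  have c: "0 < c" "c < 1" unfolding c_def using gr_one_powr[of 2 "r-2"] r by (auto simp: powr_divide)
  define G where "G \<omega> l = jump_sq ((1/2)^l/4) (\<lambda>t. X t \<omega>) T" for \<omega> and l :: nat
  have G0: "0 \<le> G \<omega> l" for \<omega> l unfolding G_def by (rule jump_sq_nonneg)
  define E where "E = (\<Sum>\<omega>\<in>\<Omega>. \<mu> \<omega> * (norm (X T \<omega>))\<^sup>2)"
  have E0: "0 \<le> E" unfolding E_def by (intro sum_nonneg mult_nonneg_nonneg weight_nonneg) auto
  have "\<forall>\<omega>. \<exists>L. (pvar r T (\<lambda>n. X (T - n) \<omega>))\<^sup>2 \<le> 1024 * ((rmax (\<lambda>t. X t \<omega>) T)\<^sup>2 + (\<Sum>l<L. c^l * G \<omega> l))"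
    unfolding c_def G_def by (intro allI pvar_reversed_path_le[OF r])
  from choice[OF this] obtain Lf where Lf: "\<And>\<omega>. (pvar r T (\<lambda>n. X (T - n) \<omega>))\<^sup>2
      \<le> 1024 * ((rmax (\<lambda>t. X t \<omega>) T)\<^sup>2 + (\<Sum>l<Lf \<omega>. c^l * G \<omega> l))"
    by blast
  define L where "L = Max (insert 0 (Lf ` \<Omega>))"
  have "(pvar r T (\<lambda>n. X (T - n) \<omega>))\<^sup>2 \<le> 1024 * ((rmax (\<lambda>t. X t \<omega>) T)\<^sup>2 + (\<Sum>l<L. c^l * G \<omega> l))" if "\<omega> \<in> \<Omega>" for \<omega>
  proof -
    have "Lf \<omega> \<le> L" unfolding L_def using that finite_space by (intro Max_ge) auto
    then have "(\<Sum>l<Lf \<omega>. c^l * G \<omega> l) \<le> (\<Sum>l<L. c^l * G \<omega> l)"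
      using c by (intro sum_mono2) (auto simp: G0)
    then show ?thesis by (intro order_trans[OF Lf] mult_left_mono add_left_mono) auto
  qed
  then have "(\<Sum>\<omega>\<in>\<Omega>. \<mu> \<omega> * (pvar r T (\<lambda>n. X (T - n) \<omega>))\<^sup>2) \<le>
     (\<Sum>\<omega>\<in>\<Omega>. \<mu> \<omega> * (1024 * ((rmax (\<lambda>t. X t \<omega>) T)\<^sup>2 + (\<Sum>l<L. c^l * G \<omega> l))))"
    by (intro sum_mono mult_left_mono weight_nonneg)
  also have "\<dots> = 1024 * ((\<Sum>\<omega>\<in>\<Omega>. \<mu> \<omega> * (rmax (\<lambda>t. X t \<omega>) T)\<^sup>2) + (\<Sum>\<omega>\<in>\<Omega>. \<Sum>l<L. c^l * (\<mu> \<omega> * G \<omega> l)))"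
    by (simp add: distrib_left sum.distrib sum_distrib_left mult.left_commute)
  also have "(\<Sum>\<omega>\<in>\<Omega>. \<Sum>l<L. c^l * (\<mu> \<omega> * G \<omega> l)) = (\<Sum>l<L. c^l * (\<Sum>\<omega>\<in>\<Omega>. \<mu> \<omega> * G \<omega> l))"
    by (subst sum.swap) (simp add: sum_distrib_left)
  also have "\<dots> \<le> (\<Sum>l<L. c^l * E)"
    unfolding E_def G_def using c by (intro sum_mono mult_left_mono jump_sq_expectation_le) auto
  also have "\<dots> \<le> 1 / (1 - c) * E"
  proof -
    have "(\<Sum>l<L. c^l) \<le> 1 / (1 - c)"
      using c by (simp add: sum_gp_strict divide_right_mono)
    then show ?thesis using E0 unfolding sum_distrib_right[symmetric] by (intro mult_right_mono) auto
  qed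
  also have "\<dots> \<le> (r / (r-2)) * E"
    using two_powr_geometric[of "r-2"] r E0 unfolding c_def by (intro mult_right_mono) auto
  also have "(\<Sum>\<omega>\<in>\<Omega>. \<mu> \<omega> * (rmax (\<lambda>t. X t \<omega>) T)\<^sup>2) \<le> 4 * E"
    unfolding E_def by (rule doob_maximal)
  also have "1024 * (4 * E + (r / (r-2)) * E) \<le> 5120 * (r / (r-2)) * E"
  proof -
    define K where "K = r / (r-2)"
    have "1 * E \<le> K * E" unfolding K_def using r E0 by (intro mult_right_mono) (auto simp: field_simps)
    then show ?thesis unfolding K_def[symmetric] by (simp add: algebra_simps)
  qed
  finally show ?thesis unfolding E_def by simp
qed

section \<open>Random thinning of a product of multipliers\<close>

text \<open>
  The law of a random subset of \<open>{..<N}\<close> that contains each index independently with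
  probability \<open>\<alpha>\<close>; only meant for \<open>R \<subseteq> {..<N}\<close>.
\<close>
definition bernoulli :: "real \<Rightarrow> nat \<Rightarrow> nat set \<Rightarrow> real" where
  "bernoulli \<alpha> N R = \<alpha> ^ card R * (1 - \<alpha>) ^ (N - card R)"

lemma bernoulli_nonneg: "0 \<le> \<alpha> \<Longrightarrow> \<alpha> \<le> 1 \<Longrightarrow> 0 \<le> bernoulli \<alpha> N R"
  by (simp add: bernoulli_def)

text \<open>
  Conditioning on whether the last index belongs to the random set.
\<close>
lemma bernoulli_sum_Suc:
  fixes \<phi> :: "nat set \<Rightarrow> 'a::real_vector"
  shows "(\<Sum>R\<in>Pow {..<Suc N}. bernoulli \<alpha> (Suc N) R *\<^sub>R \<phi> R) =
    (\<Sum>R\<in>Pow {..<N}. bernoulli \<alpha> N R *\<^sub>R (\<alpha> *\<^sub>R \<phi> (insert N R) + (1 - \<alpha>) *\<^sub>R \<phi> R))"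
proof -
  have disj: "Pow {..<N} \<inter> insert N ` Pow {..<N} = {}" by auto
  have inj: "inj_on (insert N) (Pow {..<N})"
    by (intro inj_onI) (metis PowD insert_ident lessThan_iff less_irrefl subsetD)
  have "(\<Sum>R\<in>Pow {..<Suc N}. bernoulli \<alpha> (Suc N) R *\<^sub>R \<phi> R) =
     (\<Sum>R\<in>Pow {..<N}. bernoulli \<alpha> (Suc N) R *\<^sub>R \<phi> R) +
     (\<Sum>R\<in>Pow {..<N}. bernoulli \<alpha> (Suc N) (insert N R) *\<^sub>R \<phi> (insert N R))"
    unfolding lessThan_Suc Pow_insert using disj inj
    by (simp add: sum.union_disjoint sum.reindex)
  also have "\<dots> = (\<Sum>R\<in>Pow {..<N}. bernoulli \<alpha> (Suc N) R *\<^sub>R \<phi> R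
      + bernoulli \<alpha> (Suc N) (insert N R) *\<^sub>R \<phi> (insert N R))"
    by (simp add: sum.distrib)
  also have "\<dots> = (\<Sum>R\<in>Pow {..<N}. bernoulli \<alpha> N R *\<^sub>R (\<alpha> *\<^sub>R \<phi> (insert N R) + (1 - \<alpha>) *\<^sub>R \<phi> R))"
  proof (rule sum.cong[OF refl])
    fix R assume R: "R \<in> Pow {..<N}"
    then have fin: "finite R" "N \<notin> R" and c: "card R \<le> N"
      using card_mono[of "{..<N}" R] by (auto intro: finite_subset)
    have "bernoulli \<alpha> (Suc N) (insert N R) = \<alpha> * bernoulli \<alpha> N R"
      using fin by (simp add: bernoulli_def)
    moreover have "bernoulli \<alpha> (Suc N) R = (1 - \<alpha>) * bernoulli \<alpha> N R"
      using c by (simp add: bernoulli_def Suc_diff_le)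
    ultimately show "bernoulli \<alpha> (Suc N) R *\<^sub>R \<phi> R
      + bernoulli \<alpha> (Suc N) (insert N R) *\<^sub>R \<phi> (insert N R) =
      bernoulli \<alpha> N R *\<^sub>R (\<alpha> *\<^sub>R \<phi> (insert N R) + (1 - \<alpha>) *\<^sub>R \<phi> R)"
      by (simp add: scaleR_add_right mult.commute)
  qed
  finally show ?thesis .
qed

lemma bernoulli_sum: "(\<Sum>R\<in>Pow {..<N}. bernoulli \<alpha> N R) = 1"
proof (induction N)
  case (Suc N)
  then show ?case using bernoulli_sum_Suc[of \<alpha> N "\<lambda>_. 1::real"] by simp
qed (simp add: bernoulli_def)

text \<open>
  The partial product in which only the factors with index in \<open>R\<close> are kept.
\<close>
definition thinned :: "(nat \<Rightarrow> real) \<Rightarrow> nat set \<Rightarrow> nat \<Rightarrow> real" where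
  "thinned w R n = (\<Prod>j<n. if j \<in> R then w j else 1)"

lemma thinned_insert: "n \<le> N \<Longrightarrow> thinned w (insert N R) n = thinned w R n"
  unfolding thinned_def by (intro prod.cong) auto

text \<open>
  The situation at one fixed frequency: \<open>x j\<close> measures the distance of \<open>g d^j
  \<theta>\<close> to the integers, \<open>p j\<close> is the multiplier of the \<open>j\<close>-th
  averaging step and \<open>w j\<close> the squared Fejer multiplier. The last two assumptions say that
  \<open>\<alpha>\<close> is small in terms of \<open>\<rho>\<close>, \<open>K\<close> and
  \<open>\<eta>\<close>.
\<close>
locale expanding_multipliers =
  fixes x :: "nat \<Rightarrow> real" and p :: "nat \<Rightarrow> complex" and w :: "nat \<Rightarrow> real"
    and \<eta> \<rho> \<alpha> K :: real
  assumes x_nonneg: "0 \<le> x j" and x_le: "x j \<le> 2"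
    and growth: "x j < \<eta> \<Longrightarrow> 2 * x j \<le> x (Suc j)"
    and p_le_1: "norm (p j) \<le> 1" and p_active: "\<eta> \<le> x j \<Longrightarrow> norm (p j) \<le> \<rho>"
    and p_near_1: "norm (1 - p j) \<le> K * x j"
    and w_range: "0 \<le> w j" "w j \<le> 1" and w_active: "\<eta> \<le> x j \<Longrightarrow> w j = 0"
    and w_near_1: "x j < \<eta> \<Longrightarrow> 1 - w j \<le> K * x j"
    and eta: "0 < \<eta>" "\<eta> \<le> 1" and rho: "0 \<le> \<rho>" "\<rho> < 1" and K: "0 \<le> K"
    and alpha: "0 < \<alpha>" "\<alpha> < 1" and delta: "2 * \<alpha> * K * \<eta> < 1"
    and beta: "(\<rho> / (1 - 2 * \<alpha> * K * \<eta>))\<^sup>2 < 1 - \<alpha>"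
begin

text \<open>
  \<open>\<delta>\<close> bounds the loss of the averaged product \<open>u\<close> over one block of
  inactive indices; \<open>\<sigma>\<close> is the decay rate per active index of \<open>m / u\<close>.
\<close>
definition "\<delta> = 2 * \<alpha> * K * \<eta>"
definition "\<sigma> = \<rho> / (1 - \<delta>)"

abbreviation "active j \<equiv> \<eta> \<le> x j"

text \<open>
  The number of active indices below \<open>n\<close>.
\<close>
primrec cnt :: "nat \<Rightarrow> nat" where
  "cnt 0 = 0"
| "cnt (Suc n) = (if active n then Suc (cnt n) else cnt n)"

definition m :: "nat \<Rightarrow> complex" where "m n = (\<Prod>j<n. p j)"

text \<open>
  The expectation of the thinned product over the inactive indices below \<open>n\<close>.
\<close>
primrec u :: "nat \<Rightarrow> real" where
  "u 0 = 1"
| "u (Suc n) = (if active n then u n else u n * (1 - \<alpha> * (1 - w n)))"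

text \<open>
  The value of \<open>m / u\<close> at the beginning of the block that contains \<open>n\<close>, that is,
  just after the last active index. Within a block the factors of \<open>m\<close> and of \<open>u\<close>
  are \<open>1 + O(x j)\<close>, so \<open>u n * ref n\<close> approximates \<open>m n\<close> with a
  relative error of order \<open>y n\<close>, defined next.
\<close>
primrec ref :: "nat \<Rightarrow> complex" where
  "ref 0 = 1"
| "ref (Suc n) = (if active n then m (Suc n) / of_real (u (Suc n)) else ref n)"

text \<open>
  The sum of \<open>x\<close> over the part of the current block below \<open>n\<close>. Because
  \<open>x\<close> at least doubles at each step in a block, it is dominated by the next term \<open>x
  n\<close>.
\<close>
primrec y :: "nat \<Rightarrow> real" where
  "y 0 = 0"
| "y (Suc n) = (if active n then 0 else y n + x n)"

lemma delta_range: "0 \<le> \<delta>" "\<delta> < 1"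
  using alpha K eta delta by (auto simp: \<delta>_def)

lemma sigma_range: "0 \<le> \<sigma>" "\<sigma> \<le> 1" "\<sigma>\<^sup>2 / (1 - \<alpha>) < 1"
proof -
  show "0 \<le> \<sigma>" using rho delta_range by (simp add: \<sigma>_def)
  have b: "\<sigma>\<^sup>2 < 1 - \<alpha>" using beta by (simp add: \<sigma>_def \<delta>_def)
  then show "\<sigma>\<^sup>2 / (1 - \<alpha>) < 1" using alpha by simp
  have "\<sigma>\<^sup>2 \<le> 1\<^sup>2" using b alpha by simp
  then show "\<sigma> \<le> 1" by (rule power2_le_imp_le) simp
qed

lemma y_bounds: "0 \<le> y n" "y n \<le> x n" "y n \<le> 2 * \<eta>"
proof -
  have "0 \<le> y n \<and> y n \<le> x n \<and> y n \<le> 2 * \<eta>"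
  proof (induction n)
    case (Suc n)
    then show ?case using growth[of n] x_nonneg[of n] x_nonneg[of "Suc n"] eta by (auto simp: not_le)
  qed (use x_nonneg eta in auto)
  then show "0 \<le> y n" "y n \<le> x n" "y n \<le> 2 * \<eta>" by auto
qed

lemma alpha_K_y: "\<alpha> * K * y n \<le> \<delta>"
  using mult_left_mono[OF y_bounds(3)[of n], of "\<alpha> * K"] alpha K by (simp add: \<delta>_def mult_ac)

lemma damping_range: "0 < 1 - \<alpha> * (1 - w n)" "1 - \<alpha> * (1 - w n) \<le> 1"
proof -
  have "\<alpha> * (1 - w n) \<le> \<alpha>" using alpha w_range[of n] by (simp add: mult_left_le)
  then show "0 < 1 - \<alpha> * (1 - w n)" using alpha by linarith
  show "1 - \<alpha> * (1 - w n) \<le> 1" using alpha w_range[of n] by simp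
qed

lemma u_range: "0 < u n" "u n \<le> 1"
proof -
  have "0 < u n \<and> u n \<le> 1"
    by (induction n) (use damping_range in \<open>auto simp: mult_le_one less_imp_le\<close>)
  then show "0 < u n" "u n \<le> 1" by auto
qed

lemma u_lower: "(1 - \<delta>) ^ cnt n * (1 - \<alpha> * K * y n) \<le> u n"
proof (induction n)
  case (Suc n)
  have pos: "0 \<le> (1 - \<delta>) ^ cnt n" using delta_range by simp
  show ?case
  proof (cases "active n")
    case True
    have "(1 - \<delta>) ^ cnt n * (1 - \<delta>) \<le> (1 - \<delta>) ^ cnt n * (1 - \<alpha> * K * y n)"
      using pos alpha_K_y[of n] by (intro mult_left_mono) auto
    then show ?thesis using True Suc.IH by (simp add: mult.commute)
  next
    case False
    have a: "0 \<le> 1 - \<alpha> * K * y n" using alpha_K_y[of n] delta_range by linarith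
    have b: "\<alpha> * (1 - w n) \<le> \<alpha> * K * x n" using w_near_1[of n] False alpha by (simp add: mult.assoc)
    have nn: "0 \<le> (\<alpha> * K * y n) * (\<alpha> * (1 - w n))"
      using alpha K y_bounds(1)[of n] w_range[of n] by (intro mult_nonneg_nonneg) auto
    have "1 - \<alpha> * K * (y n + x n) \<le> (1 - \<alpha> * K * y n) * (1 - \<alpha> * (1 - w n))"
      using b nn by (simp add: algebra_simps)
    then have "(1 - \<delta>) ^ cnt n * (1 - \<alpha> * K * (y n + x n)) \<le>
       ((1 - \<delta>) ^ cnt n * (1 - \<alpha> * K * y n)) * (1 - \<alpha> * (1 - w n))"
      using pos by (simp add: mult.assoc mult_left_mono)
    also have "\<dots> \<le> u n * (1 - \<alpha> * (1 - w n))"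
      using Suc.IH damping_range[of n] by (intro mult_right_mono) auto
    finally show ?thesis using False by simp
  qed
qed simp

lemma u_lower_active: "active n \<Longrightarrow> (1 - \<delta>) ^ cnt (Suc n) \<le> u (Suc n)"
  using u_lower[of "Suc n"] by simp

lemma m_bound: "norm (m n) \<le> \<rho> ^ cnt n"
proof (induction n)
  case (Suc n)
  have "norm (m (Suc n)) = norm (m n) * norm (p n)" by (simp add: m_def norm_mult)
  also have "\<dots> \<le> \<rho> ^ cnt (Suc n)"
  proof (cases "active n")
    case True
    then have "norm (m n) * norm (p n) \<le> \<rho> ^ cnt n * \<rho>"
      using Suc.IH p_active[OF True] rho by (intro mult_mono) auto
    then show ?thesis using True by (simp add: mult.commute)
  next
    case False
    have "norm (m n) * norm (p n) \<le> \<rho> ^ cnt n * 1"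
      using Suc.IH p_le_1[of n] rho by (intro mult_mono) auto
    then show ?thesis using False by simp
  qed
  finally show ?case .
qed (simp add: m_def)

lemma u_ref_bound: "norm (of_real (u n) * ref n) \<le> \<rho> ^ cnt n"
proof (induction n)
  case (Suc n)
  show ?case
  proof (cases "active n")
    case True
    then have "of_real (u (Suc n)) * ref (Suc n) = m (Suc n)" using u_range(1)[of n] by simp
    then show ?thesis using m_bound[of "Suc n"] by simp
  next
    case False
    have "of_real (u (Suc n)) * ref (Suc n) = of_real (1 - \<alpha> * (1 - w n)) * (of_real (u n) * ref n)"
      using False by simp
    then have "norm (of_real (u (Suc n)) * ref (Suc n)) = (1 - \<alpha> * (1 - w n)) * norm (of_real (u n) * ref n)"
      using damping_range(1)[of n] by (simp only: norm_mult norm_of_real abs_of_pos)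
    also have "\<dots> \<le> 1 * \<rho> ^ cnt n"
      using Suc.IH damping_range[of n] by (intro mult_mono) auto
    finally show ?thesis using False by simp
  qed
qed simp

lemma ref_bound: "norm (ref n) \<le> \<sigma> ^ cnt n"
proof (induction n)
  case (Suc n)
  show ?case
  proof (cases "active n")
    case True
    have "norm (ref (Suc n)) = norm (m (Suc n)) / u (Suc n)"
      using True u_range(1)[of "Suc n"] by (simp add: norm_divide)
    also have "\<dots> \<le> \<rho> ^ cnt (Suc n) / (1 - \<delta>) ^ cnt (Suc n)"
      using m_bound[of "Suc n"] u_lower_active[OF True] delta_range rho by (intro frac_le) auto
    finally show ?thesis by (simp add: \<sigma>_def power_divide)
  qed (use Suc in simp)
qed simp

lemma approximation_error: "norm (m n - of_real (u n) * ref n) \<le> \<rho> ^ cnt n * (2 * K * y n)"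
proof (induction n)
  case (Suc n)
  show ?case
  proof (cases "active n")
    case True
    then have "of_real (u (Suc n)) * ref (Suc n) = m (Suc n)" using u_range(1)[of n] by simp
    then show ?thesis using True by simp
  next
    case False
    define v where "v = of_real (u n) * ref n"
    have "m (Suc n) - of_real (u (Suc n)) * ref (Suc n)
       = p n * (m n - v) - ((1 - p n) - of_real (\<alpha> * (1 - w n))) * v"
      using False by (simp add: m_def v_def algebra_simps)
    then have "norm (m (Suc n) - of_real (u (Suc n)) * ref (Suc n))
       \<le> norm (p n) * norm (m n - v) + norm ((1 - p n) - of_real (\<alpha> * (1 - w n))) * norm v"
      by (metis norm_triangle_ineq4 norm_mult)
    also have "\<dots> \<le> 1 * (\<rho> ^ cnt n * (2 * K * y n)) + (K * x n + K * x n) * \<rho> ^ cnt n"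
    proof (intro add_mono mult_mono)
      have "\<alpha> * (1 - w n) \<le> 1 * (K * x n)"
        using w_near_1[of n] False alpha w_range[of n] by (intro mult_mono) auto
      then have "norm (of_real (\<alpha> * (1 - w n)) :: complex) \<le> K * x n"
        using alpha w_range[of n] by (simp add: norm_mult del: of_real_mult of_real_diff)
      then show "norm ((1 - p n) - of_real (\<alpha> * (1 - w n))) \<le> K * x n + K * x n"
        using p_near_1[of n] norm_triangle_ineq4[of "1 - p n" "of_real (\<alpha> * (1 - w n))"] by linarith
      show "norm v \<le> \<rho> ^ cnt n" using u_ref_bound[of n] by (simp add: v_def)
      show "norm (m n - v) \<le> \<rho> ^ cnt n * (2 * K * y n)" using Suc.IH by (simp add: v_def)
    qed (use p_le_1 K x_nonneg in auto)
    also have "\<dots> = \<rho> ^ cnt n * (2 * K * (y n + x n))" by (simp add: algebra_simps)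
    finally show ?thesis using False by simp
  qed
qed (simp add: m_def)

lemma geometric_le: "0 \<le> b \<Longrightarrow> b < 1 \<Longrightarrow> (\<Sum>i<n. b ^ i) \<le> 1 / (1 - b)" for b :: real
  by (simp add: sum_gp_strict divide_right_mono)

text \<open>
  Within a block the sums \<open>y\<close> at least double, so a whole block contributes at most \<open>4
  \<eta>\<close>, and the factors \<open>\<rho>^cnt\<close> make the blocks summable.
\<close>
lemma sum_y_le: "(\<Sum>k\<le>n. \<rho> ^ cnt k * y k) \<le> 4 / (1 - \<rho>)"
proof -
  have "(\<Sum>k\<le>n. \<rho> ^ cnt k * y k) \<le> \<rho> ^ cnt n * (2 * y n) + 4 * (\<Sum>i<cnt n. \<rho> ^ i)"
  proof (induction n)
    case (Suc n)
    have pos: "0 \<le> \<rho> ^ cnt n" using rho by simp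
    show ?case
    proof (cases "active n")
      case True
      have "\<rho> ^ cnt n * (2 * y n) \<le> \<rho> ^ cnt n * 4"
        using y_bounds(3)[of n] eta pos by (intro mult_left_mono) auto
      moreover have A: "4 * (\<Sum>i<cnt (Suc n). \<rho> ^ i) = 4 * (\<Sum>i<cnt n. \<rho> ^ i) + \<rho> ^ cnt n * 4"
        and B: "(\<Sum>k\<le>Suc n. \<rho> ^ cnt k * y k) = (\<Sum>k\<le>n. \<rho> ^ cnt k * y k)" and C: "y (Suc n) = 0"
        using True by simp_all
      ultimately show ?thesis using Suc.IH unfolding A B C by linarith
    next
      case False
      have "\<rho> ^ cnt n * (2 * y n) + \<rho> ^ cnt n * (y n + x n) \<le> \<rho> ^ cnt n * (2 * (y n + x n))"
        using y_bounds(2)[of n] pos unfolding distrib_left[symmetric] by (intro mult_left_mono) auto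
      then show ?thesis using Suc.IH False by simp
    qed
  qed simp
  also have "\<dots> \<le> \<rho> ^ cnt n * 4 + 4 * (\<Sum>i<cnt n. \<rho> ^ i)"
    using y_bounds(3)[of n] eta rho by (intro add_right_mono mult_left_mono) auto
  also have "\<dots> = 4 * (\<Sum>i<Suc (cnt n). \<rho> ^ i)" by simp
  also have "\<dots> \<le> 4 * (1 / (1 - \<rho>))" using geometric_le[OF rho, of "Suc (cnt n)"] by (intro mult_left_mono) auto
  finally show ?thesis by simp
qed

lemma sum_error_sq_le:
  "(\<Sum>n\<le>N. (norm (m n - of_real (u n) * ref n))\<^sup>2) \<le> 32 * K\<^sup>2 / (1 - \<rho>)"
proof -
  have "(norm (m n - of_real (u n) * ref n))\<^sup>2 \<le> 8 * K\<^sup>2 * (\<rho> ^ cnt n * y n)" for n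
  proof -
    have "(norm (m n - of_real (u n) * ref n))\<^sup>2 \<le> (\<rho> ^ cnt n * (2 * K * y n))\<^sup>2"
      using approximation_error by (intro power_mono) auto
    also have "\<dots> = 4 * K\<^sup>2 * (\<rho> ^ cnt n * y n) * (\<rho> ^ cnt n * y n)" by (simp add: power2_eq_square)
    also have "\<dots> \<le> 4 * K\<^sup>2 * (\<rho> ^ cnt n * y n) * (1 * 2)"
      using y_bounds[of n] eta rho
      by (intro mult_left_mono mult_mono mult_nonneg_nonneg power_le_one) auto
    finally show ?thesis by simp
  qed
  then have "(\<Sum>n\<le>N. (norm (m n - of_real (u n) * ref n))\<^sup>2) \<le> 8 * K\<^sup>2 * (\<Sum>n\<le>N. \<rho> ^ cnt n * y n)"
    unfolding sum_distrib_left by (intro sum_mono)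
  also have "\<dots> \<le> 8 * K\<^sup>2 * (4 / (1 - \<rho>))" using sum_y_le by (intro mult_left_mono) auto
  finally show ?thesis by simp
qed

lemma sum_m_x_sq_le:
  "(\<Sum>n<N. (norm (m n))\<^sup>2 * (x n)\<^sup>2) \<le> 8 / (1 - \<rho>)"
proof -
  have "(\<Sum>n<N. (norm (m n))\<^sup>2 * (x n)\<^sup>2) \<le> 4 * (\<Sum>i<cnt N. \<rho> ^ i) + (\<Sum>k\<le>N. \<rho> ^ cnt k * y k)"
  proof (induction N)
    case (Suc n)
    have m2: "(norm (m n))\<^sup>2 \<le> \<rho> ^ cnt n"
    proof -
      have "(norm (m n))\<^sup>2 \<le> (\<rho> ^ cnt n)\<^sup>2" using m_bound by (intro power_mono) auto
      also have "\<dots> \<le> \<rho> ^ cnt n * 1"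
        unfolding power2_eq_square using rho by (intro mult_left_mono power_le_one) auto
      finally show ?thesis by simp
    qed
    show ?case
    proof (cases "active n")
      case True
      have "(x n)\<^sup>2 \<le> 2\<^sup>2" using x_nonneg x_le by (intro power_mono) auto
      then have "(norm (m n))\<^sup>2 * (x n)\<^sup>2 \<le> \<rho> ^ cnt n * 4" using m2 rho by (intro mult_mono) auto
      then show ?thesis using Suc.IH True by (simp add: distrib_left mult.commute)
    next
      case False
      have "(x n)\<^sup>2 \<le> x n * 1"
        unfolding power2_eq_square using False x_nonneg[of n] eta by (intro mult_left_mono) auto
      also have "\<dots> \<le> y n + x n" using y_bounds(1)[of n] by simp
      finally have "(norm (m n))\<^sup>2 * (x n)\<^sup>2 \<le> \<rho> ^ cnt n * (y n + x n)"
        using m2 rho by (intro mult_mono) auto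
      then show ?thesis using Suc.IH False by simp
    qed
  qed simp
  also have "\<dots> \<le> 4 * (1 / (1 - \<rho>)) + 4 / (1 - \<rho>)"
    using geometric_le[OF rho] sum_y_le by (intro add_mono mult_left_mono) auto
  finally show ?thesis by (simp add: add_divide_distrib[symmetric])
qed

lemma sum_product_x_sq_le:
  "(\<Sum>n<N. (norm (\<Prod>j<n. p j))\<^sup>2 * (x n)\<^sup>2) \<le> 8 / (1 - \<rho>)"
  using sum_m_x_sq_le unfolding m_def .

text \<open>
  The thinned product over \<open>R\<close> vanishes from the first active element of \<open>R\<close> on.
\<close>
definition dead :: "nat \<Rightarrow> nat set \<Rightarrow> bool" where
  "dead N R \<longleftrightarrow> (\<exists>j\<in>R. j < N \<and> active j)"

text \<open>
  The weight attached to the random set \<open>R\<close>; it does not depend on the time \<open>n\<close> of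
  the thinned product. If \<open>\<tau>\<close> is the first active element of \<open>R\<close> below
  \<open>N\<close>, it is the increment \<open>ref \<tau> - ref (\<tau> + 1)\<close> divided by the
  probability that, among the active indices, \<open>\<tau>\<close> is the first one in \<open>R\<close>;
  without such an element it is \<open>ref N\<close> divided by the probability of this event. Thus the
  contributions of the sets that are still alive at time \<open>n\<close> telescope to \<open>ref n\<close>.
  As a process in \<open>N\<close> the weight is a martingale (\<open>coeff_mean\<close>).
\<close>
primrec coeff :: "nat \<Rightarrow> nat set \<Rightarrow> complex" where
  "coeff 0 R = 1"
| "coeff (Suc N) R =
    (if active N \<and> \<not> dead N R then
       (if N \<in> R then (ref N - ref (Suc N)) / of_real (\<alpha> * (1 - \<alpha>) ^ cnt N)
        else ref (Suc N) / of_real ((1 - \<alpha>) ^ Suc (cnt N)))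
     else coeff N R)"

lemma dead_insert: "dead N (insert N R) = dead N R" by (simp add: dead_def)

lemma coeff_cong: "R \<inter> {..<N} = R' \<inter> {..<N} \<Longrightarrow> coeff N R = coeff N R'"
proof (induction N)
  case (Suc N)
  have mem: "j \<in> R \<longleftrightarrow> j \<in> R'" if "j \<le> N" for j
    using Suc.prems that by (metis IntD1 IntI lessThan_iff less_Suc_eq_le)
  have "R \<inter> {..<N} = R' \<inter> {..<N}" using mem by auto
  moreover have "N \<in> R \<longleftrightarrow> N \<in> R'" by (rule mem) simp
  moreover have "dead N R = dead N R'" unfolding dead_def using mem by (metis less_imp_le_nat)
  ultimately show ?case using Suc.IH by (simp del: ref.simps)
qed simp

lemma coeff_insert: "coeff N (insert N R) = coeff N R"
  by (rule coeff_cong) auto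

lemma coeff_alive: "\<not> dead N R \<Longrightarrow> coeff N R = ref N / of_real ((1 - \<alpha>) ^ cnt N)"
proof (induction N)
  case (Suc N)
  have "\<not> dead N R" "active N \<Longrightarrow> N \<notin> R" using Suc.prems by (auto simp: dead_def)
  then show ?case using Suc.IH by (auto simp del: of_real_power)
qed simp

lemma thinned_dead: "dead N R \<Longrightarrow> N \<le> n \<Longrightarrow> thinned w R n = 0"
  unfolding thinned_def dead_def using w_active by (intro prod_zero) force+

text \<open>
  Only sets without active elements contribute, and the inactive indices are independent of the active ones.
\<close>
lemma expectation_thinned:
  "(\<Sum>R\<in>Pow {..<N}. bernoulli \<alpha> N R * thinned w R N) = (1 - \<alpha>) ^ cnt N * u N"
proof (induction N)
  case (Suc N)
  have "(\<Sum>R\<in>Pow {..<Suc N}. bernoulli \<alpha> (Suc N) R * thinned w R (Suc N)) =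
     (\<Sum>R\<in>Pow {..<N}. bernoulli \<alpha> N R *
       (\<alpha> * thinned w (insert N R) (Suc N) + (1 - \<alpha>) * thinned w R (Suc N)))"
    using bernoulli_sum_Suc[of \<alpha> N "\<lambda>R. thinned w R (Suc N)"] by simp
  also have "\<dots> = (\<Sum>R\<in>Pow {..<N}. (\<alpha> * w N + (1 - \<alpha>)) * (bernoulli \<alpha> N R * thinned w R N))"
  proof (rule sum.cong[OF refl])
    fix R assume "R \<in> Pow {..<N}"
    then have "N \<notin> R" by auto
    then have "thinned w R (Suc N) = thinned w R N" by (simp add: thinned_def)
    moreover have "thinned w (insert N R) (Suc N) = thinned w R N * w N"
      using thinned_insert[of N N w R] by (simp add: thinned_def)
    ultimately show "bernoulli \<alpha> N R *
       (\<alpha> * thinned w (insert N R) (Suc N) + (1 - \<alpha>) * thinned w R (Suc N)) =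
       (\<alpha> * w N + (1 - \<alpha>)) * (bernoulli \<alpha> N R * thinned w R N)"
      by (simp add: algebra_simps)
  qed
  also have "\<dots> = (\<alpha> * w N + (1 - \<alpha>)) * ((1 - \<alpha>) ^ cnt N * u N)"
    unfolding sum_distrib_left[symmetric] Suc.IH ..
  also have "\<dots> = (1 - \<alpha>) ^ cnt (Suc N) * u (Suc N)"
    using w_active[of N] by (simp add: algebra_simps)
  finally show ?case .
qed (simp add: bernoulli_def thinned_def)

lemma expectation_alive:
  "(\<Sum>R\<in>Pow {..<N}. bernoulli \<alpha> N R * of_bool (\<not> dead N R)) = (1 - \<alpha>) ^ cnt N"
proof (induction N)
  case (Suc N)
  have "(\<Sum>R\<in>Pow {..<Suc N}. bernoulli \<alpha> (Suc N) R * of_bool (\<not> dead (Suc N) R)) =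
     (\<Sum>R\<in>Pow {..<N}. bernoulli \<alpha> N R *
       (\<alpha> * of_bool (\<not> dead (Suc N) (insert N R)) + (1 - \<alpha>) * of_bool (\<not> dead (Suc N) R)))"
    using bernoulli_sum_Suc[of \<alpha> N "\<lambda>R. of_bool (\<not> dead (Suc N) R) :: real"] unfolding real_scaleR_def .
  also have "\<dots> = (\<Sum>R\<in>Pow {..<N}. (if active N then 1 - \<alpha> else 1) * (bernoulli \<alpha> N R * of_bool (\<not> dead N R)))"
  proof (rule sum.cong[OF refl])
    fix R assume "R \<in> Pow {..<N}"
    then have N: "N \<notin> R" by auto
    have "dead (Suc N) R = dead N R" "dead (Suc N) (insert N R) \<longleftrightarrow> active N \<or> dead N R"
      using N by (auto simp: dead_def less_Suc_eq)
    then show "bernoulli \<alpha> N R *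
       (\<alpha> * of_bool (\<not> dead (Suc N) (insert N R)) + (1 - \<alpha>) * of_bool (\<not> dead (Suc N) R)) =
       (if active N then 1 - \<alpha> else 1) * (bernoulli \<alpha> N R * of_bool (\<not> dead N R))"
      by auto
  qed
  also have "\<dots> = (1 - \<alpha>) ^ cnt (Suc N)"
    unfolding sum_distrib_left[symmetric] Suc.IH by simp
  finally show ?case .
qed (simp add: bernoulli_def dead_def)

lemma coeff_mean:
  assumes "\<not> dead N R" "active N" "N \<notin> R"
  shows "\<alpha> *\<^sub>R coeff (Suc N) (insert N R) + (1 - \<alpha>) *\<^sub>R coeff (Suc N) R = coeff N R"
proof -
  have nz: "(of_real (1 - \<alpha>) :: complex) \<noteq> 0" "(of_real \<alpha> :: complex) \<noteq> 0"
    using alpha by (simp_all del: of_real_diff)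
  have 1: "coeff (Suc N) (insert N R) = (ref N - ref (Suc N)) / (of_real \<alpha> * of_real (1 - \<alpha>) ^ cnt N)"
    using assms by (simp add: dead_insert del: ref.simps of_real_diff)
  have 2: "coeff (Suc N) R = ref (Suc N) / (of_real (1 - \<alpha>) * of_real (1 - \<alpha>) ^ cnt N)"
    using assms by (simp del: ref.simps of_real_diff)
  have 3: "coeff N R = ref N / of_real (1 - \<alpha>) ^ cnt N"
    using coeff_alive[OF assms(1)] by (simp del: of_real_diff)
  show ?thesis unfolding 1 2 3 scaleR_conv_of_real using nz
    by (simp add: add_divide_distrib[symmetric] del: of_real_diff ref.simps)
qed

lemma expectation_coeff_thinned:
  "n \<le> N \<Longrightarrow> (\<Sum>R\<in>Pow {..<N}. bernoulli \<alpha> N R *\<^sub>R (thinned w R n *\<^sub>R coeff N R))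
     = of_real (u n) * ref n"
proof (induction N arbitrary: n)
  case 0
  then show ?case by (simp add: bernoulli_def thinned_def)
next
  case (Suc N)
  let ?b = "bernoulli \<alpha> N" and ?W = "thinned w"
    and ?c0 = "coeff (Suc N)" and ?c1 = "\<lambda>R. coeff (Suc N) (insert N R)"
  let ?E = "\<Sum>R\<in>Pow {..<Suc N}. bernoulli \<alpha> (Suc N) R *\<^sub>R (thinned w R n *\<^sub>R coeff (Suc N) R)"
  have rec: "?E
    = (\<Sum>R\<in>Pow {..<N}. ?b R *\<^sub>R (\<alpha> *\<^sub>R (?W (insert N R) n *\<^sub>R ?c1 R)
        + (1 - \<alpha>) *\<^sub>R (?W R n *\<^sub>R ?c0 R)))"
    by (rule bernoulli_sum_Suc)
  have mean: "\<alpha> *\<^sub>R ?c1 R + (1 - \<alpha>) *\<^sub>R ?c0 R = coeff N R"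
    if "N \<notin> R" for R
  proof (cases "active N \<and> \<not> dead N R")
    case True
    then show ?thesis using coeff_mean[of N R] that by blast
  next
    case False
    then have "?c1 R = coeff N R" "?c0 R = coeff N R"
      using coeff_insert[of N R] by (auto simp: dead_insert)
    then show ?thesis by (simp add: scaleR_add_left[symmetric])
  qed
  show ?case
  proof (cases "n \<le> N")
    case True
    have "?E
      = (\<Sum>R\<in>Pow {..<N}. ?b R *\<^sub>R (?W R n *\<^sub>R coeff N R))"
      unfolding rec
    proof (intro sum.cong refl)
      fix R assume "R \<in> Pow {..<N}"
      then have "N \<notin> R" by auto
      have "\<alpha> *\<^sub>R (?W (insert N R) n *\<^sub>R ?c1 R) +
          (1 - \<alpha>) *\<^sub>R (?W R n *\<^sub>R ?c0 R)
        = ?W R n *\<^sub>R (\<alpha> *\<^sub>R ?c1 R + (1 - \<alpha>) *\<^sub>R ?c0 R)"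
        unfolding thinned_insert[OF True] scaleR_add_right by (simp add: mult.commute del: coeff.simps)
      then show "?b R *\<^sub>R (\<alpha> *\<^sub>R (?W (insert N R) n *\<^sub>R ?c1 R) +
          (1 - \<alpha>) *\<^sub>R (?W R n *\<^sub>R ?c0 R))
        = ?b R *\<^sub>R (?W R n *\<^sub>R coeff N R)"
        unfolding mean[OF \<open>N \<notin> R\<close>] by simp
    qed
    then show ?thesis using Suc.IH[OF True] by simp
  next
    case False
    then have n: "n = Suc N" using Suc.prems by simp
    have ins: "?W (insert N R) (Suc N) = w N * ?W R N"
      "?W R (Suc N) = ?W R N" if "N \<notin> R" for R
      using thinned_insert[of N N w R] that by (simp_all add: thinned_def)
    show ?thesis
    proof (cases "active N")
      case True
      have "?E
        = (\<Sum>R\<in>Pow {..<N}. (?b R * ?W R N) *\<^sub>R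
            ((1 - \<alpha>) *\<^sub>R (ref (Suc N) / of_real ((1 - \<alpha>) ^ Suc (cnt N)))))"
        unfolding rec unfolding n
      proof (intro sum.cong refl)
        fix R assume "R \<in> Pow {..<N}"
        then have R: "N \<notin> R" by auto
        show "?b R *\<^sub>R (\<alpha> *\<^sub>R (?W (insert N R) (Suc N) *\<^sub>R ?c1 R) +
          (1 - \<alpha>) *\<^sub>R (?W R (Suc N) *\<^sub>R ?c0 R))
          = (?b R * ?W R N) *\<^sub>R
            ((1 - \<alpha>) *\<^sub>R (ref (Suc N) / of_real ((1 - \<alpha>) ^ Suc (cnt N))))"
        proof (cases "dead N R")
          case True
          then show ?thesis using thinned_dead[OF True, of N] ins[OF R] by simp
        next
          case False
          then have "?c0 R = ref (Suc N) / of_real ((1 - \<alpha>) ^ Suc (cnt N))"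
            using \<open>active N\<close> R by (simp del: ref.simps)
          then show ?thesis unfolding ins[OF R] w_active[OF \<open>active N\<close>]
            by (simp del: coeff.simps ref.simps of_real_power)
        qed
      qed
      also have "\<dots> = ((1 - \<alpha>) ^ cnt N * u N) *\<^sub>R ((1 - \<alpha>) *\<^sub>R (ref (Suc N) / of_real ((1 - \<alpha>) ^ Suc (cnt N))))"
        unfolding scaleR_sum_left[symmetric] expectation_thinned ..
      also have "\<dots> = of_real (u (Suc N)) * ref (Suc N)"
      proof -
        have "(of_real ((1 - \<alpha>) ^ Suc (cnt N)) :: complex) \<noteq> 0" using alpha by (simp del: of_real_power of_real_diff of_real_mult)
        moreover have "((1 - \<alpha>) ^ cnt N * u N) *\<^sub>R ((1 - \<alpha>) *\<^sub>R (ref (Suc N) / of_real ((1 - \<alpha>) ^ Suc (cnt N))))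
          = (of_real ((1 - \<alpha>) ^ Suc (cnt N)) * (of_real (u N) * ref (Suc N))) / of_real ((1 - \<alpha>) ^ Suc (cnt N))"
          by (simp add: scaleR_conv_of_real del: ref.simps)
        ultimately have "((1 - \<alpha>) ^ cnt N * u N) *\<^sub>R ((1 - \<alpha>) *\<^sub>R (ref (Suc N) / of_real ((1 - \<alpha>) ^ Suc (cnt N))))
          = of_real (u N) * ref (Suc N)" by (metis nonzero_mult_div_cancel_left)
        then show ?thesis using True by (simp del: ref.simps)
      qed
      finally show ?thesis unfolding n .
    next
      case False
      have "?E
        = (\<Sum>R\<in>Pow {..<N}. (1 - \<alpha> * (1 - w N)) *\<^sub>R (?b R *\<^sub>R (?W R N *\<^sub>R coeff N R)))"
        unfolding rec unfolding n
      proof (intro sum.cong refl)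
        fix R assume "R \<in> Pow {..<N}"
        then have R: "N \<notin> R" by auto
        have "?c1 R = coeff N R" "?c0 R = coeff N R"
          using coeff_insert[of N R] False by auto
        then show "?b R *\<^sub>R (\<alpha> *\<^sub>R (?W (insert N R) (Suc N) *\<^sub>R ?c1 R) +
          (1 - \<alpha>) *\<^sub>R (?W R (Suc N) *\<^sub>R ?c0 R))
          = (1 - \<alpha> * (1 - w N)) *\<^sub>R (?b R *\<^sub>R (?W R N *\<^sub>R coeff N R))"
          unfolding ins[OF R] by (simp add: scaleR_conv_of_real algebra_simps)
      qed
      also have "\<dots> = (1 - \<alpha> * (1 - w N)) *\<^sub>R (of_real (u N) * ref N)"
        unfolding scaleR_sum_right[symmetric] Suc.IH[OF order_refl] ..
      also have "\<dots> = of_real (u (Suc N)) * ref (Suc N)"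
        using False by (simp add: scaleR_conv_of_real)
      finally show ?thesis unfolding n .
    qed
  qed
qed

text \<open>
  An active index with \<open>k\<close> predecessors contributes \<open>O(\<sigma>^(2k) / (1 -
  \<alpha>)^k)\<close>: the squared weight times the probability of the event that carries it. This is
  summable because \<open>\<sigma>\<^sup>2 < 1 - \<alpha>\<close>.
\<close>
lemma expectation_coeff_sq_le:
  "(\<Sum>R\<in>Pow {..<N}. bernoulli \<alpha> N R * (norm (coeff N R))\<^sup>2)
     \<le> 1 + (4 / \<alpha> + 1) / (1 - \<sigma>\<^sup>2 / (1 - \<alpha>))"
proof -
  define b where "b = \<sigma>\<^sup>2 / (1 - \<alpha>)"
  have b: "0 \<le> b" "b < 1" using sigma_range alpha by (auto simp: b_def)
  have "(\<Sum>R\<in>Pow {..<N}. bernoulli \<alpha> N R * (norm (coeff N R))\<^sup>2)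
     \<le> 1 + (4 / \<alpha> + 1) * (\<Sum>i<cnt N. b ^ i)"
  proof (induction N)
    case (Suc N)
  let ?b = "bernoulli \<alpha> N" and ?c1 = "\<lambda>R. coeff (Suc N) (insert N R)"
  let ?S = "\<Sum>R\<in>Pow {..<N}. bernoulli \<alpha> N R * (norm (coeff N R))\<^sup>2"
    let ?k = "cnt N"
    have rec: "(\<Sum>R\<in>Pow {..<Suc N}. bernoulli \<alpha> (Suc N) R * (norm (coeff (Suc N) R))\<^sup>2)
      = (\<Sum>R\<in>Pow {..<N}. ?b R * (\<alpha> * (norm (?c1 R))\<^sup>2
          + (1 - \<alpha>) * (norm (coeff (Suc N) R))\<^sup>2))"
      using bernoulli_sum_Suc[of \<alpha> N "\<lambda>R. (norm (coeff (Suc N) R))\<^sup>2"] by (simp del: coeff.simps)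
    show ?case
    proof (cases "active N")
      case False
      have "(\<Sum>R\<in>Pow {..<Suc N}. bernoulli \<alpha> (Suc N) R * (norm (coeff (Suc N) R))\<^sup>2)
        = ?S"
        unfolding rec using False coeff_insert by (intro sum.cong) (auto simp: algebra_simps)
      then show ?thesis using Suc.IH False by simp
    next
      case True
      define c where "c = (4 / \<alpha> + 1) * b ^ ?k / (1 - \<alpha>) ^ ?k"
      have q: "0 < (1 - \<alpha>) ^ ?k" using alpha by simp
      have step: "\<alpha> * (norm (?c1 R))\<^sup>2 + (1 - \<alpha>) * (norm (coeff (Suc N) R))\<^sup>2
          \<le> (norm (coeff N R))\<^sup>2 + c * of_bool (\<not> dead N R)" if "R \<in> Pow {..<N}" for R
      proof (cases "dead N R")
        case True
        then have "?c1 R = coeff N R" "coeff (Suc N) R = coeff N R"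
          using coeff_insert[of N R] by (auto simp: dead_insert)
        then show ?thesis using True by (simp add: algebra_simps)
      next
        case False
        have R: "N \<notin> R" using that by auto
        have "norm (ref (Suc N)) \<le> \<sigma> ^ Suc ?k" using ref_bound[of "Suc N"] True by (simp del: ref.simps)
        then have r1: "(norm (ref (Suc N)))\<^sup>2 \<le> (\<sigma>\<^sup>2) ^ Suc ?k"
          by (metis norm_ge_zero power_mono power_mult mult.commute)
        have "\<sigma> ^ Suc ?k \<le> \<sigma> ^ ?k" using sigma_range by (intro power_decreasing) auto
        then have "norm (ref N - ref (Suc N)) \<le> 2 * \<sigma> ^ ?k"
          using ref_bound[of N] \<open>norm (ref (Suc N)) \<le> \<sigma> ^ Suc ?k\<close> norm_triangle_ineq4[of "ref N" "ref (Suc N)"] by linarith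
        then have "(norm (ref N - ref (Suc N)))\<^sup>2 \<le> (2 * \<sigma> ^ ?k)\<^sup>2" by (intro power_mono) auto
        also have "\<dots> = 4 * (\<sigma>\<^sup>2) ^ ?k" by (simp add: power_mult_distrib power_mult[symmetric] mult.commute)
        finally have r2: "(norm (ref N - ref (Suc N)))\<^sup>2 \<le> 4 * (\<sigma>\<^sup>2) ^ ?k" .
        have s: "\<sigma>\<^sup>2 = b * (1 - \<alpha>)" using alpha by (simp add: b_def)
        have "\<alpha> * (norm (?c1 R))\<^sup>2 = (norm (ref N - ref (Suc N)))\<^sup>2 / (\<alpha> * ((1 - \<alpha>) ^ ?k)\<^sup>2)"
          using True False alpha by (simp add: dead_insert norm_divide norm_mult norm_power power_divide power2_eq_square del: ref.simps of_real_diff)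
        also have "\<dots> \<le> 4 * (\<sigma>\<^sup>2) ^ ?k / (\<alpha> * ((1 - \<alpha>) ^ ?k)\<^sup>2)"
          using r2 alpha by (intro divide_right_mono) auto
        also have "\<dots> = (4 / \<alpha>) * b ^ ?k / (1 - \<alpha>) ^ ?k"
          unfolding s power_mult_distrib using q alpha by (simp add: power2_eq_square)
        finally have 1: "\<alpha> * (norm (?c1 R))\<^sup>2 \<le> (4 / \<alpha>) * b ^ ?k / (1 - \<alpha>) ^ ?k" .
        have "(1 - \<alpha>) * (norm (coeff (Suc N) R))\<^sup>2 = (norm (ref (Suc N)))\<^sup>2 / ((1 - \<alpha>) * ((1 - \<alpha>) ^ ?k)\<^sup>2)"
          using True False R alpha by (simp add: norm_divide norm_mult norm_power power_divide power2_eq_square del: ref.simps of_real_diff)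
        also have "\<dots> \<le> (\<sigma>\<^sup>2) ^ Suc ?k / ((1 - \<alpha>) * ((1 - \<alpha>) ^ ?k)\<^sup>2)"
          using r1 alpha by (intro divide_right_mono) auto
        also have "\<dots> = b * b ^ ?k / (1 - \<alpha>) ^ ?k"
          unfolding s power_mult_distrib using q alpha by (simp add: power2_eq_square)
        also have "\<dots> \<le> 1 * b ^ ?k / (1 - \<alpha>) ^ ?k"
          using q b by (intro divide_right_mono mult_right_mono) auto
        finally have 2: "(1 - \<alpha>) * (norm (coeff (Suc N) R))\<^sup>2 \<le> b ^ ?k / (1 - \<alpha>) ^ ?k" by simp
        have "c = (4 / \<alpha>) * b ^ ?k / (1 - \<alpha>) ^ ?k + b ^ ?k / (1 - \<alpha>) ^ ?k"
          by (simp add: c_def distrib_right add_divide_distrib)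
        then show ?thesis using 1 2 False by (simp del: coeff.simps) (smt (verit) zero_le_power2)
      qed
      have "(\<Sum>R\<in>Pow {..<Suc N}. bernoulli \<alpha> (Suc N) R * (norm (coeff (Suc N) R))\<^sup>2)
        \<le> (\<Sum>R\<in>Pow {..<N}. ?b R * ((norm (coeff N R))\<^sup>2 + c * of_bool (\<not> dead N R)))"
        unfolding rec using alpha step by (intro sum_mono mult_left_mono bernoulli_nonneg) (auto simp del: coeff.simps)
      also have "\<dots> = ?S
         + c * (\<Sum>R\<in>Pow {..<N}. ?b R * of_bool (\<not> dead N R))"
        by (simp only: distrib_left sum.distrib sum_distrib_left mult.left_commute)
      also have "\<dots> = ?S + (4 / \<alpha> + 1) * b ^ ?k"
        unfolding expectation_alive c_def using alpha by simp
      finally show ?thesis using Suc.IH True by (simp add: distrib_left)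
    qed
  qed (simp add: bernoulli_def)
  also have "\<dots> \<le> 1 + (4 / \<alpha> + 1) * (1 / (1 - b))"
    using geometric_le[OF b] alpha by (intro add_left_mono mult_left_mono) auto
  finally show ?thesis by (simp add: b_def)
qed

end

section \<open>Fourier analysis on a cyclic group and the Fejer kernel\<close>

lemma sum_square_le_weighted:
  fixes w v :: "'i \<Rightarrow> real"
  assumes "finite I" "\<And>i. i \<in> I \<Longrightarrow> 0 \<le> w i" "(\<Sum>i\<in>I. w i) = 1"
  shows "(\<Sum>i\<in>I. w i * v i)\<^sup>2 \<le> (\<Sum>i\<in>I. w i * (v i)\<^sup>2)"
proof -
  define L where "L = (\<Sum>i\<in>I. w i * v i)"
  have "0 \<le> (\<Sum>i\<in>I. w i * (v i - L)\<^sup>2)" using assms by (intro sum_nonneg) auto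
  also have "\<dots> = (\<Sum>i\<in>I. w i * (v i)\<^sup>2 - 2 * L * (w i * v i) + L\<^sup>2 * w i)"
    by (intro sum.cong refl) (simp add: power2_eq_square algebra_simps)
  also have "\<dots> = (\<Sum>i\<in>I. w i * (v i)\<^sup>2) - 2 * L * L + L\<^sup>2"
    unfolding sum.distrib sum_subtractf sum_distrib_left[symmetric] assms(3) by (simp add: L_def)
  finally show ?thesis unfolding L_def[symmetric] by (simp add: power2_eq_square)
qed

text \<open>
  If the integrand has mean zero in the coordinate \<open>n\<close> and the remaining factor does not depend
  on this coordinate, then its integral against a product measure vanishes.
\<close>
lemma sum_PiE_fibre_zero:
  fixes \<kappa> :: "'b \<Rightarrow> 'c::comm_ring_1"
  assumes I: "finite I" "n \<in> I"
    and A: "\<And>\<xi> b. A (\<xi>(n := b)) = A \<xi>" and D: "(\<Sum>b\<in>B. \<kappa> b * D b) = 0"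
  shows "(\<Sum>\<xi>\<in>PiE I (\<lambda>_. B). (\<Prod>j\<in>I. \<kappa> (\<xi> j)) * (D (\<xi> n) * A \<xi>)) = 0"
proof -
  define I' where "I' = I - {n}"
  have I': "I = insert n I'" "n \<notin> I'" "finite I'" using I by (auto simp: I'_def)
  have "(\<Sum>\<xi>\<in>PiE I (\<lambda>_. B). (\<Prod>j\<in>I. \<kappa> (\<xi> j)) * (D (\<xi> n) * A \<xi>))
    = (\<Sum>(b, \<xi>)\<in>B \<times> PiE I' (\<lambda>_. B). (\<Prod>j\<in>I. \<kappa> ((\<xi>(n := b)) j)) * (D b * A \<xi>))"
    unfolding I'(1) PiE_insert_eq
    by (subst sum.reindex[OF inj_combinator[OF I'(2)]]) (simp add: case_prod_beta A comp_def)
  also have "\<dots> = (\<Sum>(b, \<xi>)\<in>B \<times> PiE I' (\<lambda>_. B). (\<kappa> b * D b) * ((\<Prod>j\<in>I'. \<kappa> (\<xi> j)) * A \<xi>))"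
  proof (intro sum.cong refl, clarify)
    fix b \<xi>
    have "(\<Prod>j\<in>I. \<kappa> ((\<xi>(n := b)) j)) = \<kappa> b * (\<Prod>j\<in>I'. \<kappa> ((\<xi>(n := b)) j))"
      unfolding I'(1) using I' by (subst prod.insert) auto
    also have "(\<Prod>j\<in>I'. \<kappa> ((\<xi>(n := b)) j)) = (\<Prod>j\<in>I'. \<kappa> (\<xi> j))"
      using I'(2) by (intro prod.cong) auto
    finally show "(\<Prod>j\<in>I. \<kappa> ((\<xi>(n := b)) j)) * (D b * A \<xi>) = (\<kappa> b * D b) * ((\<Prod>j\<in>I'. \<kappa> (\<xi> j)) * A \<xi>)"
      by (simp add: mult_ac)
  qed
  also have "\<dots> = (\<Sum>b\<in>B. \<kappa> b * D b) * (\<Sum>\<xi>\<in>PiE I' (\<lambda>_. B). (\<Prod>j\<in>I'. \<kappa> (\<xi> j)) * A \<xi>)"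
    by (simp add: sum_product sum.cartesian_product)
  finally show ?thesis using D by simp
qed

lemma sin_ge_half: "0 \<le> s \<Longrightarrow> s \<le> pi / 2 \<Longrightarrow> s / 2 \<le> sin s" for s :: real
proof -
  assume s: "0 \<le> s" "s \<le> pi / 2"
  have "{..<3::nat} = {0, 1, 2}" by auto
  then have "\<bar>sin s - s\<bar> \<le> s ^ 3 / 6"
    using Maclaurin_sin_bound[of s 3] s by (simp add: sin_coeff_def fact_numeral)
  moreover have "s ^ 3 / 6 \<le> s / 2"
  proof -
    have "s \<le> 3.2 / 2" using s pi_approx by simp
    then have "s\<^sup>2 \<le> (3.2 / 2)\<^sup>2" using s by (intro power_mono) auto
    then have "s\<^sup>2 \<le> 3" by (simp add: power2_eq_square)
    then have "s * s\<^sup>2 \<le> s * 3" using s by (intro mult_left_mono) auto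
    then show ?thesis by (simp add: power3_eq_cube power2_eq_square)
  qed
  ultimately show ?thesis by linarith
qed

lemma norm_1_minus_cis: "norm (1 - cis t) = 2 * \<bar>sin (t / 2)\<bar>"
proof -
  have "(norm (1 - cis t))\<^sup>2 = (1 - cos t)\<^sup>2 + (sin t)\<^sup>2" by (simp add: cmod_power2)
  also have "\<dots> = 2 - 2 * cos t"
    using sin_cos_squared_add[of t] by (simp add: power2_eq_square algebra_simps)
  also have "\<dots> = (2 * \<bar>sin (t / 2)\<bar>)\<^sup>2"
    using cos_double_sin[of "t / 2"] by (simp add: power_mult_distrib)
  finally show ?thesis by (rule power2_eq_imp_eq) auto
qed

lemma norm_1_minus_cis_le: "norm (1 - cis t) \<le> \<bar>t\<bar>"
  using abs_sin_x_le_abs_x[of "t / 2"] by (simp add: norm_1_minus_cis)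

lemma norm_1_minus_cis_ge: "\<bar>t\<bar> \<le> pi \<Longrightarrow> \<bar>t\<bar> / 2 \<le> norm (1 - cis t)"
proof -
  assume t: "\<bar>t\<bar> \<le> pi"
  have "\<bar>t\<bar> / 2 / 2 \<le> sin (\<bar>t\<bar> / 2)" using t by (intro sin_ge_half) auto
  also have "\<dots> \<le> \<bar>sin (t / 2)\<bar>" by (cases "0 \<le> t") auto
  finally show ?thesis by (simp add: norm_1_minus_cis)
qed

text \<open>
  Functions on the cyclic group of order \<open>Q\<close> are \<open>Q\<close>-periodic functions on the
  integers, and both positions and frequencies are summed over the period \<open>{0..<int Q}\<close>.
\<close>
locale cyclic_fourier =
  fixes Q :: nat assumes Q_pos: "0 < Q"
begin

definition chi :: "int \<Rightarrow> complex" where "chi k = cis (2 * pi * of_int k / of_nat Q)"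

abbreviation "period \<equiv> {0..<int Q}"

lemma chi_add: "chi (k + l) = chi k * chi l"
  by (simp add: chi_def cis_mult add_divide_distrib distrib_left)

lemma norm_chi [simp]: "norm (chi k) = 1" by (simp add: chi_def)

lemma chi_0 [simp]: "chi 0 = 1" by (simp add: chi_def)

lemma chi_minus: "chi (- k) = cnj (chi k)" by (simp add: chi_def cis_cnj)

lemma chi_diff: "chi (k - l) = chi k * cnj (chi l)"
  using chi_add[of k "- l"] by (simp add: chi_minus)

lemma chi_power: "chi k ^ n = chi (int n * k)"
  by (induction n) (simp_all add: chi_add distrib_right)

lemma chi_eq_1_iff: "chi k = 1 \<longleftrightarrow> int Q dvd k"
proof
  assume "chi k = 1"
  then have "cos (2 * pi * of_int k / of_nat Q) = 1" by (simp add: chi_def complex_eq_iff)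
  then obtain n :: int where "2 * pi * of_int k / of_nat Q = of_int n * 2 * pi"
    using cos_one_2pi_int by auto
  then have "(of_int k :: real) = of_int (int Q * n)" using Q_pos by (simp add: field_simps)
  then show "int Q dvd k" by (metis dvd_triv_left of_int_eq_iff)
next
  assume "int Q dvd k"
  then obtain n where "k = int Q * n" by auto
  then have "chi k = cis (2 * pi * of_int n)" using Q_pos by (simp add: chi_def mult.assoc del: cis_multiple_2pi)
  then show "chi k = 1" using cis_multiple_2pi[of "of_int n"] by (simp only: Ints_of_int)
qed

lemma chi_mult_period: "chi (int Q * k) = 1" by (simp add: chi_eq_1_iff)

lemma sum_dom_nat: "(\<Sum>x\<in>period. f x) = (\<Sum>n<Q. f (int n))"
proof -
  have "period = int ` {..<Q}" by (simp add: lessThan_atLeast0 image_int_atLeastLessThan)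
  then show ?thesis by (simp add: sum.reindex)
qed

lemma sum_chi: "(\<Sum>x\<in>period. chi (k * x)) = (if int Q dvd k then of_nat Q else 0)"
proof -
  have "(\<Sum>x\<in>period. chi (k * x)) = (\<Sum>n<Q. chi k ^ n)"
    by (simp add: sum_dom_nat chi_power mult.commute)
  also have "\<dots> = (if int Q dvd k then of_nat Q else 0)"
  proof -
    have "chi k ^ Q = 1" by (simp add: chi_power chi_mult_period)
    then show ?thesis by (simp add: sum_gp_strict chi_eq_1_iff)
  qed
  finally show ?thesis .
qed

lemma sum_periodic_shift:
  fixes f :: "int \<Rightarrow> 'a::comm_monoid_add"
  assumes "\<And>x. f (x + int Q) = f x"
  shows "(\<Sum>x\<in>period. f (x + s)) = (\<Sum>x\<in>period. f x)"
proof -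
  have per: "f (x + int Q * k) = f x" for x k
  proof (induction k rule: int_induct[where k = 0])
    case (step1 i)
    then show ?case using assms[of "x + int Q * i"] by (simp add: algebra_simps)
  next
    case (step2 i)
    then show ?case using assms[of "x + int Q * (i - 1)"] by (simp add: algebra_simps)
  qed simp
  have pmod: "f (x mod int Q) = f x" for x
    using per[of "x mod int Q" "x div int Q"] by simp
  show ?thesis
  proof (rule sum.reindex_bij_witness[of _ "\<lambda>x. (x - s) mod int Q" "\<lambda>x. (x + s) mod int Q"])
    fix x assume "x \<in> period"
    then show "((x + s) mod int Q - s) mod int Q = x" "((x - s) mod int Q + s) mod int Q = x"
      by (simp_all add: mod_simps)
    show "(x + s) mod int Q \<in> period" "(x - s) mod int Q \<in> period" using Q_pos by simp_all
    show "f ((x + s) mod int Q) = f (x + s)" by (rule pmod)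
  qed
qed

text \<open>
  The function with Fourier coefficients \<open>c\<close>. A Fourier multiplier acts on \<open>c\<close> by
  pointwise multiplication.
\<close>
definition synth :: "(int \<Rightarrow> complex) \<Rightarrow> int \<Rightarrow> complex" where
  "synth c x = (\<Sum>a\<in>period. c a * chi (a * x))"

lemma synth_periodic: "synth c (x + int Q) = synth c x"
  unfolding synth_def by (intro sum.cong refl) (simp add: distrib_left chi_add mult.commute[of _ "int Q"] chi_mult_period)

lemma synth_exists:
  assumes "\<And>x. f (x + int Q) = f x"
  shows "\<exists>c. \<forall>x. synth c x = f x"
proof (intro exI allI)
  fix x
  define c where "c a = (\<Sum>y\<in>period. f y * chi (- (a * y))) / of_nat Q" for a
  have "synth c x = (\<Sum>a\<in>period. \<Sum>y\<in>period. f y * chi (a * (x - y))) / of_nat Q"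
    unfolding synth_def c_def sum_divide_distrib sum_distrib_right
    by (intro sum.cong refl) (simp add: right_diff_distrib chi_diff chi_minus)
  also have "(\<Sum>a\<in>period. \<Sum>y\<in>period. f y * chi (a * (x - y))) = (\<Sum>y\<in>period. f y * (\<Sum>a\<in>period. chi ((x - y) * a)))"
    by (subst sum.swap) (simp add: sum_distrib_left mult.commute)
  also have "\<dots> = (\<Sum>y\<in>period. f (y + x) * (\<Sum>a\<in>period. chi ((x - (y + x)) * a)))"
  proof (rule sum_periodic_shift[symmetric])
    fix y
    have "chi ((x - (y + int Q)) * a) = chi ((x - y) * a)" for a
      by (simp add: left_diff_distrib distrib_right chi_diff chi_add chi_mult_period)
    then show "f (y + int Q) * (\<Sum>a\<in>period. chi ((x - (y + int Q)) * a)) = f y * (\<Sum>a\<in>period. chi ((x - y) * a))"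
      by (simp add: assms)
  qed
  also have "\<dots> = (\<Sum>y\<in>period. if y = 0 then f x * of_nat Q else 0)"
    unfolding sum_chi by (intro sum.cong refl) (auto dest: zdvd_imp_le)
  also have "\<dots> = f x * of_nat Q" using Q_pos by simp
  finally show "synth (\<lambda>a. (\<Sum>y\<in>period. f y * chi (- (a * y))) / of_nat Q) x = f x"
    using Q_pos unfolding c_def by simp
qed

lemma parseval: "(\<Sum>x\<in>period. (norm (synth c x))\<^sup>2) = of_nat Q * (\<Sum>a\<in>period. (norm (c a))\<^sup>2)"
proof -
  have "complex_of_real (\<Sum>x\<in>period. (norm (synth c x))\<^sup>2) = (\<Sum>x\<in>period. synth c x * cnj (synth c x))"
    by (simp only: of_real_sum complex_norm_square)
  also have "\<dots> = (\<Sum>x\<in>period. \<Sum>a\<in>period. \<Sum>b\<in>period. c a * cnj (c b) * chi ((a - b) * x))"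
    unfolding synth_def cnj_sum sum_product
    by (intro sum.cong refl) (simp add: left_diff_distrib chi_diff)
  also have "\<dots> = (\<Sum>a\<in>period. \<Sum>b\<in>period. c a * cnj (c b) * (\<Sum>x\<in>period. chi ((a - b) * x)))"
    unfolding sum_distrib_left by (subst sum.swap, rule sum.cong[OF refl], rule sum.swap)
  also have "\<dots> = (\<Sum>a\<in>period. \<Sum>b\<in>period. if b = a then c a * cnj (c b) * of_nat Q else 0)"
    unfolding sum_chi
  proof (intro sum.cong refl)
    fix a b assume "a \<in> period" "b \<in> period"
    then have "int Q dvd a - b \<longleftrightarrow> b = a"
      by (metis atLeastLessThan_iff diff_self dvd_0_right mod_eq_dvd_iff mod_pos_pos_trivial)
    then show "c a * cnj (c b) * (if int Q dvd a - b then of_nat Q else 0) = (if b = a then c a * cnj (c b) * of_nat Q else 0)"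
      by simp
  qed
  also have "\<dots> = (\<Sum>a\<in>period. c a * cnj (c a) * of_nat Q)" by simp
  also have "\<dots> = complex_of_real (of_nat Q * (\<Sum>a\<in>period. (norm (c a))\<^sup>2))"
    by (simp only: of_real_mult of_real_of_nat_eq of_real_sum complex_norm_square sum_distrib_left mult.commute)
  finally show ?thesis by (simp only: of_real_eq_iff)
qed

end

locale fejer_kernel = cyclic_fourier +
  fixes B :: nat assumes B_pos: "0 < B" and B_le: "2 * B \<le> Q"
begin

text \<open>
  The squared modulus of a Dirichlet kernel of length \<open>B\<close>, normalised to total mass one. It is
  a probability density whose Fourier transform \<open>khat\<close> is supported on frequencies at distance
  less than \<open>B\<close> from zero; \<open>khat\<close> is computed by counting the solutions in
  \<open>pairs\<close>.
\<close>
definition fejer :: "int \<Rightarrow> real" where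
  "fejer x = (norm (\<Sum>i<B. chi (int i * x)))\<^sup>2 / (real Q * real B)"

definition pairs :: "int \<Rightarrow> (nat \<times> nat) set" where
  "pairs b = {(i, i'). i < B \<and> i' < B \<and> int Q dvd int i - int i' + b}"

definition khat :: "int \<Rightarrow> real" where
  "khat b = real (card (pairs b)) / real B"

lemma fejer_nonneg: "0 \<le> fejer x" by (simp add: fejer_def)

lemma fejer_hat: "(\<Sum>x\<in>period. of_real (fejer x) * chi (b * x)) = of_real (khat b)"
proof -
  have "of_real (fejer x) * chi (b * x) = (\<Sum>i<B. \<Sum>i'<B. chi ((int i - int i' + b) * x)) / of_nat (Q * B)" for x
  proof -
    have "complex_of_real ((norm (\<Sum>i<B. chi (int i * x)))\<^sup>2) * chi (b * x) =
       (\<Sum>i<B. \<Sum>i'<B. chi ((int i - int i' + b) * x))"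
      unfolding complex_norm_square cnj_sum sum_product unfolding sum_distrib_right
      by (intro sum.cong refl) (simp add: left_diff_distrib distrib_right chi_diff chi_add)
    then show ?thesis unfolding fejer_def by simp
  qed
  then have "(\<Sum>x\<in>period. of_real (fejer x) * chi (b * x))
    = (\<Sum>x\<in>period. \<Sum>i<B. \<Sum>i'<B. chi ((int i - int i' + b) * x)) / of_nat (Q * B)"
    by (simp add: sum_divide_distrib)
  also have "(\<Sum>x\<in>period. \<Sum>i<B. \<Sum>i'<B. chi ((int i - int i' + b) * x))
    = (\<Sum>i<B. \<Sum>i'<B. \<Sum>x\<in>period. chi ((int i - int i' + b) * x))"
    by (subst sum.swap, intro sum.cong refl, subst sum.swap) simp
  also have "\<dots> = (\<Sum>(i,i')\<in>{..<B} \<times> {..<B}. if int Q dvd int i - int i' + b then of_nat Q else 0)"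
    unfolding sum_chi sum.cartesian_product ..
  also have "\<dots> = (\<Sum>p\<in>pairs b. of_nat Q)"
    by (rule sum.mono_neutral_cong_right) (auto simp: pairs_def split: if_splits)
  finally show ?thesis using Q_pos by (simp add: khat_def)
qed

lemma khat_le_1: "khat b \<le> 1"
proof -
  have "inj_on fst (pairs b)"
  proof (rule inj_onI, clarify)
    fix i i' j j' assume p: "(i, i') \<in> pairs b" "(j, j') \<in> pairs b" "fst (i, i') = fst (j, j')"
    then have "int Q dvd (int i - int i' + b) - (int j - int j' + b)"
      unfolding pairs_def by (intro dvd_diff) auto
    then have d: "int Q dvd int j' - int i'" using p by simp
    have "\<bar>int j' - int i'\<bar> < int Q" using p B_le by (auto simp: pairs_def)
    then have "int j' - int i' = 0" using d by (metis abs_dvd_iff zdvd_not_zless zero_less_abs_iff dvd_abs_iff)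
    then show "i = j \<and> i' = j'" using p by simp
  qed
  moreover have "fst ` pairs b \<subseteq> {..<B}" by (auto simp: pairs_def)
  ultimately have "card (pairs b) \<le> B" by (metis card_inj_on_le card_lessThan finite_lessThan)
  then show ?thesis using B_pos by (simp add: khat_def)
qed

lemma khat_nonneg: "0 \<le> khat b" by (simp add: khat_def)

lemma khat_minus: "khat (- b) = khat b"
proof -
  have "complex_of_real (khat (- b)) = cnj (\<Sum>x\<in>period. of_real (fejer x) * chi (b * x))"
    unfolding fejer_hat[symmetric] by (simp add: chi_minus)
  then show ?thesis unfolding fejer_hat by simp
qed

lemma khat_eq_0: "2 * pi * real B / real Q \<le> norm (1 - chi b) \<Longrightarrow> khat b = 0"
proof (rule ccontr)
  assume big: "2 * pi * real B / real Q \<le> norm (1 - chi b)" and "khat b \<noteq> 0"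
  then have "pairs b \<noteq> {}" by (auto simp: khat_def)
  then obtain i i' where p: "i < B" "i' < B" "int Q dvd int i - int i' + b" by (auto simp: pairs_def)
  have "chi (int i' - int i) = chi (int i' - int i) * chi (int i - int i' + b)"
    using p(3) chi_eq_1_iff by simp
  also have "\<dots> = chi b" by (simp add: chi_add[symmetric])
  finally have "norm (1 - chi b) = norm (1 - chi (int i' - int i))" by simp
  also have "\<dots> \<le> \<bar>2 * pi * of_int (int i' - int i) / of_nat Q\<bar>"
    unfolding chi_def by (rule norm_1_minus_cis_le)
  also have "\<dots> = 2 * pi * \<bar>real i' - real i\<bar> / real Q" by (simp add: abs_mult)
  also have "\<dots> < 2 * pi * real B / real Q"
    using p Q_pos by (intro divide_strict_right_mono mult_strict_left_mono) auto
  finally show False using big by simp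
qed

lemma khat_near_1: "1 - khat b \<le> real Q / real B * norm (1 - chi b)"
proof -
  \<comment> \<open>the representative of \<open>b\<close> of least absolute value\<close>
  have "\<exists>b0. int Q dvd b0 - b \<and> 2 * \<bar>b0\<bar> \<le> int Q"
  proof (cases "2 * (b mod int Q) \<le> int Q")
    case True
    have "int Q dvd b mod int Q - b" by (metis mod_eq_dvd_iff mod_mod_trivial)
    then show ?thesis using True Q_pos by (intro exI[of _ "b mod int Q"]) auto
  next
    case False
    have "int Q dvd (b mod int Q - int Q) - b" by (metis mod_eq_dvd_iff mod_mod_trivial minus_mod_self2)
    moreover have "b mod int Q < int Q" using Q_pos by simp
    ultimately show ?thesis using False by (intro exI[of _ "b mod int Q - int Q"]) auto
  qed
  then obtain b0 where b0: "int Q dvd b0 - b" "2 * \<bar>b0\<bar> \<le> int Q" by blast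
  have "chi b = chi b * chi (b0 - b)" using b0(1) chi_eq_1_iff by simp
  also have "\<dots> = chi b0" by (simp add: chi_add[symmetric])
  finally have "chi b = chi b0" .
  have "\<bar>real_of_int b0\<bar> / real Q \<le> \<bar>2 * pi * of_int b0 / of_nat Q\<bar> / 2"
    using pi_gt3 Q_pos by (simp add: abs_mult field_simps mult_le_cancel_right1)
  also have "\<dots> \<le> norm (1 - chi b0)"
    unfolding chi_def
  proof (rule norm_1_minus_cis_ge)
    have "2 * \<bar>real_of_int b0\<bar> \<le> real Q" using b0(2) by linarith
    then show "\<bar>2 * pi * of_int b0 / of_nat Q\<bar> \<le> pi" using Q_pos by (simp add: abs_mult field_simps)
  qed
  finally have lower: "\<bar>real_of_int b0\<bar> / real Q \<le> norm (1 - chi b)" using \<open>chi b = chi b0\<close> by simp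
  have fin: "finite (pairs b)" by (rule finite_subset[of _ "{..<B} \<times> {..<B}"]) (auto simp: pairs_def)
  have "B - nat \<bar>b0\<bar> \<le> card (pairs b)"
  proof (cases "0 \<le> b0")
    case True
    have "(\<lambda>i. (i, i + nat b0)) ` {..<B - nat b0} \<subseteq> pairs b"
    proof (rule image_subsetI)
      fix i assume "i \<in> {..<B - nat b0}"
      moreover have "int Q dvd b - b0" using b0(1) by (metis dvd_minus_iff minus_diff_eq)
      ultimately show "(i, i + nat b0) \<in> pairs b" using True by (auto simp: pairs_def)
    qed
    from card_mono[OF fin this] show ?thesis using True by (simp add: card_image inj_on_def)
  next
    case False
    have "(\<lambda>i. (i + nat (- b0), i)) ` {..<B - nat (- b0)} \<subseteq> pairs b"
    proof (rule image_subsetI)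
      fix i assume "i \<in> {..<B - nat (- b0)}"
      moreover have "int Q dvd b - b0" using b0(1) by (metis dvd_minus_iff minus_diff_eq)
      ultimately show "(i + nat (- b0), i) \<in> pairs b" using False by (auto simp: pairs_def)
    qed
    from card_mono[OF fin this] show ?thesis using False by (simp add: card_image inj_on_def)
  qed
  then have "real B - \<bar>real_of_int b0\<bar> \<le> real (card (pairs b))" by linarith
  then have "(real B - real (card (pairs b))) / real B \<le> \<bar>real_of_int b0\<bar> / real B"
    by (intro divide_right_mono) auto
  then have "1 - khat b \<le> \<bar>real_of_int b0\<bar> / real B"
    using B_pos by (simp add: khat_def diff_divide_distrib)
  also have "\<dots> = real Q / real B * (\<bar>real_of_int b0\<bar> / real Q)" using Q_pos by simp
  also have "\<dots> \<le> real Q / real B * norm (1 - chi b)" using lower by (intro mult_left_mono) auto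
  finally show ?thesis .
qed

lemma khat_0: "khat 0 = 1"
  using khat_near_1[of 0] khat_le_1[of 0] by simp

lemma fejer_sum: "(\<Sum>x\<in>period. fejer x) = 1"
proof -
  have "complex_of_real (\<Sum>x\<in>period. fejer x) = 1" using fejer_hat[of 0] khat_0 by simp
  then show ?thesis by (simp only: of_real_eq_1_iff)
qed

end

section \<open>Rota dilation and the variation of a multiplier sequence\<close>

lemma pvar_cong: "(\<And>n. n \<le> N \<Longrightarrow> a n = b n) \<Longrightarrow> pvar r N a = pvar r N b"
  unfolding pvar_def by (intro SUP_cong refl) auto

lemma pvar_weighted_sum_sq:
  assumes "2 \<le> r" "finite I" "\<And>i. i \<in> I \<Longrightarrow> 0 \<le> w i" "(\<Sum>i\<in>I. w i) = 1"
  shows "(pvar r N (\<lambda>n. \<Sum>i\<in>I. of_real (w i) * a i n))\<^sup>2 \<le> (\<Sum>i\<in>I. w i * (pvar r N (a i))\<^sup>2)"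
proof -
  have "(pvar r N (\<lambda>n. \<Sum>i\<in>I. of_real (w i) * a i n))\<^sup>2 \<le> (\<Sum>i\<in>I. w i * pvar r N (a i))\<^sup>2"
    using assms by (intro power_mono pvar_weighted_sum pvar_nonneg) auto
  also have "\<dots> \<le> (\<Sum>i\<in>I. w i * (pvar r N (a i))\<^sup>2)"
    using assms by (intro sum_square_le_weighted) auto
  finally show ?thesis .
qed

lemma thinned_Suc: "thinned w R (Suc n) = thinned w R n * (if n \<in> R then w n else 1)"
  by (simp add: thinned_def)

lemma thinned_power2: "thinned (\<lambda>j. (w j)\<^sup>2) R n = (thinned w R n)\<^sup>2"
  unfolding thinned_def prod_power_distrib by (intro prod.cong) auto

context fejer_kernel
begin

lemma fejer_translates:
  "(\<Sum>b\<in>period. of_real (fejer b) * synth c (x - k * b)) = synth (\<lambda>a. of_real (khat (a * k)) * c a) x"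
proof -
  have "(\<Sum>b\<in>period. of_real (fejer b) * synth c (x - k * b))
    = (\<Sum>b\<in>period. \<Sum>a\<in>period. c a * chi (a * x) * (of_real (fejer b) * chi (- (a * k) * b)))"
    unfolding synth_def sum_distrib_left
  proof (intro sum.cong refl)
    fix a b :: int
    have "chi (a * (x - k * b)) = chi (a * x) * chi (- (a * k) * b)"
      unfolding chi_add[symmetric] by (simp add: algebra_simps)
    then show "of_real (fejer b) * (c a * chi (a * (x - k * b))) = c a * chi (a * x) * (of_real (fejer b) * chi (- (a * k) * b))"
      by simp
  qed
  also have "\<dots> = (\<Sum>a\<in>period. c a * chi (a * x) * (\<Sum>b\<in>period. of_real (fejer b) * chi (- (a * k) * b)))"
    unfolding sum_distrib_left by (rule sum.swap)
  also have "\<dots> = synth (\<lambda>a. of_real (khat (a * k)) * c a) x"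
    unfolding fejer_hat synth_def by (intro sum.cong refl) (simp add: khat_minus)
  finally show ?thesis .
qed

text \<open>
  Let \<open>\<xi> 0, \<xi> 1, \<dots>\<close> be independent with the Fejer law, and let a uniformly
  distributed point \<open>x\<close> perform the walk with steps \<open>s j * \<xi> j\<close>, \<open>j
  \<in> R\<close>. If \<open>f\<close> has coefficients \<open>c\<close>, and \<open>v n\<close> is the
  thinned product of the factors \<open>khat (a * s j)\<close>, then the function with coefficients \<open>v
  n * c\<close>, evaluated at the position at time \<open>n\<close>, is a martingale for decreasing
  \<open>n\<close>, with final value \<open>f x\<close>. Averaging over the walk multiplies the coefficients
  by \<open>v n\<close> once more. This is why squares of \<open>khat\<close> appear; and the variation does
  not increase under averaging.
\<close>
lemma rota_variation:
  fixes s :: "nat \<Rightarrow> int"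
  assumes r: "2 < r"
  shows "(\<Sum>x\<in>period. (pvar r N (\<lambda>n. synth (\<lambda>a. of_real (thinned (\<lambda>j. (khat (a * s j))\<^sup>2) R n) * c a) x))\<^sup>2)
     \<le> 5120 * (r / (r-2)) * (\<Sum>x\<in>period. (norm (synth c x))\<^sup>2)"
proof -
  define P where "P = PiE {..<N} (\<lambda>_. period)"
  define wt where "wt \<xi> = (\<Prod>j<N. fejer (\<xi> j))" for \<xi>
  define S where "S n \<xi> = (\<Sum>j<n. if j \<in> R then s j * \<xi> j else 0)" for n and \<xi> :: "nat \<Rightarrow> int"
  define v where "v n a = thinned (\<lambda>j. khat (a * s j)) R n" for n a
  define g where "g n a = of_real (v n a) * c a" for n a
  define Y where "Y n \<omega> = synth (g n) (fst \<omega> + S n (snd \<omega>))" for n \<omega>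
  have finP: "finite P" unfolding P_def by (intro finite_PiE) auto
  have wt0: "0 \<le> wt \<xi>" for \<xi> unfolding wt_def by (intro prod_nonneg) (auto simp: fejer_nonneg)
  have wt1: "(\<Sum>\<xi>\<in>P. wt \<xi>) = 1"
    using prod_sum_PiE[of "{..<N}" "\<lambda>_. period" "\<lambda>_. fejer"] unfolding P_def wt_def by (simp add: fejer_sum)
  have shift: "synth h (x + int Q + z) = synth h (x + z)" for h x z
    using synth_periodic[of h "x + z"] by (simp add: algebra_simps)
  have mart: "finite_martingale (period \<times> P) (\<lambda>\<omega>. wt (snd \<omega>)) (\<lambda>t. Y (N - t)) N"
  proof
    show "finite (period \<times> P)" using finP by simp
    show "0 \<le> wt (snd \<omega>)" for \<omega> :: "int \<times> (nat \<Rightarrow> int)" by (rule wt0)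
    fix t and \<alpha> :: "(nat \<Rightarrow> complex) \<Rightarrow> complex" assume t: "t < N"
    define n where "n = N - Suc t"
    have n: "n < N" "N - t = Suc n" "N - Suc t = n" using t by (auto simp: n_def)
    have late: "Suc n \<le> N - min k t" for k using n(2) by auto
    define A where "A x \<xi> = cnj (\<alpha> (\<lambda>k. synth (g (N - min k t)) (x + (S (N - min k t) \<xi> - S (Suc n) \<xi>))))" for x \<xi>
    define D where "D x b = synth (g n) (x - (if n \<in> R then s n * b else 0)) - synth (g (Suc n)) x" for x b
    have S_diff: "S m \<xi> - S (Suc n) \<xi> = (\<Sum>j\<in>{Suc n..<m}. if j \<in> R then s j * \<xi> j else 0)" if "Suc n \<le> m" for m \<xi>
      unfolding S_def lessThan_atLeast0 using that by (intro sum_diff_nat_ivl) auto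
    have A_upd: "A x (\<xi>(n := b)) = A x \<xi>" for x \<xi> b
    proof -
      have "S m (\<xi>(n := b)) - S (Suc n) (\<xi>(n := b)) = S m \<xi> - S (Suc n) \<xi>" if "Suc n \<le> m" for m
        unfolding S_diff[OF that] by (intro sum.cong) auto
      then show ?thesis unfolding A_def using late by simp
    qed
    have D_zero: "(\<Sum>b\<in>period. of_real (fejer b) * D x b) = 0" for x
    proof -
      have one: "(\<Sum>b\<in>period. complex_of_real (fejer b)) = 1" unfolding of_real_sum[symmetric] fejer_sum by simp
      have "(\<Sum>b\<in>period. of_real (fejer b) * synth (g n) (x - (if n \<in> R then s n * b else 0))) = synth (g (Suc n)) x"
      proof (cases "n \<in> R")
        case True
        have "(\<lambda>a. of_real (khat (a * s n)) * g n a) = g (Suc n)"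
          using True by (simp add: g_def v_def thinned_Suc fun_eq_iff)
        then show ?thesis using True fejer_translates[of "g n" x "s n"] by simp
      next
        case False
        then have "g (Suc n) = g n" by (simp add: g_def v_def thinned_Suc fun_eq_iff)
        then show ?thesis using False one by (simp add: sum_distrib_right[symmetric])
      qed
      then show ?thesis using one
        by (simp add: D_def right_diff_distrib sum_subtractf sum_distrib_right[symmetric])
    qed
    have term_eq: "(Y n (x, \<xi>) - Y (Suc n) (x, \<xi>)) * cnj (\<alpha> (\<lambda>k. Y (N - min k t) (x, \<xi>)))
        = D (x + S (Suc n) \<xi>) (\<xi> n) * A (x + S (Suc n) \<xi>) \<xi>" for x \<xi>
    proof -
      have st: "x + S (Suc n) \<xi> - (if n \<in> R then s n * \<xi> n else 0) = x + S n \<xi>" by (simp add: S_def)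
      show ?thesis unfolding Y_def D_def A_def fst_conv snd_conv st by simp
    qed
    \<comment> \<open>translating the starting point by the walk up to time \<open>n + 1\<close> makes the later values independent of \<open>\<xi> n\<close>\<close>
    have "(\<Sum>\<omega>\<in>period \<times> P. of_real (wt (snd \<omega>)) *
        ((Y n \<omega> - Y (Suc n) \<omega>) * cnj (\<alpha> (\<lambda>k. Y (N - min k t) \<omega>))))
      = (\<Sum>x\<in>period. \<Sum>\<xi>\<in>P. of_real (wt \<xi>) * (D (x + S (Suc n) \<xi>) (\<xi> n) * A (x + S (Suc n) \<xi>) \<xi>))"
      unfolding sum.cartesian_product by (intro sum.cong refl) (clarsimp simp: term_eq)
    also have "\<dots> = (\<Sum>\<xi>\<in>P. of_real (wt \<xi>) * (\<Sum>x\<in>period. D (x + S (Suc n) \<xi>) (\<xi> n) * A (x + S (Suc n) \<xi>) \<xi>))"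
      unfolding sum_distrib_left by (rule sum.swap)
    also have "\<dots> = (\<Sum>\<xi>\<in>P. of_real (wt \<xi>) * (\<Sum>x\<in>period. D x (\<xi> n) * A x \<xi>))"
    proof (rule sum.cong[OF refl], rule arg_cong2[where f = "(*)", OF refl])
      fix \<xi>
      show "(\<Sum>x\<in>period. D (x + S (Suc n) \<xi>) (\<xi> n) * A (x + S (Suc n) \<xi>) \<xi>) = (\<Sum>x\<in>period. D x (\<xi> n) * A x \<xi>)"
      proof (rule sum_periodic_shift)
        fix x
        have "D (x + int Q) (\<xi> n) = D x (\<xi> n)"
          unfolding D_def synth_periodic diff_conv_add_uminus[of _ "if n \<in> R then s n * \<xi> n else 0"] shift ..
        moreover have "A (x + int Q) \<xi> = A x \<xi>" unfolding A_def shift ..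
        ultimately show "D (x + int Q) (\<xi> n) * A (x + int Q) \<xi> = D x (\<xi> n) * A x \<xi>" by simp
      qed
    qed
    also have "\<dots> = (\<Sum>x\<in>period. \<Sum>\<xi>\<in>P. of_real (wt \<xi>) * (D x (\<xi> n) * A x \<xi>))"
      unfolding sum_distrib_left by (rule sum.swap)
    also have "\<dots> = 0"
    proof (rule sum.neutral, rule ballI)
      fix x
      show "(\<Sum>\<xi>\<in>P. of_real (wt \<xi>) * (D x (\<xi> n) * A x \<xi>)) = 0"
        unfolding P_def wt_def of_real_prod
        using n(1) A_upd D_zero by (intro sum_PiE_fibre_zero) auto
    qed
    finally show "(\<Sum>\<omega>\<in>period \<times> P. of_real (wt (snd \<omega>)) *
        ((Y (N - Suc t) \<omega> - Y (N - t) \<omega>) * cnj (\<alpha> (\<lambda>k. Y (N - min k t) \<omega>)))) = 0"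
      unfolding n(2,3) .
  qed
  have project: "synth (\<lambda>a. of_real (thinned (\<lambda>j. (khat (a * s j))\<^sup>2) R n) * c a) x
     = (\<Sum>\<xi>\<in>P. of_real (wt \<xi>) * Y n (x, \<xi>))" if "n \<le> N" for n x
  proof -
    have E: "(\<Sum>\<xi>\<in>P. of_real (wt \<xi>) * chi (a * S n \<xi>)) = of_real (v n a)" for a
    proof -
      let ?q = "\<lambda>j b. if j < n \<and> j \<in> R then chi (a * s j * b) else 1"
      have "chi (a * S n \<xi>) = (\<Prod>j<N. ?q j (\<xi> j))" for \<xi>
      proof -
        have "chi (a * S m \<xi>) = (\<Prod>j<m. if j \<in> R then chi (a * s j * \<xi> j) else 1)" for m
          by (induction m) (simp_all add: S_def distrib_left chi_add mult.assoc)
        then have "chi (a * S n \<xi>) = (\<Prod>j<n. ?q j (\<xi> j))" by (auto intro: prod.cong)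
        also have "\<dots> = (\<Prod>j<N. ?q j (\<xi> j))" using that by (intro prod.mono_neutral_left) auto
        finally show ?thesis .
      qed
      then have "(\<Sum>\<xi>\<in>P. of_real (wt \<xi>) * chi (a * S n \<xi>)) = (\<Sum>\<xi>\<in>P. \<Prod>j<N. of_real (fejer (\<xi> j)) * ?q j (\<xi> j))"
        by (simp add: wt_def prod.distrib)
      also have "\<dots> = (\<Prod>j<N. \<Sum>b\<in>period. of_real (fejer b) * ?q j b)"
        unfolding P_def by (intro prod_sum_PiE[symmetric]) auto
      also have "\<dots> = (\<Prod>j<N. if j < n \<and> j \<in> R then of_real (khat (a * s j)) else 1)"
      proof (intro prod.cong refl)
        fix j
        show "(\<Sum>b\<in>period. of_real (fejer b) * ?q j b) = (if j < n \<and> j \<in> R then of_real (khat (a * s j)) else 1)"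
          using fejer_hat[of "a * s j"] by (auto simp: of_real_sum[symmetric] fejer_sum simp del: of_real_sum)
      qed
      also have "\<dots> = (\<Prod>j<n. if j < n \<and> j \<in> R then of_real (khat (a * s j)) else 1)"
        using that by (intro prod.mono_neutral_right) auto
      also have "\<dots> = of_real (v n a)"
        unfolding v_def thinned_def of_real_prod by (intro prod.cong) auto
      finally show ?thesis .
    qed
    have "(\<Sum>\<xi>\<in>P. of_real (wt \<xi>) * Y n (x, \<xi>)) = (\<Sum>a\<in>period. g n a * chi (a * x) * (\<Sum>\<xi>\<in>P. of_real (wt \<xi>) * chi (a * S n \<xi>)))"
      unfolding Y_def synth_def sum_distrib_left
      by (subst sum.swap) (simp add: distrib_left chi_add mult_ac)
    also have "\<dots> = synth (\<lambda>a. of_real (thinned (\<lambda>j. (khat (a * s j))\<^sup>2) R n) * c a) x"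
      unfolding E synth_def thinned_power2
      by (intro sum.cong refl) (simp add: g_def v_def power2_eq_square mult_ac)
    finally show ?thesis by simp
  qed
  have "(\<Sum>x\<in>period. (pvar r N (\<lambda>n. synth (\<lambda>a. of_real (thinned (\<lambda>j. (khat (a * s j))\<^sup>2) R n) * c a) x))\<^sup>2)
    = (\<Sum>x\<in>period. (pvar r N (\<lambda>n. \<Sum>\<xi>\<in>P. of_real (wt \<xi>) * Y n (x, \<xi>)))\<^sup>2)"
    using project by (intro sum.cong refl arg_cong[where f = "\<lambda>z. z\<^sup>2"] pvar_cong)
  also have "\<dots> \<le> (\<Sum>x\<in>period. \<Sum>\<xi>\<in>P. wt \<xi> * (pvar r N (\<lambda>n. Y n (x, \<xi>)))\<^sup>2)"
    using r finP wt0 wt1 by (intro sum_mono pvar_weighted_sum_sq) auto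
  also have "\<dots> = (\<Sum>\<omega>\<in>period \<times> P. wt (snd \<omega>) * (pvar r N (\<lambda>n. Y (N - (N - n)) \<omega>))\<^sup>2)"
  proof -
    have "pvar r N (\<lambda>n. Y n \<omega>) = pvar r N (\<lambda>n. Y (N - (N - n)) \<omega>)" for \<omega> by (intro pvar_cong) auto
    then show ?thesis unfolding sum.cartesian_product by (intro sum.cong refl) (simp add: case_prod_beta)
  qed
  also have "\<dots> \<le> 5120 * (r / (r-2)) * (\<Sum>\<omega>\<in>period \<times> P. wt (snd \<omega>) * (norm (Y (N - N) \<omega>))\<^sup>2)"
    by (rule finite_martingale.lepingle[OF mart r])
  also have "(\<Sum>\<omega>\<in>period \<times> P. wt (snd \<omega>) * (norm (Y (N - N) \<omega>))\<^sup>2) = (\<Sum>x\<in>period. (norm (synth c x))\<^sup>2)"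
  proof -
    have g0: "g 0 = c" by (simp add: g_def v_def thinned_def fun_eq_iff)
    have "(\<Sum>\<omega>\<in>period \<times> P. wt (snd \<omega>) * (norm (Y (N - N) \<omega>))\<^sup>2) = (\<Sum>x\<in>period. \<Sum>\<xi>\<in>P. wt \<xi> * (norm (synth c x))\<^sup>2)"
      unfolding sum.cartesian_product by (intro sum.cong refl) (simp add: case_prod_beta Y_def S_def g0)
    also have "\<dots> = (\<Sum>x\<in>period. (norm (synth c x))\<^sup>2)"
      unfolding sum_distrib_right[symmetric] wt1 by simp
    finally show ?thesis .
  qed
  finally show ?thesis .
qed

end

lemma (in expanding_multipliers) product_decomposition:
  "\<exists>H e. (\<forall>n\<le>N. (\<Prod>j<n. p j) =
      (\<Sum>R\<in>Pow {..<N}. of_real (bernoulli \<alpha> N R) * (of_real (thinned w R n) * H R)) + e n) \<and>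
    (\<Sum>R\<in>Pow {..<N}. bernoulli \<alpha> N R * (norm (H R))\<^sup>2) \<le> 1 + (4 / \<alpha> + 1) / (1 - \<sigma>\<^sup>2 / (1 - \<alpha>)) \<and>
    (\<Sum>n\<le>N. (norm (e n))\<^sup>2) \<le> 32 * K\<^sup>2 / (1 - \<rho>)"
proof (intro exI conjI allI impI)
  fix n assume "n \<le> N"
  from expectation_coeff_thinned[OF this]
  show "(\<Prod>j<n. p j) =
      (\<Sum>R\<in>Pow {..<N}. of_real (bernoulli \<alpha> N R) * (of_real (thinned w R n) * coeff N R))
        + (m n - of_real (u n) * ref n)"
    by (simp add: scaleR_conv_of_real m_def)
qed (rule expectation_coeff_sq_le sum_error_sq_le)+

text \<open>
  The variation of a sequence of Fourier multipliers that satisfies the hypotheses of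
  \<open>expanding_multipliers\<close> at every frequency, with common constants.
\<close>
lemma (in fejer_kernel) multiplier_variation:
  fixes s :: "nat \<Rightarrow> int"
  assumes r: "2 < r"
    and em: "\<And>a. expanding_multipliers (x a) (p a) (\<lambda>j. (khat (a * s j))\<^sup>2) \<eta> \<rho> \<alpha> K"
    and C: "C = 10240 * (1 + (4 / \<alpha> + 1) / (1 - (\<rho> / (1 - 2 * \<alpha> * K * \<eta>))\<^sup>2 / (1 - \<alpha>))) + 256 * K\<^sup>2 / (1 - \<rho>)"
  shows "(\<Sum>x\<in>period. (pvar r N (\<lambda>n. synth (\<lambda>a. (\<Prod>j<n. p a j) * c a) x))\<^sup>2)
     \<le> C * (r / (r-2)) * (\<Sum>x\<in>period. (norm (synth c x))\<^sup>2)"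
proof -
  define C1 where "C1 = 1 + (4 / \<alpha> + 1) / (1 - (\<rho> / (1 - 2 * \<alpha> * K * \<eta>))\<^sup>2 / (1 - \<alpha>))"
  define C2 where "C2 = 32 * K\<^sup>2 / (1 - \<rho>)"
  let ?\<pi> = "bernoulli \<alpha> N"
  let ?P = "Pow {..<N}"
  let ?W = "\<lambda>a R n. thinned (\<lambda>j. (khat (a * s j))\<^sup>2) R n"
  have alpha: "0 < \<alpha>" "\<alpha> < 1" and rho: "\<rho> < 1"
    using em[of 0] by (auto simp: expanding_multipliers_def)
  have \<pi>0: "0 \<le> ?\<pi> R" for R using alpha by (intro bernoulli_nonneg) auto
  define good where "good a H e \<longleftrightarrow>
    (\<forall>n\<le>N. (\<Prod>j<n. p a j) = (\<Sum>R\<in>?P. of_real (?\<pi> R) * (of_real (?W a R n) * H R)) + e n) \<and>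
    (\<Sum>R\<in>?P. ?\<pi> R * (norm (H R))\<^sup>2) \<le> C1 \<and> (\<Sum>n\<le>N. (norm (e n))\<^sup>2) \<le> C2" for a H e
  have "\<forall>a. \<exists>H e. good a H e"
    using expanding_multipliers.product_decomposition[OF em, of N]
    unfolding good_def C1_def C2_def expanding_multipliers.\<sigma>_def[OF em] expanding_multipliers.\<delta>_def[OF em] by (rule allI)
  from choice[OF this] obtain H where "\<forall>a. \<exists>e. good a (H a) e" by blast
  from choice[OF this] obtain e where He: "\<And>a. good a (H a) (e a)" by blast
  have dec: "\<And>a n. n \<le> N \<Longrightarrow> (\<Prod>j<n. p a j) = (\<Sum>R\<in>?P. of_real (?\<pi> R) * (of_real (?W a R n) * H a R)) + e a n"
    and H: "\<And>a. (\<Sum>R\<in>?P. ?\<pi> R * (norm (H a R))\<^sup>2) \<le> C1"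
    and e: "\<And>a. (\<Sum>n\<le>N. (norm (e a n))\<^sup>2) \<le> C2"
    using He unfolding good_def by blast+
  define E where "E = (\<Sum>a\<in>period. (norm (c a))\<^sup>2)"
  have E0: "0 \<le> E" unfolding E_def by (intro sum_nonneg) auto
  define F where "F R n x = synth (\<lambda>a. of_real (?W a R n) * (H a R * c a)) x" for R n x
  define G where "G n x = synth (\<lambda>a. e a n * c a) x" for n x
  have split: "synth (\<lambda>a. (\<Prod>j<n. p a j) * c a) x = (\<Sum>R\<in>?P. of_real (?\<pi> R) * F R n x) + G n x"
    if "n \<le> N" for n x
  proof -
    have "(\<Sum>R\<in>?P. of_real (?\<pi> R) * F R n x)
      = (\<Sum>a\<in>period. (\<Sum>R\<in>?P. of_real (?\<pi> R) * (of_real (?W a R n) * H a R)) * c a * chi (a * x))"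
      unfolding F_def synth_def sum_distrib_left sum_distrib_right
      by (subst sum.swap) (simp add: mult_ac)
    then show ?thesis
      unfolding G_def synth_def dec[OF that] by (simp add: sum.distrib[symmetric] distrib_right)
  qed
  have sq: "(pvar r N (\<lambda>n. synth (\<lambda>a. (\<Prod>j<n. p a j) * c a) x))\<^sup>2
     \<le> 2 * (\<Sum>R\<in>?P. ?\<pi> R * (pvar r N (\<lambda>n. F R n x))\<^sup>2) + 8 * (\<Sum>n\<le>N. (norm (G n x))\<^sup>2)" for x
  proof -
    let ?A = "pvar r N (\<lambda>n. \<Sum>R\<in>?P. of_real (?\<pi> R) * F R n x)" and ?B = "pvar r N (\<lambda>n. G n x)"
    have "pvar r N (\<lambda>n. synth (\<lambda>a. (\<Prod>j<n. p a j) * c a) x)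
      = pvar r N (\<lambda>n. (\<Sum>R\<in>?P. of_real (?\<pi> R) * F R n x) + G n x)"
      using split by (intro pvar_cong)
    also have "\<dots> \<le> ?A + ?B" using r by (intro pvar_add) auto
    finally have "(pvar r N (\<lambda>n. synth (\<lambda>a. (\<Prod>j<n. p a j) * c a) x))\<^sup>2 \<le> (?A + ?B)\<^sup>2"
      using r by (intro power_mono pvar_nonneg) auto
    also have "\<dots> \<le> 2 * ?A\<^sup>2 + 2 * ?B\<^sup>2"
      using sum_squares_bound[of ?A ?B] by (simp add: power2_sum)
    also have "?A\<^sup>2 \<le> (\<Sum>R\<in>?P. ?\<pi> R * (pvar r N (\<lambda>n. F R n x))\<^sup>2)"
      using r \<pi>0 by (intro pvar_weighted_sum_sq) (auto simp: bernoulli_sum)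
    also have "?B\<^sup>2 \<le> (2 * sqrt (\<Sum>n\<le>N. (norm (G n x))\<^sup>2))\<^sup>2"
      using r by (intro power_mono pvar_le_square pvar_nonneg) auto
    also have "\<dots> = 4 * (\<Sum>n\<le>N. (norm (G n x))\<^sup>2)"
      by (simp add: power_mult_distrib sum_nonneg)
    finally show ?thesis by simp
  qed
  let ?h = "\<lambda>R. \<Sum>a\<in>period. (norm (H a R))\<^sup>2 * (norm (c a))\<^sup>2"
  have FR: "(\<Sum>x\<in>period. (pvar r N (\<lambda>n. F R n x))\<^sup>2) \<le> 5120 * (r / (r-2)) * (real Q * ?h R)" for R
    using rota_variation[OF r, of N s R "\<lambda>a. H a R * c a"] unfolding F_def parseval
    by (simp add: norm_mult power_mult_distrib)
  have GR: "(\<Sum>x\<in>period. \<Sum>n\<le>N. (norm (G n x))\<^sup>2) \<le> real Q * (C2 * E)"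
  proof -
    have "(\<Sum>x\<in>period. \<Sum>n\<le>N. (norm (G n x))\<^sup>2) = (\<Sum>n\<le>N. real Q * (\<Sum>a\<in>period. (norm (e a n))\<^sup>2 * (norm (c a))\<^sup>2))"
      unfolding G_def by (subst sum.swap) (simp add: parseval norm_mult power_mult_distrib)
    also have "\<dots> = real Q * (\<Sum>a\<in>period. (\<Sum>n\<le>N. (norm (e a n))\<^sup>2) * (norm (c a))\<^sup>2)"
      unfolding sum_distrib_left[symmetric] sum_distrib_right by (subst sum.swap) simp
    also have "\<dots> \<le> real Q * (\<Sum>a\<in>period. C2 * (norm (c a))\<^sup>2)"
      using e by (intro mult_left_mono sum_mono mult_right_mono) auto
    finally show ?thesis by (simp add: E_def sum_distrib_left)
  qed
  have HR: "(\<Sum>R\<in>?P. ?\<pi> R * ?h R) \<le> C1 * E"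
  proof -
    have "(\<Sum>R\<in>?P. ?\<pi> R * ?h R)
      = (\<Sum>a\<in>period. (\<Sum>R\<in>?P. ?\<pi> R * (norm (H a R))\<^sup>2) * (norm (c a))\<^sup>2)"
      unfolding sum_distrib_left sum_distrib_right by (subst sum.swap) (simp add: mult_ac)
    also have "\<dots> \<le> (\<Sum>a\<in>period. C1 * (norm (c a))\<^sup>2)"
      using H by (intro sum_mono mult_right_mono) auto
    finally show ?thesis by (simp add: E_def sum_distrib_left)
  qed
  define k where "k = r / (r-2)"
  have k: "1 \<le> k" using r by (simp add: k_def field_simps)
  have "(\<Sum>x\<in>period. (pvar r N (\<lambda>n. synth (\<lambda>a. (\<Prod>j<n. p a j) * c a) x))\<^sup>2)
    \<le> (\<Sum>x\<in>period. 2 * (\<Sum>R\<in>?P. ?\<pi> R * (pvar r N (\<lambda>n. F R n x))\<^sup>2) + 8 * (\<Sum>n\<le>N. (norm (G n x))\<^sup>2))"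
    using sq by (intro sum_mono)
  also have "\<dots> = 2 * (\<Sum>R\<in>?P. ?\<pi> R * (\<Sum>x\<in>period. (pvar r N (\<lambda>n. F R n x))\<^sup>2))
      + 8 * (\<Sum>x\<in>period. \<Sum>n\<le>N. (norm (G n x))\<^sup>2)"
    unfolding sum.distrib sum_distrib_left[symmetric] by (subst sum.swap) (simp add: sum_distrib_left)
  also have "\<dots> \<le> 2 * (\<Sum>R\<in>?P. ?\<pi> R * (5120 * k * (real Q * ?h R)))
      + 8 * (real Q * (C2 * E))"
    using FR GR \<pi>0 unfolding k_def by (intro add_mono mult_left_mono sum_mono) auto
  also have "(\<Sum>R\<in>?P. ?\<pi> R * (5120 * k * (real Q * ?h R)))
     = 5120 * k * (real Q * (\<Sum>R\<in>?P. ?\<pi> R * ?h R))"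
    by (simp only: sum_distrib_left mult_ac)
  also have "\<dots> \<le> 5120 * k * (real Q * (C1 * E))"
    using HR k by (intro mult_left_mono) auto
  also have "2 * (5120 * k * (real Q * (C1 * E))) + 8 * (real Q * (C2 * E))
     \<le> 2 * (5120 * k * (real Q * (C1 * E))) + 8 * (k * (real Q * (C2 * E)))"
  proof -
    have "0 \<le> C2" using rho by (simp add: C2_def)
    then have "1 * (real Q * (C2 * E)) \<le> k * (real Q * (C2 * E))"
      using k E0 by (intro mult_right_mono) auto
    then show ?thesis by simp
  qed
  also have "\<dots> = C * k * (real Q * E)"
    unfolding C C1_def[symmetric] by (simp add: C2_def algebra_simps)
  finally show ?thesis unfolding k_def parseval E_def[symmetric] by simp
qed

section \<open>Exponential sums over restricted digits\<close>

lemma norm_1_minus_power_le: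
  fixes z :: complex assumes "norm z = 1"
  shows "norm (1 - z ^ n) \<le> real n * norm (1 - z)"
proof (induction n)
  case (Suc n)
  have "1 - z ^ Suc n = (1 - z ^ n) + z ^ n * (1 - z)" by (simp add: algebra_simps)
  then have "norm (1 - z ^ Suc n) \<le> norm (1 - z ^ n) + norm (z ^ n * (1 - z))"
    by (metis norm_triangle_ineq)
  also have "\<dots> = norm (1 - z ^ n) + norm (1 - z)" using assms by (simp add: norm_mult norm_power)
  finally show ?case using Suc.IH by (simp add: algebra_simps)
qed simp

lemma norm_1_minus_power_ge:
  fixes z :: complex
  assumes z: "norm z = 1" and d: "3 \<le> d" and small: "norm (1 - z) < 1 / (real d)\<^sup>2"
  shows "2 * norm (1 - z) \<le> norm (1 - z ^ d)"
proof -
  have "real d - norm (\<Sum>i<d. z ^ i) \<le> norm (of_nat d - (\<Sum>i<d. z ^ i))"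
    using norm_triangle_ineq2[of "of_nat d" "\<Sum>i<d. z ^ i"] by simp
  also have "of_nat d - (\<Sum>i<d. z ^ i) = (\<Sum>i<d. 1 - z ^ i)" by (simp add: sum_subtractf)
  also have "norm \<dots> \<le> (\<Sum>i<d. real d * norm (1 - z))"
  proof (intro sum_norm_le)
    fix i assume "i \<in> {..<d}"
    then have "real i * norm (1 - z) \<le> real d * norm (1 - z)" by (intro mult_right_mono) auto
    then show "norm (1 - z ^ i) \<le> real d * norm (1 - z)" using norm_1_minus_power_le[OF z, of i] by linarith
  qed
  also have "\<dots> = (real d)\<^sup>2 * norm (1 - z)" by (simp add: power2_eq_square)
  also have "\<dots> \<le> 1" using small d by (simp add: field_simps)
  finally have "2 \<le> norm (\<Sum>i<d. z ^ i)" using d by linarith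
  then have "norm (1 - z) * 2 \<le> norm (1 - z) * norm (\<Sum>i<d. z ^ i)" by (intro mult_left_mono) auto
  also have "\<dots> = norm (1 - z ^ d)" by (simp add: one_diff_power_eq norm_mult)
  finally show ?thesis by simp
qed

lemma norm_1_plus_le:
  fixes z :: complex assumes "norm z = 1"
  shows "norm (1 + z) \<le> 2 - (norm (1 - z))\<^sup>2 / 4"
proof -
  let ?t = "norm (1 - z)"
  have "?t \<le> 1 + norm z" by (metis norm_one norm_triangle_ineq4)
  then have "?t\<^sup>2 \<le> 2\<^sup>2" using assms by (intro power_mono) auto
  also have "(2::real)\<^sup>2 = 4" by simp
  finally have t: "?t\<^sup>2 \<le> 4" .
  have "(Re z)\<^sup>2 + (Im z)\<^sup>2 = 1" using assms by (metis cmod_power2 power_one)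
  then have "(norm (1 + z))\<^sup>2 = 4 - ?t\<^sup>2"
    unfolding cmod_power2 by (simp add: power2_eq_square algebra_simps)
  also have "\<dots> \<le> (2 - ?t\<^sup>2 / 4)\<^sup>2"
    using zero_le_power2[of "?t\<^sup>2"] by (simp add: power2_diff power_divide)
  finally show ?thesis
  proof (rule power2_le_imp_le)
    show "0 \<le> 2 - ?t\<^sup>2 / 4" using t by linarith
  qed
qed

text \<open>
  By Bezout, if all \<open>z^\<delta>\<close> are close to \<open>1\<close> then so is \<open>z^g\<close>
  for the greatest common divisor \<open>g\<close> of \<open>D\<close>, which is the \<open>g\<close>
  constructed here. Only the divisibility \<open>g dvd \<delta>\<close> is needed besides; it gives the
  converse.
\<close>
lemma common_divisor_control:
  fixes D :: "nat set"
  assumes "finite D"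
  shows "\<exists>g C. 0 \<le> C \<and> (\<forall>\<delta>\<in>D. g dvd \<delta>) \<and>
    (\<forall>z::complex. norm z = 1 \<longrightarrow> norm (1 - z ^ g) \<le> C * (\<Sum>\<delta>\<in>D. norm (1 - z ^ \<delta>)))"
  using assms
proof (induction D rule: finite_induct)
  case empty
  show ?case by (intro exI[of _ 0] exI[of _ "0::real"]) auto
next
  case (insert \<delta> D)
  then obtain g C where g: "0 \<le> C" "\<forall>\<delta>\<in>D. g dvd \<delta>"
    "\<And>z::complex. norm z = 1 \<Longrightarrow> norm (1 - z ^ g) \<le> C * (\<Sum>\<delta>\<in>D. norm (1 - z ^ \<delta>))" by blast
  show ?case
  proof (cases "g = 0")
    case True
    have "norm (1 - z ^ \<delta>) \<le> 1 * (\<Sum>\<delta>\<in>insert \<delta> D. norm (1 - z ^ \<delta>))" for z :: complex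
      using insert(1,2) by (simp add: sum_nonneg)
    moreover have "\<delta> dvd \<delta>'" if "\<delta>' \<in> insert \<delta> D" for \<delta>' using that g(2) True by auto
    ultimately show ?thesis by (intro exI[of _ \<delta>] exI[of _ "1::real"]) auto
  next
    case False
    then obtain x y where xy: "g * x = \<delta> * y + gcd g \<delta>" using bezout_nat by blast
    define C' where "C' = real x * C + real y"
    have C': "0 \<le> C'" using g(1) by (simp add: C'_def)
    have "norm (1 - z ^ gcd g \<delta>) \<le> C' * (\<Sum>\<delta>\<in>insert \<delta> D. norm (1 - z ^ \<delta>))" if z: "norm z = 1" for z :: complex
    proof -
      let ?S = "\<Sum>\<delta>\<in>D. norm (1 - z ^ \<delta>)"
      have S: "0 \<le> ?S" by (simp add: sum_nonneg)
      have "(z ^ \<delta>) ^ y * z ^ gcd g \<delta> = (z ^ g) ^ x"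
        unfolding power_mult[symmetric] power_add[symmetric] xy ..
      then have "(z ^ \<delta>) ^ y * (1 - z ^ gcd g \<delta>) = (1 - (z ^ g) ^ x) - (1 - (z ^ \<delta>) ^ y)"
        by (simp add: algebra_simps)
      moreover have "norm ((z ^ \<delta>) ^ y * (1 - z ^ gcd g \<delta>)) = norm (1 - z ^ gcd g \<delta>)"
        using z by (simp add: norm_mult norm_power)
      ultimately have "norm (1 - z ^ gcd g \<delta>) \<le> norm (1 - (z ^ g) ^ x) + norm (1 - (z ^ \<delta>) ^ y)"
        by (metis norm_triangle_ineq4)
      also have "\<dots> \<le> real x * norm (1 - z ^ g) + real y * norm (1 - z ^ \<delta>)"
        using z by (intro add_mono norm_1_minus_power_le) (auto simp: norm_power)
      also have "\<dots> \<le> real x * (C * ?S) + real y * norm (1 - z ^ \<delta>)"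
        using g(3)[OF z] by (intro add_right_mono mult_left_mono) auto
      also have "\<dots> \<le> C' * ?S + C' * norm (1 - z ^ \<delta>)"
        using S g(1) by (intro add_mono) (auto simp: C'_def algebra_simps)
      finally show ?thesis using insert(1,2) by (simp add: algebra_simps)
    qed
    moreover have "gcd g \<delta> dvd \<delta>'" if "\<delta>' \<in> insert \<delta> D" for \<delta>'
      using that g(2) by (auto intro: dvd_trans[OF gcd_dvd1])
    ultimately show ?thesis using C' by blast
  qed
qed

locale digit_system =
  fixes d :: nat and D :: "nat set"
  assumes d_ge_3: "3 \<le> d" and D_digits: "D \<subseteq> {0..<d}" and card_D: "2 \<le> card D" and zero_in_D: "0 \<in> D"
begin

abbreviation "q \<equiv> card D"
abbreviation "\<Phi> \<equiv> digit_map d D"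
abbreviation "avg \<equiv> digit_avg d D"

lemma finite_D: "finite D" using card_D by (metis card.infinite not_numeral_le_zero)

lemma digit_enum_bij: "bij_betw (digit_enum D) {..<q} D"
proof -
  have "bij_betw ((!) (sorted_list_of_set D)) {..<length (sorted_list_of_set D)} (set (sorted_list_of_set D))"
    by (intro bij_betw_nth) auto
  then show ?thesis using finite_D by (simp add: digit_enum_def[abs_def])
qed

lemma digit_enum_in: "b < q \<Longrightarrow> digit_enum D b \<in> D"
  using digit_enum_bij by (auto simp: bij_betw_def)

lemma digit_map_0: "\<Phi> 0 = 0"
  using digit_map_expansion[OF finite_D card_D zero_in_D, of 0 "\<lambda>_. 0" 0 d]
    digit_map_expansion[OF finite_D card_D zero_in_D, of 1 "\<lambda>_. 0" 0 d] d_ge_3 card_D by simp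

lemma digit_enum_0: "digit_enum D 0 = 0"
  using digit_map_0 by (simp add: digit_map_def)

lemma digit_map_rec: "\<Phi> m = digit_enum D (m mod q) + d * \<Phi> (m div q)"
proof (cases "m = 0")
  case True
  then show ?thesis by (simp add: digit_map_0 digit_enum_0)
next
  case False
  define h where "h j = digit_enum D ((m div q) div q ^ j mod q) * d ^ j" for j
  have "\<Phi> m = digit_enum D (m mod q) + (\<Sum>j<m. digit_enum D (m div q ^ Suc j mod q) * d ^ Suc j)"
    unfolding digit_map_def lessThan_Suc_atMost[symmetric] sum.lessThan_Suc_shift by simp
  also have "(\<Sum>j<m. digit_enum D (m div q ^ Suc j mod q) * d ^ Suc j) = d * (\<Sum>j<m. h j)"
    unfolding sum_distrib_left h_def by (intro sum.cong refl) (simp add: div_mult2_eq)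
  also have "(\<Sum>j<m. h j) = (\<Sum>j\<le>m div q. h j)"
  proof (rule sum.mono_neutral_right)
    have "m div q < m" using False card_D by (intro div_less_dividend) auto
    then show "{..m div q} \<subseteq> {..<m}" by auto
    show "\<forall>j\<in>{..<m} - {..m div q}. h j = 0"
    proof
      fix j assume "j \<in> {..<m} - {..m div q}"
      then have "m div q < j" by simp
      also have "j < q ^ j" using card_D less_exp[of j] power_mono[of 2 q j] by linarith
      finally show "h j = 0" by (simp add: h_def digit_enum_0)
    qed
  qed simp
  also have "(\<Sum>j\<le>m div q. h j) = \<Phi> (m div q)" by (simp add: digit_map_def h_def)
  finally show ?thesis .
qed

lemma digit_map_digit: "a < q \<Longrightarrow> \<Phi> a = digit_enum D a"
  using digit_map_rec[of a] by (simp add: digit_map_0)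

lemma digit_map_split: "b < q ^ n \<Longrightarrow> \<Phi> (a * q ^ n + b) = \<Phi> b + d ^ n * \<Phi> a"
proof (induction n arbitrary: b)
  case 0
  then show ?case by (simp add: digit_map_0)
next
  case (Suc n)
  have q0: "0 < q" using card_D by simp
  have eq: "a * q ^ Suc n + b = b + q * (a * q ^ n)" by simp
  have "(a * q ^ Suc n + b) mod q = b mod q" unfolding eq by (rule mod_mult_self2)
  moreover have "(a * q ^ Suc n + b) div q = a * q ^ n + b div q"
    unfolding eq using q0 by (subst div_mult_self2) auto
  moreover have "b div q < q ^ n" using Suc.prems q0 by (intro less_mult_imp_div_less) (simp add: mult.commute)
  ultimately show ?case
    using digit_map_rec[of "a * q ^ Suc n + b"] digit_map_rec[of b] Suc.IH[of "b div q"]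
    by (simp add: algebra_simps)
qed

lemma digit_map_dvd: "(\<forall>\<delta>\<in>D. g dvd \<delta>) \<Longrightarrow> g dvd \<Phi> m"
  unfolding digit_map_def using card_D
  by (intro dvd_sum dvd_mult2) (auto intro!: digit_enum_in)

lemma exp_sum_split:
  fixes z :: complex
  shows "(\<Sum>m<u * q ^ n. z ^ \<Phi> m) = (\<Sum>b<q ^ n. z ^ \<Phi> b) * (\<Sum>a<u. (z ^ d ^ n) ^ \<Phi> a)"
proof -
  have "(\<Sum>m<u * q ^ n. z ^ \<Phi> m) = (\<Sum>a<u. \<Sum>m\<in>{a * q ^ n..<a * q ^ n + q ^ n}. z ^ \<Phi> m)"
    by (rule sum.nat_group[symmetric])
  also have "\<dots> = (\<Sum>a<u. \<Sum>b<q ^ n. z ^ \<Phi> b * (z ^ d ^ n) ^ \<Phi> a)"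
  proof (rule sum.cong[OF refl])
    fix a
    have "(\<Sum>m\<in>{a * q ^ n..<a * q ^ n + q ^ n}. z ^ \<Phi> m) = (\<Sum>b<q ^ n. z ^ \<Phi> (a * q ^ n + b))"
      using sum.shift_bounds_nat_ivl[of "\<lambda>m. z ^ \<Phi> m" 0 "a * q ^ n" "q ^ n"]
      by (simp add: lessThan_atLeast0 add.commute)
    also have "\<dots> = (\<Sum>b<q ^ n. z ^ \<Phi> b * (z ^ d ^ n) ^ \<Phi> a)"
      by (intro sum.cong refl) (simp add: digit_map_split power_add power_mult)
    finally show "(\<Sum>m\<in>{a * q ^ n..<a * q ^ n + q ^ n}. z ^ \<Phi> m) = (\<Sum>b<q ^ n. z ^ \<Phi> b * (z ^ d ^ n) ^ \<Phi> a)" .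
  qed
  also have "\<dots> = (\<Sum>b<q ^ n. z ^ \<Phi> b) * (\<Sum>a<u. (z ^ d ^ n) ^ \<Phi> a)"
    by (subst sum.swap) (simp add: sum_product)
  finally show ?thesis .
qed

text \<open>
  The Fourier transform of the uniform measure on \<open>D\<close>, as a function on the unit circle.
\<close>
definition symbol :: "complex \<Rightarrow> complex" where
  "symbol z = (\<Sum>\<delta>\<in>D. z ^ \<delta>) / of_nat q"

lemma exp_sum_product:
  fixes z :: complex
  shows "(\<Sum>b<q ^ n. z ^ \<Phi> b) / of_nat (q ^ n) = (\<Prod>j<n. symbol (z ^ d ^ j))"
proof (induction n)
  case 0
  show ?case by (simp add: digit_map_0)
next
  case (Suc n)
  have "(\<Sum>a<q. (z ^ d ^ n) ^ \<Phi> a) = (\<Sum>a<q. (z ^ d ^ n) ^ digit_enum D a)"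
    by (intro sum.cong refl) (simp add: digit_map_digit)
  also have "\<dots> = (\<Sum>\<delta>\<in>D. (z ^ d ^ n) ^ \<delta>)"
    by (rule sum.reindex_bij_betw[OF digit_enum_bij])
  finally have A: "(\<Sum>a<q. (z ^ d ^ n) ^ \<Phi> a) / of_nat q = symbol (z ^ d ^ n)" by (simp add: symbol_def)
  have B: "(\<Sum>b<q ^ Suc n. z ^ \<Phi> b) / of_nat (q ^ Suc n)
      = (\<Sum>b<q ^ n. z ^ \<Phi> b) / of_nat (q ^ n) * ((\<Sum>a<q. (z ^ d ^ n) ^ \<Phi> a) / of_nat q)"
    using exp_sum_split[where u = q and n = n and z = z] by simp
  show ?case unfolding B A Suc.IH by simp
qed

lemma norm_symbol_le_1: "norm z = 1 \<Longrightarrow> norm (symbol z) \<le> 1"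
proof -
  assume z: "norm z = 1"
  have "norm (\<Sum>\<delta>\<in>D. z ^ \<delta>) \<le> (\<Sum>\<delta>\<in>D. 1)" using z by (intro sum_norm_le) (simp add: norm_power)
  then show ?thesis using card_D by (simp add: symbol_def norm_divide divide_le_eq)
qed

lemma symbol_near_1:
  assumes z: "norm z = 1" and g: "\<forall>\<delta>\<in>D. g dvd \<delta>" "0 < g"
  shows "norm (1 - symbol z) \<le> real d * norm (1 - z ^ g)"
proof -
  have q0: "of_nat q \<noteq> (0::complex)" using card_D by simp
  have "1 - symbol z = (\<Sum>\<delta>\<in>D. 1 - z ^ \<delta>) / of_nat q"
    using q0 by (simp add: symbol_def sum_subtractf diff_divide_distrib)
  then have "norm (1 - symbol z) = norm (\<Sum>\<delta>\<in>D. 1 - z ^ \<delta>) / real q" by (simp add: norm_divide)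
  also have "norm (\<Sum>\<delta>\<in>D. 1 - z ^ \<delta>) \<le> (\<Sum>\<delta>\<in>D. real d * norm (1 - z ^ g))"
  proof (intro sum_norm_le)
    fix \<delta> assume "\<delta> \<in> D"
    then obtain k where k: "\<delta> = g * k" and "\<delta> < d" using g D_digits by fastforce
    have "1 * k \<le> g * k" using g(2) by (intro mult_le_mono1) simp
    then have "k \<le> d" using k \<open>\<delta> < d\<close> by linarith
    have "norm (1 - z ^ \<delta>) \<le> real k * norm (1 - z ^ g)"
      unfolding k power_mult using z by (intro norm_1_minus_power_le) (simp add: norm_power)
    also have "\<dots> \<le> real d * norm (1 - z ^ g)" using \<open>k \<le> d\<close> by (intro mult_right_mono) auto
    finally show "norm (1 - z ^ \<delta>) \<le> real d * norm (1 - z ^ g)" .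
  qed
  also have "(\<Sum>\<delta>\<in>D. real d * norm (1 - z ^ g)) / real q = real d * norm (1 - z ^ g)"
    using card_D by simp
  finally show ?thesis using card_D by (simp add: divide_right_mono)
qed

text \<open>
  If \<open>z^g\<close> is not close to \<open>1\<close>, then some \<open>z^\<delta>\<close> is not close
  to \<open>1 = z^0\<close>, and these two terms of the symbol do not align.
\<close>
lemma symbol_decay:
  assumes z: "norm z = 1" and C: "0 < C" "norm (1 - z ^ g) \<le> C * (\<Sum>\<delta>\<in>D. norm (1 - z ^ \<delta>))"
    and \<eta>: "0 < \<eta>" "\<eta> \<le> norm (1 - z ^ g)"
  shows "norm (symbol z) \<le> 1 - (\<eta> / (C * real q))\<^sup>2 / (4 * real q)"
proof -
  define \<tau> where "\<tau> = \<eta> / (C * real q)"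
  have q0: "0 < real q" using card_D by simp
  have \<tau>: "0 < \<tau>" using C \<eta> q0 by (simp add: \<tau>_def)
  have "\<exists>\<delta>\<in>D. \<tau> \<le> norm (1 - z ^ \<delta>)"
  proof (rule ccontr)
    assume "\<not> ?thesis"
    then have "(\<Sum>\<delta>\<in>D. norm (1 - z ^ \<delta>)) < (\<Sum>\<delta>\<in>D. \<tau>)"
      using finite_D zero_in_D by (intro sum_strict_mono) auto
    also have "\<dots> = real q * \<tau>" by simp
    finally have "C * (\<Sum>\<delta>\<in>D. norm (1 - z ^ \<delta>)) < C * (real q * \<tau>)" using C by simp
    also have "\<dots> = \<eta>" using C q0 by (simp add: \<tau>_def)
    finally show False using C \<eta> by linarith
  qed
  then obtain \<delta> where \<delta>: "\<delta> \<in> D" "\<tau> \<le> norm (1 - z ^ \<delta>)" by blast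
  have "\<delta> \<noteq> 0" using \<delta> \<tau> by (intro notI) simp
  have sub: "{0, \<delta>} \<subseteq> D" using \<delta> zero_in_D by simp
  have "(\<Sum>\<delta>\<in>D. z ^ \<delta>) = (\<Sum>\<delta>\<in>D - {0, \<delta>}. z ^ \<delta>) + (\<Sum>\<delta>\<in>{0, \<delta>}. z ^ \<delta>)"
    by (rule sum.subset_diff[OF sub finite_D])
  also have "(\<Sum>\<delta>\<in>{0, \<delta>}. z ^ \<delta>) = 1 + z ^ \<delta>" using \<open>\<delta> \<noteq> 0\<close> by simp
  finally have "norm (\<Sum>\<delta>\<in>D. z ^ \<delta>) \<le> norm (\<Sum>\<delta>\<in>D - {0, \<delta>}. z ^ \<delta>) + norm (1 + z ^ \<delta>)"
    by (metis norm_triangle_ineq)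
  also have "norm (\<Sum>\<delta>\<in>D - {0, \<delta>}. z ^ \<delta>) \<le> (\<Sum>\<delta>\<in>D - {0, \<delta>}. 1)"
    using z by (intro sum_norm_le) (simp add: norm_power)
  also have "\<dots> = real q - 2"
    using sub finite_D \<open>\<delta> \<noteq> 0\<close> card_D by (simp add: card_Diff_subset of_nat_diff)
  also have "norm (1 + z ^ \<delta>) \<le> 2 - (norm (1 - z ^ \<delta>))\<^sup>2 / 4"
    using z by (intro norm_1_plus_le) (simp add: norm_power)
  also have "\<dots> \<le> 2 - \<tau>\<^sup>2 / 4"
    using \<delta>(2) \<tau> power_mono[of \<tau> "norm (1 - z ^ \<delta>)" 2] by simp
  finally have "norm (\<Sum>\<delta>\<in>D. z ^ \<delta>) \<le> real q - \<tau>\<^sup>2 / 4" by simp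
  then have "norm (symbol z) \<le> (real q - \<tau>\<^sup>2 / 4) / real q"
    unfolding symbol_def norm_divide norm_of_nat using q0 by (intro divide_right_mono) auto
  also have "\<dots> = 1 - \<tau>\<^sup>2 / (4 * real q)" using q0 by (simp add: diff_divide_distrib)
  finally show ?thesis by (simp add: \<tau>_def)
qed

end

lemma small_alpha_exists:
  fixes \<rho> L :: real
  assumes "0 \<le> \<rho>" "\<rho> < 1"
  shows "\<exists>\<alpha>. 0 < \<alpha> \<and> \<alpha> < 1 \<and> 2 * \<alpha> * L < 1 \<and> (\<rho> / (1 - 2 * \<alpha> * L))\<^sup>2 < 1 - \<alpha>"
proof -
  have "((\<lambda>\<alpha>. 2 * \<alpha> * L) \<longlongrightarrow> 0) (at_right 0)" by (auto intro!: tendsto_eq_intros)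
  then have 1: "eventually (\<lambda>\<alpha>. 2 * \<alpha> * L < 1) (at_right 0)" by (rule order_tendstoD) simp
  have "((\<lambda>\<alpha>. (\<rho> / (1 - 2 * \<alpha> * L))\<^sup>2 + \<alpha>) \<longlongrightarrow> \<rho>\<^sup>2) (at_right 0)" by (auto intro!: tendsto_eq_intros)
  moreover have "\<rho>\<^sup>2 < 1" using assms by (simp add: power_less_one_iff)
  ultimately have 2: "eventually (\<lambda>\<alpha>. (\<rho> / (1 - 2 * \<alpha> * L))\<^sup>2 + \<alpha> < 1) (at_right 0)" by (rule order_tendstoD)
  have 3: "eventually (\<lambda>\<alpha>::real. \<alpha> \<in> {0<..<1}) (at_right 0)" by (intro eventually_at_right_real) simp
  from eventually_conj[OF 1 eventually_conj[OF 2 3]]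
  have "eventually (\<lambda>\<alpha>. 0 < \<alpha> \<and> \<alpha> < 1 \<and> 2 * \<alpha> * L < 1 \<and> (\<rho> / (1 - 2 * \<alpha> * L))\<^sup>2 < 1 - \<alpha>) (at_right 0)"
    by (rule eventually_mono) auto
  then show ?thesis by (rule eventually_happens'[OF trivial_limit_at_right_real])
qed

section \<open>The estimates on a cyclic group\<close>

context digit_system
begin

text \<open>
  The cyclic groups used have order \<open>resolution * B\<close>. Then \<open>khat b\<close> vanishes as
  soon as \<open>chi b\<close> is at distance at least \<open>2 \<pi> / resolution\<close> from
  \<open>1\<close>. This is less than \<open>\<eta> = 1 / d\<^sup>2\<close>, and below the threshold
  \<open>\<eta>\<close> raising to the power \<open>d\<close> at least doubles the distance to
  \<open>1\<close>.
\<close>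
abbreviation "resolution \<equiv> 7 * d\<^sup>2"

text \<open>
  At every frequency \<open>a\<close> the averaging multipliers and the squared Fejer multipliers in the
  variable \<open>g d^j a\<close> satisfy the hypotheses of \<open>expanding_multipliers\<close>. The
  constant \<open>K\<close> is twice the resolution, which bounds the deviation of the squared Fejer
  multiplier from \<open>1\<close>, and exceeds \<open>d\<close>, which does the same for the symbol.
\<close>
lemma symbol_multipliers:
  assumes B: "0 < B"
    and g: "\<forall>\<delta>\<in>D. g dvd \<delta>" "0 < g"
    and C: "0 < C" "\<And>z::complex. norm z = 1 \<Longrightarrow> norm (1 - z ^ g) \<le> C * (\<Sum>\<delta>\<in>D. norm (1 - z ^ \<delta>))"
    and \<eta>: "\<eta> = 1 / (real d)\<^sup>2" and \<rho>: "\<rho> = max 0 (1 - (\<eta> / (C * real q))\<^sup>2 / (4 * real q))"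
    and K: "K = 14 * (real d)\<^sup>2"
    and \<alpha>: "0 < \<alpha>" "\<alpha> < 1" "2 * \<alpha> * (K * \<eta>) < 1" "(\<rho> / (1 - 2 * \<alpha> * (K * \<eta>)))\<^sup>2 < 1 - \<alpha>"
  shows "fejer_kernel (resolution * B) B"
    and "expanding_multipliers (\<lambda>j. norm (1 - cyclic_fourier.chi (resolution * B) (a * int (g * d ^ j))))
      (\<lambda>j. symbol (cyclic_fourier.chi (resolution * B) (- a) ^ d ^ j))
      (\<lambda>j. (fejer_kernel.khat (resolution * B) B (a * int (g * d ^ j)))\<^sup>2) \<eta> \<rho> \<alpha> K"
proof -
  have "3 * 3 \<le> d * d" by (intro mult_le_mono d_ge_3)
  then have res: "2 \<le> resolution" unfolding power2_eq_square by linarith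
  show F: "fejer_kernel (resolution * B) B"
  proof
    show "0 < resolution * B" using B res by (intro mult_pos_pos) linarith+
    show "2 * B \<le> resolution * B" using res by (rule mult_le_mono1)
  qed (rule B)
  interpret fejer_kernel "resolution * B" B by (rule F)
  let ?a = "\<lambda>j. a * int (g * d ^ j)"
  have d0: "0 < real d" using d_ge_3 by simp
  have q0: "0 < real q" using card_D by simp
  have ratio: "real (resolution * B) / real B = 7 * (real d)\<^sup>2" using B by simp
  have norm_z: "norm (chi (- a) ^ d ^ j) = 1" for j by (simp add: norm_power)
  have zg: "norm (1 - (chi (- a) ^ d ^ j) ^ g) = norm (1 - chi (?a j))" for j
  proof -
    have "(chi (- a) ^ d ^ j) ^ g = chi (- (?a j))"
      unfolding power_mult[symmetric] chi_power by (rule arg_cong[where f = chi]) (simp add: mult_ac)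
    also have "\<dots> = cnj (chi (?a j))" by (rule chi_minus)
    finally have "1 - (chi (- a) ^ d ^ j) ^ g = cnj (1 - chi (?a j))" by simp
    then show ?thesis by (simp only: complex_mod_cnj)
  qed
  have big: "2 * pi * real B / real (resolution * B) \<le> \<eta>"
    using B pi_approx d0 unfolding \<eta> by (simp add: field_simps)
  show "expanding_multipliers (\<lambda>j. norm (1 - chi (?a j))) (\<lambda>j. symbol (chi (- a) ^ d ^ j))
      (\<lambda>j. (khat (?a j))\<^sup>2) \<eta> \<rho> \<alpha> K"
  proof
    fix j
    let ?x = "norm (1 - chi (?a j))"
    show "0 \<le> ?x" by simp
    show "?x \<le> 2" using norm_triangle_ineq4[of 1 "chi (?a j)"] by simp
    show "norm (symbol (chi (- a) ^ d ^ j)) \<le> 1" by (rule norm_symbol_le_1[OF norm_z])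
    show "0 \<le> (khat (?a j))\<^sup>2" by simp
    show "(khat (?a j))\<^sup>2 \<le> 1" using khat_le_1 khat_nonneg by (intro power_le_one)
    show "norm (1 - symbol (chi (- a) ^ d ^ j)) \<le> K * ?x"
    proof -
      have "norm (1 - symbol (chi (- a) ^ d ^ j)) \<le> real d * ?x"
        using symbol_near_1[OF norm_z g, of j] unfolding zg .
      also have "\<dots> \<le> K * ?x"
      proof (rule mult_right_mono)
        have "real d * 1 \<le> real d * (14 * real d)" using d_ge_3 by (intro mult_left_mono) auto
        then show "real d \<le> K" unfolding K by (simp add: power2_eq_square mult_ac)
      qed simp
      finally show ?thesis .
    qed
    {
      assume small: "?x < \<eta>"
      have "chi (a * int (g * d ^ Suc j)) = chi (?a j) ^ d"
        unfolding chi_power by (rule arg_cong[where f = chi]) (simp add: mult_ac)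
      then show "2 * ?x \<le> norm (1 - chi (a * int (g * d ^ Suc j)))"
        using norm_1_minus_power_ge[OF norm_chi d_ge_3, of "a * int (g * d ^ j)"] small
        unfolding \<eta> by (simp del: power_Suc of_nat_mult of_nat_power)
      let ?k = "khat (?a j)"
      have "1 - ?k\<^sup>2 = (1 + ?k) * (1 - ?k)" by (simp add: power2_eq_square algebra_simps)
      also have "\<dots> \<le> 2 * (7 * (real d)\<^sup>2 * ?x)"
        using khat_le_1 khat_nonneg khat_near_1[of "a * int (g * d ^ j)"] unfolding ratio
        by (intro mult_mono) auto
      finally show "1 - ?k\<^sup>2 \<le> K * ?x" unfolding K by simp
    }
    {
      assume large: "\<eta> \<le> ?x"
      have "norm (symbol (chi (- a) ^ d ^ j)) \<le> 1 - (\<eta> / (C * real q))\<^sup>2 / (4 * real q)"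
        using large d0 by (intro symbol_decay[OF norm_z C(1) C(2)[OF norm_z]]) (auto simp: \<eta> zg simp del: of_nat_mult of_nat_power)
      then show "norm (symbol (chi (- a) ^ d ^ j)) \<le> \<rho>" unfolding \<rho> by simp
      have "khat (?a j) = 0" by (rule khat_eq_0[OF order_trans[OF big large]])
      then show "(khat (?a j))\<^sup>2 = 0" by (simp only: zero_power2)
    }
  next
    show "0 < \<eta>" using d0 by (simp add: \<eta>)
    have "1 \<le> (real d)\<^sup>2" using d_ge_3 by (intro one_le_power) simp
    then show "\<eta> \<le> 1" using d0 unfolding \<eta> by simp
    show "0 \<le> \<rho>" by (simp add: \<rho>)
    have "0 < (\<eta> / (C * real q))\<^sup>2 / (4 * real q)" using d0 q0 C(1) by (simp add: \<eta>)
    then show "\<rho> < 1" unfolding \<rho> by simp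
    show "0 \<le> K" by (simp add: K)
    show "0 < \<alpha>" "\<alpha> < 1" by (rule \<alpha>)+
    show "2 * \<alpha> * K * \<eta> < 1" "(\<rho> / (1 - 2 * \<alpha> * K * \<eta>))\<^sup>2 < 1 - \<alpha>"
      using \<alpha>(3,4) by (simp_all add: mult.assoc)
  qed
qed

lemma digit_avg_synth:
  assumes "cyclic_fourier Q"
  shows "avg M (cyclic_fourier.synth Q c) x =
    cyclic_fourier.synth Q (\<lambda>a. (\<Sum>m<M. cyclic_fourier.chi Q (- a) ^ \<Phi> m) / of_nat M * c a) x"
proof -
  interpret cyclic_fourier Q by (rule assms)
  have "avg M (synth c) x = (\<Sum>m<M. \<Sum>a\<in>period. c a * chi (a * x) * chi (- a) ^ \<Phi> m) / of_nat M"
  proof -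
    have "chi (a * (x - int k)) = chi (a * x) * chi (- a) ^ k" for a k
      unfolding chi_power chi_add[symmetric] by (simp add: algebra_simps)
    then show ?thesis by (simp add: digit_avg_def synth_def mult.assoc)
  qed
  also have "\<dots> = synth (\<lambda>a. (\<Sum>m<M. chi (- a) ^ \<Phi> m) / of_nat M * c a) x"
    unfolding synth_def by (subst sum.swap) (simp add: sum_divide_distrib sum_distrib_left sum_distrib_right mult_ac)
  finally show ?thesis .
qed

lemma block_average_close:
  fixes z :: complex
  assumes z: "norm z = 1" and g: "\<forall>\<delta>\<in>D. g dvd \<delta>" "0 < g" and u: "0 < u" "u \<le> v"
  shows "norm ((\<Sum>a<u. z ^ \<Phi> a) / of_nat u - 1) \<le> real (\<Sum>a<v. \<Phi> a) * norm (1 - z ^ g)"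
proof -
  have "(\<Sum>a<u. z ^ \<Phi> a) / of_nat u - 1 = - ((\<Sum>a<u. 1 - z ^ \<Phi> a) / of_nat u)"
    using u by (simp add: sum_subtractf diff_divide_distrib)
  then have "norm ((\<Sum>a<u. z ^ \<Phi> a) / of_nat u - 1) = norm (\<Sum>a<u. 1 - z ^ \<Phi> a) / real u"
    by (simp add: norm_divide)
  also have "norm (\<Sum>a<u. 1 - z ^ \<Phi> a) \<le> (\<Sum>a<u. real (\<Sum>a<v. \<Phi> a) * norm (1 - z ^ g))"
  proof (intro sum_norm_le)
    fix a assume "a \<in> {..<u}"
    then have le: "\<Phi> a \<le> (\<Sum>a<v. \<Phi> a)" using u by (intro member_le_sum) auto
    obtain k where k: "\<Phi> a = g * k" using digit_map_dvd[OF g(1)] by blast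
    have "1 * k \<le> g * k" using g(2) by (intro mult_le_mono1) simp
    then have kle: "k \<le> (\<Sum>a<v. \<Phi> a)" using le k by linarith
    have "norm (1 - z ^ \<Phi> a) \<le> real k * norm (1 - z ^ g)"
      unfolding k power_mult using z by (intro norm_1_minus_power_le) (simp add: norm_power)
    also have "\<dots> \<le> real (\<Sum>a<v. \<Phi> a) * norm (1 - z ^ g)"
      using kle by (intro mult_right_mono) (auto simp del: of_nat_sum)
    finally show "norm (1 - z ^ \<Phi> a) \<le> real (\<Sum>a<v. \<Phi> a) * norm (1 - z ^ g)" .
  qed
  also have "(\<Sum>a<u. real (\<Sum>a<v. \<Phi> a) * norm (1 - z ^ g)) / real u = real (\<Sum>a<v. \<Phi> a) * norm (1 - z ^ g)"
    using u by simp
  finally show ?thesis using u by (simp add: divide_right_mono)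
qed

text \<open>
  The constant does not depend on \<open>B\<close>, that is, on the order of the group.
\<close>
lemma cyclic_bounds:
  "\<exists>C>0. \<forall>B>0. \<forall>F. (\<forall>x. F (x + int (resolution * B)) = F x) \<longrightarrow> (\<forall>N r. 2 < r \<longrightarrow>
     (\<Sum>x\<in>{0..<int (resolution * B)}. (pvar r N (\<lambda>n. avg (q ^ n) F x))\<^sup>2)
       \<le> C * (r / (r-2)) * (\<Sum>x\<in>{0..<int (resolution * B)}. (norm (F x))\<^sup>2) \<and>
     (\<Sum>x\<in>{0..<int (resolution * B)}. \<Sum>n<N. \<Sum>u\<in>{q ^ s..<q ^ (s+1)}.
        (norm (avg (u * q ^ n) F x - avg (q ^ n) F x))\<^sup>2)
       \<le> C * (\<Sum>x\<in>{0..<int (resolution * B)}. (norm (F x))\<^sup>2))"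
proof -
  obtain g C0 where g0: "0 \<le> C0" "\<forall>\<delta>\<in>D. g dvd \<delta>"
    "\<And>z::complex. norm z = 1 \<Longrightarrow> norm (1 - z ^ g) \<le> C0 * (\<Sum>\<delta>\<in>D. norm (1 - z ^ \<delta>))"
    using common_divisor_control[OF finite_D] by blast
  have "\<not> D \<subseteq> {0}" using card_D card_mono[of "{0::nat}" D] by auto
  then obtain \<delta> where "\<delta> \<in> D" "\<delta> \<noteq> 0" by auto
  then have g_pos: "0 < g" using g0(2) by (metis dvd_0_left gr0I)
  define C1 where "C1 = C0 + 1"
  have C1: "0 < C1" using g0(1) by (simp add: C1_def)
  have C1z: "norm (1 - z ^ g) \<le> C1 * (\<Sum>\<delta>\<in>D. norm (1 - z ^ \<delta>))" if "norm z = 1" for z :: complex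
  proof -
    have "0 \<le> (\<Sum>\<delta>\<in>D. norm (1 - z ^ \<delta>))" by (simp add: sum_nonneg)
    then show ?thesis using g0(3)[OF that] by (simp add: C1_def distrib_right)
  qed
  define \<eta> where "\<eta> = 1 / (real d)\<^sup>2"
  define \<rho> where "\<rho> = max 0 (1 - (\<eta> / (C1 * real q))\<^sup>2 / (4 * real q))"
  define K where "K = 14 * (real d)\<^sup>2"
  have "0 < (\<eta> / (C1 * real q))\<^sup>2 / (4 * real q)" using d_ge_3 card_D C1 by (simp add: \<eta>_def)
  then have \<rho>: "0 \<le> \<rho>" "\<rho> < 1" unfolding \<rho>_def by simp_all
  obtain \<alpha> where \<alpha>: "0 < \<alpha>" "\<alpha> < 1" "2 * \<alpha> * (K * \<eta>) < 1" "(\<rho> / (1 - 2 * \<alpha> * (K * \<eta>)))\<^sup>2 < 1 - \<alpha>"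
    using small_alpha_exists[OF \<rho>, of "K * \<eta>"] by blast
  define Ca where "Ca = 10240 * (1 + (4 / \<alpha> + 1) / (1 - (\<rho> / (1 - 2 * \<alpha> * K * \<eta>))\<^sup>2 / (1 - \<alpha>))) + 256 * K\<^sup>2 / (1 - \<rho>)"
  define v where "v = q ^ (s+1)"
  define W where "W = real (\<Sum>a<v. \<Phi> a)"
  define Cb where "Cb = real v * (W\<^sup>2 * (8 / (1 - \<rho>)))"
  define C where "C = \<bar>Ca\<bar> + \<bar>Cb\<bar> + 1"
  have C: "0 < C" "Ca \<le> C" "Cb \<le> C" by (auto simp: C_def)
  show ?thesis
  proof (intro exI[of _ C] conjI C(1) allI impI)
    fix B :: nat and F :: "int \<Rightarrow> complex" and N :: nat and r :: real
    assume B: "0 < B" and per: "\<forall>x. F (x + int (resolution * B)) = F x" and r: "2 < r"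
    note sm = symbol_multipliers[OF B g0(2) g_pos C1 C1z \<eta>_def \<rho>_def K_def \<alpha>]
    define Q where "Q = resolution * B"
    have FK: "fejer_kernel Q B" unfolding Q_def by (rule sm(1))
    interpret fejer_kernel Q B by (rule FK)
    let "?e u n x" = "(norm (avg (u * q ^ n) F x - avg (q ^ n) F x))\<^sup>2"
    let ?F2 = "\<Sum>x\<in>period. (norm (F x))\<^sup>2"
    have CF: "cyclic_fourier Q" by unfold_locales
    let ?x = "\<lambda>a j. norm (1 - chi (a * int (g * d ^ j)))"
    let ?p = "\<lambda>a j. symbol (chi (- a) ^ d ^ j)"
    have em: "expanding_multipliers (?x a) (?p a) (\<lambda>j. (khat (a * int (g * d ^ j)))\<^sup>2) \<eta> \<rho> \<alpha> K" for a
      using sm(2)[of a] unfolding Q_def .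
    obtain c where c: "\<And>x. synth c x = F x" using synth_exists[of F] per unfolding Q_def by blast
    have F: "F = synth c" using c by auto
    have avg: "avg (q ^ n) F x = synth (\<lambda>a. (\<Prod>j<n. ?p a j) * c a) x" for n x
      unfolding F digit_avg_synth[OF CF] exp_sum_product ..
    have k: "1 \<le> r / (r-2)" using r by (simp add: field_simps)
    have S0: "0 \<le> ?F2" by (simp add: sum_nonneg)
    show "(\<Sum>x\<in>{0..<int (resolution * B)}. (pvar r N (\<lambda>n. avg (q ^ n) F x))\<^sup>2)
       \<le> C * (r / (r-2)) * (\<Sum>x\<in>{0..<int (resolution * B)}. (norm (F x))\<^sup>2)"
      unfolding Q_def[symmetric]
    proof -
      have "(\<Sum>x\<in>period. (pvar r N (\<lambda>n. avg (q ^ n) F x))\<^sup>2) \<le> Ca * (r / (r-2)) * ?F2"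
        unfolding avg using multiplier_variation[OF r em Ca_def] unfolding F .
      also have "\<dots> \<le> C * (r / (r-2)) * ?F2"
        using C k S0 by (intro mult_right_mono) auto
      finally show "(\<Sum>x\<in>period. (pvar r N (\<lambda>n. avg (q ^ n) F x))\<^sup>2) \<le> C * (r / (r-2)) * ?F2" .
    qed
    define V where "V u n a = (\<Sum>a'<u. (chi (- a) ^ d ^ n) ^ \<Phi> a') / of_nat u - 1" for u n a
    have diff: "avg (u * q ^ n) F x - avg (q ^ n) F x
       = synth (\<lambda>a. (\<Prod>j<n. ?p a j) * V u n a * c a) x" for u n x
    proof -
      have "avg (u * q ^ n) F x = synth (\<lambda>a. (\<Prod>j<n. ?p a j) * (V u n a + 1) * c a) x"
        unfolding F digit_avg_synth[OF CF] exp_sum_split exp_sum_product[symmetric] V_def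
        by (simp add: mult_ac)
      then show ?thesis unfolding avg synth_def by (simp add: sum_subtractf[symmetric] algebra_simps)
    qed
    have Vle: "(norm (V u n a))\<^sup>2 \<le> W\<^sup>2 * (?x a n)\<^sup>2" if "u \<in> {q ^ s..<q ^ (s+1)}" for u n a
    proof -
      have "0 < q ^ s" using card_D by simp
      then have "0 < u" using that by (meson atLeastLessThan_iff less_le_trans)
      then have u: "0 < u" "u \<le> v" using that by (auto simp: v_def)
      have "norm (V u n a) \<le> W * norm (1 - (chi (- a) ^ d ^ n) ^ g)"
        unfolding V_def W_def by (rule block_average_close[OF _ g0(2) g_pos u]) (simp add: norm_power)
      also have "norm (1 - (chi (- a) ^ d ^ n) ^ g) = ?x a n"
      proof -
        have "(chi (- a) ^ d ^ n) ^ g = chi (- (a * int (g * d ^ n)))"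
          unfolding power_mult[symmetric] chi_power by (rule arg_cong[where f = chi]) (simp add: mult_ac)
        also have "\<dots> = cnj (chi (a * int (g * d ^ n)))" by (rule chi_minus)
        finally have "1 - (chi (- a) ^ d ^ n) ^ g = cnj (1 - chi (a * int (g * d ^ n)))" by simp
        then show ?thesis by (simp only: complex_mod_cnj)
      qed
      finally have "norm (V u n a) \<le> W * ?x a n" .
      then have "(norm (V u n a))\<^sup>2 \<le> (W * ?x a n)\<^sup>2" by (intro power_mono) auto
      then show ?thesis by (simp add: power_mult_distrib)
    qed
    have one: "(\<Sum>x\<in>period. \<Sum>n<N. ?e u n x)
       \<le> W\<^sup>2 * (8 / (1 - \<rho>)) * ?F2" if u: "u \<in> {q ^ s..<q ^ (s+1)}" for u
    proof -
      have "(\<Sum>x\<in>period. \<Sum>n<N. ?e u n x)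
        = (\<Sum>n<N. \<Sum>x\<in>period. (norm (synth (\<lambda>a. (\<Prod>j<n. ?p a j) * V u n a * c a) x))\<^sup>2)"
        unfolding diff by (rule sum.swap)
      also have "\<dots> = real Q * (\<Sum>n<N. \<Sum>a\<in>period. (norm (\<Prod>j<n. ?p a j))\<^sup>2 * (norm (V u n a))\<^sup>2 * (norm (c a))\<^sup>2)"
        unfolding parseval norm_mult power_mult_distrib sum_distrib_left ..
      also have "\<dots> \<le> real Q * (\<Sum>n<N. \<Sum>a\<in>period. (norm (\<Prod>j<n. ?p a j))\<^sup>2 * (W\<^sup>2 * (?x a n)\<^sup>2) * (norm (c a))\<^sup>2)"
        using Vle[OF u] by (intro mult_left_mono sum_mono mult_right_mono) auto
      also have "\<dots> = real Q * (\<Sum>a\<in>period. W\<^sup>2 * (\<Sum>n<N. (norm (\<Prod>j<n. ?p a j))\<^sup>2 * (?x a n)\<^sup>2) * (norm (c a))\<^sup>2)"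
        by (subst sum.swap) (simp only: sum_distrib_left sum_distrib_right mult_ac)
      also have "\<dots> \<le> real Q * (\<Sum>a\<in>period. W\<^sup>2 * (8 / (1 - \<rho>)) * (norm (c a))\<^sup>2)"
      proof -
        have "(\<Sum>n<N. (norm (\<Prod>j<n. ?p a j))\<^sup>2 * (?x a n)\<^sup>2) \<le> 8 / (1 - \<rho>)" for a
          by (rule expanding_multipliers.sum_product_x_sq_le[OF em])
        then show ?thesis by (intro mult_left_mono sum_mono mult_right_mono) auto
      qed
      also have "\<dots> = W\<^sup>2 * (8 / (1 - \<rho>)) * ?F2"
        unfolding F parseval sum_distrib_left[symmetric] by (simp only: mult_ac)
      finally show ?thesis .
    qed
    show "(\<Sum>x\<in>{0..<int (resolution * B)}. \<Sum>n<N. \<Sum>u\<in>{q ^ s..<q ^ (s+1)}.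
        ?e u n x)
       \<le> C * (\<Sum>x\<in>{0..<int (resolution * B)}. (norm (F x))\<^sup>2)"
      unfolding Q_def[symmetric]
    proof -
      have "(\<Sum>x\<in>period. \<Sum>n<N. \<Sum>u\<in>{q ^ s..<q ^ (s+1)}. ?e u n x)
        = (\<Sum>x\<in>period. \<Sum>u\<in>{q ^ s..<q ^ (s+1)}. \<Sum>n<N. ?e u n x)"
        by (rule sum.cong[OF refl], rule sum.swap)
      also have "\<dots> = (\<Sum>u\<in>{q ^ s..<q ^ (s+1)}. \<Sum>x\<in>period. \<Sum>n<N. ?e u n x)"
        by (rule sum.swap)
      also have "\<dots> \<le> (\<Sum>u\<in>{q ^ s..<q ^ (s+1)}. W\<^sup>2 * (8 / (1 - \<rho>)) * ?F2)"
        by (intro sum_mono one)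
      also have "\<dots> = real (q ^ (s+1) - q ^ s) * (W\<^sup>2 * (8 / (1 - \<rho>)) * ?F2)"
        by simp
      also have "\<dots> \<le> real v * (W\<^sup>2 * (8 / (1 - \<rho>)) * ?F2)"
      proof (rule mult_right_mono)
        show "real (q ^ (s+1) - q ^ s) \<le> real v" unfolding v_def by (intro of_nat_mono diff_le_self)
      qed (use \<rho> S0 in auto)
      also have "\<dots> = Cb * ?F2" by (simp add: Cb_def)
      also have "\<dots> \<le> C * ?F2" using C S0 by (intro mult_right_mono) auto
      finally show "(\<Sum>x\<in>period. \<Sum>n<N. \<Sum>u\<in>{q ^ s..<q ^ (s+1)}. ?e u n x)
        \<le> C * ?F2" .
    qed
  qed
qed

end

section \<open>Transference to the integers\<close>

lemma pvar_mono: "2 \<le> r \<Longrightarrow> L \<le> L' \<Longrightarrow> pvar r L a \<le> pvar r L' a"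
  by (rule pvar_least, rule pvar_upper) (auto intro: order_trans)

lemma sum_le_image_range:
  fixes h :: "'b \<Rightarrow> real"
  assumes "finite I" "A \<subseteq> f ` I" "\<And>y. 0 \<le> h y"
  shows "sum h A \<le> (\<Sum>i\<in>I. h (f i))"
proof -
  have "sum h A \<le> sum h (f ` I)" using assms by (intro sum_mono2) auto
  also have "\<dots> \<le> sum (h \<circ> f) I" using assms by (intro sum_image_le) auto
  finally show ?thesis by simp
qed

context digit_system
begin

text \<open>
  Each time in the set \<open>avg_times q s\<close> is \<open>u * q ^ n\<close> for a unique \<open>u \<in>
  multipliers s\<close> and a unique \<open>n\<close>, its scale; the scale is monotone in the time.
\<close>
definition multipliers :: "nat \<Rightarrow> nat set" where "multipliers s = {q ^ s..<q ^ (s+1)}"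

definition scale :: "nat \<Rightarrow> nat \<Rightarrow> nat" where
  "scale s M = (THE n. \<exists>u\<in>multipliers s. M = u * q ^ n)"

lemma scale_mono_aux:
  assumes "u \<in> multipliers s" "u' \<in> multipliers s" "u * q ^ n \<le> u' * q ^ n'"
  shows "n \<le> n'"
proof (rule ccontr)
  assume "\<not> n \<le> n'"
  then have "s + 1 + n' \<le> s + n" by simp
  have q0: "0 < q" using card_D by simp
  have "u' * q ^ n' < q ^ (s + 1) * q ^ n'" using assms(2) q0 by (simp add: multipliers_def)
  also have "\<dots> = q ^ (s + 1 + n')" by (simp only: power_add)
  also have "\<dots> \<le> q ^ (s + n)" using \<open>s + 1 + n' \<le> s + n\<close> q0 by (intro power_increasing) auto
  also have "\<dots> \<le> u * q ^ n" using assms(1) by (simp add: multipliers_def power_add)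
  finally show False using assms(3) by simp
qed

lemma scale_eq:
  assumes u: "u \<in> multipliers s"
  shows "scale s (u * q ^ n) = n"
  unfolding scale_def
proof (rule the_equality)
  show "\<exists>u'\<in>multipliers s. u * q ^ n = u' * q ^ n" using u by blast
next
  fix n' assume "\<exists>u'\<in>multipliers s. u * q ^ n = u' * q ^ n'"
  then obtain u' where u': "u' \<in> multipliers s" "u * q ^ n = u' * q ^ n'" by blast
  have "n \<le> n'" using scale_mono_aux[OF u u'(1)] u'(2) by simp
  moreover have "n' \<le> n" using scale_mono_aux[OF u'(1) u] u'(2) by simp
  ultimately show "n' = n" by simp
qed

lemma avg_timesE:
  assumes "M \<in> avg_times q s"
  obtains u n where "u \<in> multipliers s" "M = u * q ^ n"
  using assms that by (auto simp: avg_times_def multipliers_def)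

lemma scale_mono: "M \<in> avg_times q s \<Longrightarrow> M' \<in> avg_times q s \<Longrightarrow> M \<le> M' \<Longrightarrow> scale s M \<le> scale s M'"
  by (elim avg_timesE) (auto simp: scale_eq intro: scale_mono_aux)

lemma scale_le: "M \<in> avg_times q s \<Longrightarrow> scale s M \<le> M"
proof (elim avg_timesE)
  fix u n assume u: "u \<in> multipliers s" "M = u * q ^ n"
  have "1 \<le> q ^ s" using card_D by (intro one_le_power) simp
  also have "\<dots> \<le> u" using u by (simp add: multipliers_def)
  finally have "1 \<le> u" .
  have "n \<le> q ^ n" using card_D less_exp[of n] power_mono[of 2 q n] by linarith
  also have "1 * q ^ n \<le> u * q ^ n" using \<open>1 \<le> u\<close> by (intro mult_le_mono1)
  finally show "scale s M \<le> M" using u by (simp add: scale_eq)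
qed

text \<open>
  The square function that compares the averages at \<open>u q^n\<close> with the average at
  \<open>q^n\<close>, over the scales \<open>n \<le> L\<close>.
\<close>
definition block_error :: "nat \<Rightarrow> nat \<Rightarrow> (int \<Rightarrow> complex) \<Rightarrow> int \<Rightarrow> real" where
  "block_error s L f x = (\<Sum>n<Suc L. \<Sum>u\<in>multipliers s.
     (norm (avg (u * q ^ n) f x - avg (q ^ n) f x))\<^sup>2)"

text \<open>
  A bound, increasing in \<open>L\<close>, for the variation at \<open>x\<close> over all times at most
  \<open>L\<close>.
\<close>
definition majorant :: "real \<Rightarrow> nat \<Rightarrow> nat \<Rightarrow> (int \<Rightarrow> complex) \<Rightarrow> int \<Rightarrow> real" where
  "majorant r s L f x = pvar r L (\<lambda>n. avg (q ^ n) f x) + 2 * sqrt (block_error s L f x)"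

lemma block_error_nonneg: "0 \<le> block_error s L f x"
  unfolding block_error_def by (intro sum_nonneg) auto

lemma majorant_nonneg: "2 \<le> r \<Longrightarrow> 0 \<le> majorant r s L f x"
  unfolding majorant_def by (intro add_nonneg_nonneg pvar_nonneg) (auto simp: block_error_nonneg)

lemma majorant_mono: "2 \<le> r \<Longrightarrow> L \<le> L' \<Longrightarrow> majorant r s L f x \<le> majorant r s L' f x"
  unfolding majorant_def block_error_def
  by (intro add_mono pvar_mono mult_left_mono real_sqrt_le_mono sum_mono2) (auto intro!: sum_nonneg)

lemma variation_sum_le_majorant:
  fixes t :: "nat \<Rightarrow> nat"
  assumes r: "2 \<le> r" and t: "t ` {0..J} \<subseteq> avg_times q s" "strict_mono_on {0..J} t" "t J \<le> L"
  shows "(\<Sum>j=1..J. norm (avg (t j) f x - avg (t (j - 1)) f x) powr r) powr (1 / r)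
    \<le> majorant r s L f x"
proof -
  define a where "a M = avg M f x" for M
  define b where "b n = a (q ^ n)" for n
  define e where "e M = (if M \<in> avg_times q s then a M - b (scale s M) else 0)" for M
  define T where "T j = t (min j J)" for j
  have T: "T j \<in> avg_times q s" for j
  proof -
    have "min j J \<in> {0..J}" by simp
    then show ?thesis using t(1) unfolding T_def by blast
  qed
  have monoT: "mono T"
  proof (rule monoI)
    fix i j :: nat assume "i \<le> j"
    then have "min i J \<le> min j J" "min i J \<in> {0..J}" "min j J \<in> {0..J}" by auto
    then show "T i \<le> T j" unfolding T_def using t(2) by (metis order.order_iff_strict strict_mono_onD)
  qed
  have TL: "T j \<le> L" for j
  proof -
    have "T j \<le> T (max j J)" using monoT by (simp add: mono_def)
    also have "\<dots> = t J" by (simp add: T_def)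
    finally show ?thesis using t(3) by simp
  qed
  have aT: "a (T j) = b (scale s (T j)) + e (T j)" for j using T by (simp add: e_def)
  \<comment> \<open>split into the average at the scale, read along a weakly monotone sequence, and the error\<close>
  have "(\<Sum>j=1..J. norm (a (t j) - a (t (j - 1))) powr r) = (\<Sum>j<J. norm (a (T (Suc j)) - a (T j)) powr r)"
    unfolding One_nat_def sum.atLeast1_atMost_eq by (intro sum.cong refl) (auto simp: T_def min_def)
  also have "\<dots> powr (1/r) = (\<Sum>j<J. norm ((b (scale s (T (Suc j))) - b (scale s (T j))) + (e (T (Suc j)) - e (T j))) powr r) powr (1/r)"
    unfolding aT by (simp add: algebra_simps)
  also have "\<dots> \<le> (\<Sum>j<J. norm (b (scale s (T (Suc j))) - b (scale s (T j))) powr r) powr (1/r)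
      + (\<Sum>j<J. norm (e (T (Suc j)) - e (T j)) powr r) powr (1/r)"
    using r by (intro powr_norm_triangle) auto
  also have "(\<Sum>j<J. norm (b (scale s (T (Suc j))) - b (scale s (T j))) powr r) powr (1/r) \<le> pvar r L b"
  proof (rule pvar_upper[OF r, of "\<lambda>j. scale s (T j)"])
    show "mono (\<lambda>j. scale s (T j))" using monoT T by (auto intro!: monoI scale_mono dest: monoD)
    show "scale s (T j) \<le> L" for j using scale_le[OF T, of j] TL[of j] by linarith
  qed
  also have "(\<Sum>j<J. norm (e (T (Suc j)) - e (T j)) powr r) powr (1/r) \<le> 2 * sqrt (\<Sum>M\<le>L. (norm (e M))\<^sup>2)"
    by (rule powr_sum_increments_le_square[OF r monoT TL])
  also have "\<dots> \<le> 2 * sqrt (block_error s L f x)"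
  proof (intro mult_left_mono real_sqrt_le_mono)
    have "(\<Sum>M\<le>L. (norm (e M))\<^sup>2) = (\<Sum>M\<in>avg_times q s \<inter> {..L}. (norm (e M))\<^sup>2)"
      by (rule sum.mono_neutral_right) (auto simp: e_def)
    also have "\<dots> \<le> (\<Sum>(n,u)\<in>{..<Suc L} \<times> multipliers s. (norm (e (u * q ^ n)))\<^sup>2)"
    proof -
      have "avg_times q s \<inter> {..L} \<subseteq> (\<lambda>(n,u). u * q ^ n) ` ({..<Suc L} \<times> multipliers s)"
      proof
        fix M assume M: "M \<in> avg_times q s \<inter> {..L}"
        then obtain u n where u: "u \<in> multipliers s" "M = u * q ^ n" using avg_timesE[of M s] by blast
        have "n \<le> L" using scale_le[of M s] M u by (simp add: scale_eq)
        then show "M \<in> (\<lambda>(n,u). u * q ^ n) ` ({..<Suc L} \<times> multipliers s)" using u by force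
      qed
      from sum_le_image_range[OF _ this, of "\<lambda>M. (norm (e M))\<^sup>2"]
      show ?thesis by (simp add: case_prod_beta multipliers_def)
    qed
    also have "\<dots> = block_error s L f x"
      unfolding block_error_def sum.cartesian_product[symmetric]
    proof (rule sum.cong[OF refl], rule sum.cong[OF refl])
      fix n u assume u: "u \<in> multipliers s"
      then have "u * q ^ n \<in> avg_times q s" by (auto simp: avg_times_def multipliers_def)
      then show "(norm (e (u * q ^ n)))\<^sup>2 = (norm (avg (u * q ^ n) f x - avg (q ^ n) f x))\<^sup>2"
        using u by (simp add: e_def scale_eq a_def b_def)
    qed
    finally show "(\<Sum>M\<le>L. (norm (e M))\<^sup>2) \<le> block_error s L f x" .
  qed simp
  finally show ?thesis unfolding majorant_def a_def b_def by simp
qed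

text \<open>
  For times at most \<open>L\<close> and points in \<open>{-L..L}\<close> the majorant only sees
  \<open>f\<close> on a bounded window, so \<open>f\<close> may be replaced by its periodisation from a
  window that is an interval of length \<open>Q\<close>.
\<close>
lemma window_bound:
  "\<exists>C>0. \<forall>L f r. 2 < r \<longrightarrow> (\<exists>Y. finite Y \<and>
     (\<Sum>x\<in>{-int L..int L}. (majorant r s L f x)\<^sup>2) \<le> (C * (r / (r-2)))\<^sup>2 * (\<Sum>y\<in>Y. (norm (f y))\<^sup>2))"
proof -
  obtain C where C: "0 < C" and bounds: "\<forall>B>0. \<forall>F. (\<forall>x. F (x + int (resolution * B)) = F x) \<longrightarrow> (\<forall>N r. 2 < r \<longrightarrow>
     (\<Sum>x\<in>{0..<int (resolution * B)}. (pvar r N (\<lambda>n. avg (q ^ n) F x))\<^sup>2)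
       \<le> C * (r / (r-2)) * (\<Sum>x\<in>{0..<int (resolution * B)}. (norm (F x))\<^sup>2) \<and>
     (\<Sum>x\<in>{0..<int (resolution * B)}. \<Sum>n<N. \<Sum>u\<in>{q ^ s..<q ^ (s+1)}.
        (norm (avg (u * q ^ n) F x - avg (q ^ n) F x))\<^sup>2)
       \<le> C * (\<Sum>x\<in>{0..<int (resolution * B)}. (norm (F x))\<^sup>2))"
    using cyclic_bounds[of s] by (elim exE conjE) (rule that)
  show ?thesis
  proof (intro exI[of _ "sqrt (10 * C)"] conjI allI impI)
    show "0 < sqrt (10 * C)" using C by simp
    fix L :: nat and f :: "int \<Rightarrow> complex" and r :: real
    assume r: "2 < r"
    define k where "k = r / (r-2)"
    have k: "1 \<le> k" using r by (simp add: k_def field_simps)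
    define M0 where "M0 = q ^ (s+1) * q ^ L"
    define W where "W = (\<Sum>m<M0. \<Phi> m)"
    \<comment> \<open>averages at points of \<open>{-L..L}\<close> read \<open>f\<close> on \<open>{-c..L}\<close>; one period, of length at least \<open>B > c + L\<close>, covers this\<close>
    define c where "c = L + W"
    define B where "B = c + L + 1"
    define Q where "Q = resolution * B"
    have B: "0 < B" by (simp add: B_def)
    have BQ: "B \<le> Q" using d_ge_3 by (simp add: Q_def)
    interpret cyclic_fourier Q by unfold_locales (use B BQ in linarith)
    define F where "F y = f ((y + int c) mod int Q - int c)" for y
    have per: "F (y + int Q) = F y" for y
    proof -
      have "(y + int Q + int c) mod int Q = (y + int c) mod int Q"
        by (metis add.commute add.left_commute mod_add_self1)
      then show ?thesis by (simp add: F_def)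
    qed
    have F_eq: "F y = f y" if "- int c \<le> y" "y < int Q - int c" for y
      using that by (simp add: F_def)
    have avg_eq: "avg M f x = avg M F x" if M: "M \<le> M0" and x: "x \<in> {-int L..int L}" for M x
    proof -
      have "f (x - int (\<Phi> m)) = F (x - int (\<Phi> m))" if "m < M" for m
      proof (rule F_eq[symmetric])
        have "\<Phi> m \<le> W" unfolding W_def using that M by (intro member_le_sum) auto
        then show "- int c \<le> x - int (\<Phi> m)" using x by (simp add: c_def)
        have "x - int (\<Phi> m) \<le> int L" using x by simp
        also have "\<dots> < int B - int c" by (simp add: B_def)
        finally show "x - int (\<Phi> m) < int Q - int c" using BQ by linarith
      qed
      then show ?thesis by (simp add: digit_avg_def)
    qed
    have q1: "1 \<le> q" using card_D by simp
    have qn: "q ^ n \<le> M0" if "n \<le> L" for n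
    proof -
      have "1 * q ^ n \<le> q ^ (s+1) * q ^ L"
        using q1 that by (intro mult_le_mono power_increasing) auto
      then show ?thesis by (simp add: M0_def)
    qed
    have uqn: "u * q ^ n \<le> M0" if "n \<le> L" "u \<in> multipliers s" for u n
      unfolding M0_def using q1 that by (intro mult_le_mono power_increasing) (auto simp: multipliers_def)
    have maj_eq: "majorant r s L f x = majorant r s L F x" if x: "x \<in> {-int L..int L}" for x
    proof -
      have "pvar r L (\<lambda>n. avg (q ^ n) f x) = pvar r L (\<lambda>n. avg (q ^ n) F x)"
        by (intro pvar_cong avg_eq qn x)
      moreover have "block_error s L f x = block_error s L F x"
        unfolding block_error_def
      proof (rule sum.cong[OF refl], rule sum.cong[OF refl])
        fix n u assume "n \<in> {..<Suc L}" and u: "u \<in> multipliers s"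
        then have n: "n \<le> L" by simp
        show "(norm (avg (u * q ^ n) f x - avg (q ^ n) f x))\<^sup>2 =
          (norm (avg (u * q ^ n) F x - avg (q ^ n) F x))\<^sup>2"
          unfolding avg_eq[OF qn[OF n] x] avg_eq[OF uqn[OF n u] x] ..
      qed
      ultimately show ?thesis by (simp add: majorant_def)
    qed
    have avg_per: "avg M F (x + int Q) = avg M F x" for M x
    proof -
      have "F (x + int Q - int k) = F (x - int k)" for k using per[of "x - int k"] by (simp add: algebra_simps)
      then show ?thesis by (simp add: digit_avg_def)
    qed
    have maj_per: "majorant r s L F (x + int Q) = majorant r s L F x" for x
      unfolding majorant_def block_error_def avg_per ..
    have window: "(\<Sum>x\<in>{-int c..<int Q - int c}. h x) = (\<Sum>x\<in>period. h x)"
      if "\<And>x. h (x + int Q) = h x" for h :: "int \<Rightarrow> real"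
    proof -
      have "(\<Sum>x\<in>{-int c..<int Q - int c}. h x) = (\<Sum>x\<in>period. h (x + - int c))"
        by (rule sum.reindex_bij_witness[of _ "\<lambda>x. x - int c" "\<lambda>x. x + int c"]) auto
      also have "\<dots> = (\<Sum>x\<in>period. h x)" using that by (rule sum_periodic_shift)
      finally show ?thesis .
    qed
    define E where "E = (\<Sum>x\<in>period. (norm (F x))\<^sup>2)"
    have E0: "0 \<le> E" by (simp add: E_def sum_nonneg)
    have E_eq: "E = (\<Sum>y\<in>{-int c..<int Q - int c}. (norm (f y))\<^sup>2)"
    proof -
      have "E = (\<Sum>y\<in>{-int c..<int Q - int c}. (norm (F y))\<^sup>2)"
        unfolding E_def by (rule window[symmetric]) (simp add: per)
      also have "\<dots> = (\<Sum>y\<in>{-int c..<int Q - int c}. (norm (f y))\<^sup>2)"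
        by (intro sum.cong refl) (simp add: F_eq)
      finally show ?thesis .
    qed
    have "\<forall>x. F (x + int (resolution * B)) = F x" using per unfolding Q_def ..
    note bounds' = mp[OF spec[OF mp[OF spec[OF bounds, of B] B], of F] this, unfolded Q_def[symmetric]]
    have b: "(\<Sum>x\<in>period. (pvar r L (\<lambda>n. avg (q ^ n) F x))\<^sup>2) \<le> C * k * E"
      "(\<Sum>x\<in>period. block_error s L F x) \<le> C * E"
      unfolding k_def E_def block_error_def multipliers_def
      by (rule conjunct1[OF mp[OF spec[OF spec[OF bounds', of L], of r] r]],
        rule conjunct2[OF mp[OF spec[OF spec[OF bounds', of "Suc L"], of r] r]])
    have "(\<Sum>x\<in>{-int L..int L}. (majorant r s L f x)\<^sup>2) = (\<Sum>x\<in>{-int L..int L}. (majorant r s L F x)\<^sup>2)"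
      by (intro sum.cong refl) (simp add: maj_eq)
    also have "\<dots> \<le> (\<Sum>x\<in>{-int c..<int Q - int c}. (majorant r s L F x)\<^sup>2)"
    proof (rule sum_mono2)
      have "int L < int Q - int c" using BQ by (simp add: B_def)
      then show "{-int L..int L} \<subseteq> {-int c..<int Q - int c}" by (auto simp: c_def)
    qed auto
    also have "\<dots> = (\<Sum>x\<in>period. (majorant r s L F x)\<^sup>2)"
      by (rule window) (simp add: maj_per)
    also have "\<dots> \<le> (\<Sum>x\<in>period. 2 * (pvar r L (\<lambda>n. avg (q ^ n) F x))\<^sup>2 + 8 * block_error s L F x)"
    proof (rule sum_mono)
      fix x
      let ?A = "pvar r L (\<lambda>n. avg (q ^ n) F x)" and ?B = "2 * sqrt (block_error s L F x)"
      have "(majorant r s L F x)\<^sup>2 \<le> 2 * ?A\<^sup>2 + 2 * ?B\<^sup>2"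
        using sum_squares_bound[of ?A ?B] unfolding majorant_def power2_sum by linarith
      also have "?B\<^sup>2 = 4 * block_error s L F x" by (simp add: power_mult_distrib block_error_nonneg)
      finally show "(majorant r s L F x)\<^sup>2 \<le> 2 * ?A\<^sup>2 + 8 * block_error s L F x" by simp
    qed
    also have "\<dots> \<le> 2 * (C * k * E) + 8 * (C * E)"
      using b unfolding sum.distrib sum_distrib_left[symmetric] by linarith
    also have "\<dots> \<le> 10 * C * k\<^sup>2 * E"
    proof -
      have CE: "0 \<le> C * E" using C E0 by simp
      have "k * 1 \<le> k * k" using k by (intro mult_left_mono) auto
      then have k2: "k \<le> k\<^sup>2" by (simp add: power2_eq_square)
      have "k * (C * E) \<le> k\<^sup>2 * (C * E)" using CE k2 by (intro mult_right_mono) auto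
      moreover have "1 * (C * E) \<le> k\<^sup>2 * (C * E)" using CE k k2 by (intro mult_right_mono) auto
      ultimately show ?thesis by (simp add: algebra_simps)
    qed
    also have "\<dots> = (sqrt (10 * C) * (r / (r-2)))\<^sup>2 * E"
    proof -
      have "(sqrt (10 * C))\<^sup>2 = 10 * C" using C by simp
      then show ?thesis by (simp only: power_mult_distrib k_def)
    qed
    finally show "\<exists>Y. finite Y \<and> (\<Sum>x\<in>{-int L..int L}. (majorant r s L f x)\<^sup>2)
        \<le> (sqrt (10 * C) * (r / (r-2)))\<^sup>2 * (\<Sum>y\<in>Y. (norm (f y))\<^sup>2)"
      unfolding E_eq by (intro exI[of _ "{-int c..<int Q - int c}"]) auto
  qed
qed

end

lemma SUP_power2_le:
  fixes g :: "nat \<Rightarrow> ennreal"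
  assumes "incseq g"
  shows "(SUP L. g L)\<^sup>2 \<le> (SUP L. (g L)\<^sup>2)"
proof -
  have "(SUP L. g L)\<^sup>2 = (SUP K. SUP L. g L * g K)"
    unfolding power2_eq_square by (simp add: SUP_mult_left_ennreal SUP_mult_right_ennreal)
  also have "\<dots> \<le> (SUP L. (g L)\<^sup>2)"
  proof (intro SUP_least)
    fix K L
    have "g L * g K \<le> g (max L K) * g (max L K)"
      using assms by (intro mult_mono) (auto simp: incseq_def)
    also have "\<dots> \<le> (SUP L. (g L)\<^sup>2)" unfolding power2_eq_square by (rule SUP_upper) simp
    finally show "g L * g K \<le> (SUP L. (g L)\<^sup>2)" .
  qed
  finally show ?thesis .
qed

lemma ennreal_sqrt_mono: "a \<le> b \<Longrightarrow> ennreal_sqrt a \<le> ennreal_sqrt b"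
  unfolding ennreal_sqrt_def
  by (auto simp: top_unique less_top intro!: ennreal_leI real_sqrt_le_mono enn2real_mono)

lemma ennreal_sqrt_scale:
  assumes "0 \<le> a" "b < \<infinity>"
  shows "ennreal_sqrt (ennreal (a\<^sup>2) * b) = ennreal a * ennreal_sqrt b"
proof -
  obtain b' where b: "b = ennreal b'" "0 \<le> b'" using assms(2) by (cases b) auto
  have *: "ennreal (a\<^sup>2) * b = ennreal (a\<^sup>2 * b')" using b by (simp add: ennreal_mult)
  show ?thesis unfolding * using b assms(1)
    by (simp add: ennreal_sqrt_def real_sqrt_mult flip: ennreal_mult)
qed

lemma (in digit_system) variation_l2_bound:
  "\<exists>C::real. 0 < C \<and>
    (\<forall>r::real. 2 < r \<longrightarrow>
      (\<forall>f :: int \<Rightarrow> complex. l2norm (\<lambda>x. ennreal (norm (f x))) < \<infinity> \<longrightarrow>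
        l2norm (\<lambda>x. variation r (avg_times q s) (\<lambda>M. avg M f x))
          \<le> ennreal (C * (r / (r - 2))) * l2norm (\<lambda>x. ennreal (norm (f x)))))"
proof -
  obtain C where C: "0 < C" and window: "\<forall>L f r. 2 < r \<longrightarrow> (\<exists>Y. finite Y \<and>
     (\<Sum>x\<in>{-int L..int L}. (majorant r s L f x)\<^sup>2) \<le> (C * (r / (r-2)))\<^sup>2 * (\<Sum>y\<in>Y. (norm (f y))\<^sup>2))"
    using window_bound[of s] by (elim exE conjE) (rule that)
  show ?thesis
  proof (intro exI[of _ C] conjI allI impI C)
    fix r :: real and f :: "int \<Rightarrow> complex"
    assume r: "2 < r" and fin: "l2norm (\<lambda>x. ennreal (norm (f x))) < \<infinity>"
    let ?V = "\<lambda>x. variation r (avg_times q s) (\<lambda>M. avg M f x)"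
    define k where "k = C * (r / (r-2))"
    have k: "0 \<le> k" using C r by (simp add: k_def)
    define N2 where "N2 = (\<integral>\<^sup>+ x. ennreal (norm (f x)) ^ 2 \<partial>count_space UNIV)"
    have N2: "N2 < \<infinity>" using fin unfolding l2norm_def N2_def[symmetric] ennreal_sqrt_def
      by (auto simp: less_top split: if_splits)
    define g where "g L x = ennreal (majorant r s L f x) * indicator {-int L..int L} x" for L x
    have g_inc: "incseq (\<lambda>L. g L x)" for x
    proof (rule incseq_SucI)
      fix L
      show "g L x \<le> g (Suc L) x"
        unfolding g_def using majorant_mono[of r L "Suc L" s f x] r
        by (intro mult_mono ennreal_leI) (auto simp: indicator_def)
    qed
    have var_le: "?V x \<le> (SUP L. g L x)" for x
      unfolding variation_def
    proof (rule SUP_least, clarify)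
      fix J :: nat and t :: "nat \<Rightarrow> nat" assume t: "t ` {0..J} \<subseteq> avg_times q s" "strict_mono_on {0..J} t"
      define L where "L = max (t J) (nat \<bar>x\<bar>)"
      have "ennreal ((\<Sum>j=1..J. norm (avg (t j) f x - avg (t (j - 1)) f x) powr r) powr (1 / r))
        \<le> ennreal (majorant r s L f x)"
        using r by (intro ennreal_leI variation_sum_le_majorant t) (auto simp: L_def)
      also have "\<dots> = g L x"
      proof -
        have "x \<in> {-int L..int L}" by (auto simp: L_def)
        then show ?thesis by (simp add: g_def)
      qed
      also have "\<dots> \<le> (SUP L. g L x)" by (rule SUP_upper) simp
      finally show "ennreal ((\<Sum>j=1..J. norm (avg (t j) f x - avg (t (j - 1)) f x) powr r) powr (1 / r))
        \<le> (SUP L. g L x)" .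
    qed
    have gL: "(\<integral>\<^sup>+ x. (g L x)\<^sup>2 \<partial>count_space UNIV) \<le> ennreal (k\<^sup>2) * N2" for L
    proof -
      obtain Y where Y: "finite Y" "(\<Sum>x\<in>{-int L..int L}. (majorant r s L f x)\<^sup>2) \<le> k\<^sup>2 * (\<Sum>y\<in>Y. (norm (f y))\<^sup>2)"
        using mp[OF spec[OF spec[OF spec[OF window, of L], of f], of r] r] unfolding k_def[symmetric] by (elim exE conjE) (rule that)
      have "(\<integral>\<^sup>+ x. (g L x)\<^sup>2 \<partial>count_space UNIV) = (\<Sum>x\<in>{-int L..int L}. (g L x)\<^sup>2)"
        by (rule nn_integral_count_space') (auto simp: g_def indicator_def)
      also have "\<dots> = (\<Sum>x\<in>{-int L..int L}. ennreal ((majorant r s L f x)\<^sup>2))"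
        using majorant_nonneg[of r s L f] r
        by (intro sum.cong refl) (simp add: g_def ennreal_power)
      also have "\<dots> = ennreal (\<Sum>x\<in>{-int L..int L}. (majorant r s L f x)\<^sup>2)"
        by (intro sum_ennreal) auto
      also have "\<dots> \<le> ennreal (k\<^sup>2 * (\<Sum>y\<in>Y. (norm (f y))\<^sup>2))" using Y(2) by (rule ennreal_leI)
      also have "\<dots> = ennreal (k\<^sup>2) * (\<Sum>y\<in>Y. ennreal (norm (f y)) ^ 2)"
        by (simp add: ennreal_mult sum_nonneg ennreal_power sum_ennreal)
      also have "(\<Sum>y\<in>Y. ennreal (norm (f y)) ^ 2) \<le> N2"
      proof -
        have "(\<Sum>y\<in>Y. ennreal (norm (f y)) ^ 2) = (\<Sum>y\<in>Y. ennreal (norm (f y)) ^ 2 * indicator Y y)"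
          by (intro sum.cong refl) simp
        also have "\<dots> = (\<integral>\<^sup>+ y. ennreal (norm (f y)) ^ 2 * indicator Y y \<partial>count_space UNIV)"
          using Y(1) by (intro nn_integral_count_space'[symmetric]) (auto simp: indicator_def)
        also have "\<dots> \<le> N2" unfolding N2_def by (intro nn_integral_mono) (auto simp: indicator_def)
        finally show ?thesis .
      qed
      finally show ?thesis by (simp add: mult_left_mono)
    qed
    have "(\<integral>\<^sup>+ x. (?V x)\<^sup>2 \<partial>count_space UNIV)
      \<le> (\<integral>\<^sup>+ x. (SUP L. (g L x)\<^sup>2) \<partial>count_space UNIV)"
      using var_le g_inc by (intro nn_integral_mono order_trans[OF power_mono SUP_power2_le]) auto
    also have "\<dots> = (SUP L. \<integral>\<^sup>+ x. (g L x)\<^sup>2 \<partial>count_space UNIV)"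
    proof (rule nn_integral_monotone_convergence_SUP)
      show "incseq (\<lambda>L x. (g L x)\<^sup>2)"
        using g_inc by (auto simp: incseq_def le_fun_def intro!: power_mono)
    qed simp
    also have "\<dots> \<le> ennreal (k\<^sup>2) * N2" by (intro SUP_least gL)
    finally have "l2norm (\<lambda>x. ?V x) \<le> ennreal_sqrt (ennreal (k\<^sup>2) * N2)"
      unfolding l2norm_def by (rule ennreal_sqrt_mono)
    also have "\<dots> = ennreal k * ennreal_sqrt N2" using k N2 by (rule ennreal_sqrt_scale)
    finally show "l2norm (\<lambda>x. ?V x)
          \<le> ennreal (C * (r / (r - 2))) * l2norm (\<lambda>x. ennreal (norm (f x)))"
      unfolding k_def N2_def l2norm_def .
  qed
qed

theorem theorem1p4:
  fixes d :: nat and D :: "nat set" and s :: nat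
  assumes "3 \<le> d" and "D \<subset> {0..<d}" and "2 \<le> card D" and "0 \<in> D"
  shows "\<exists>C::real. 0 < C \<and>
    (\<forall>r::real. 2 < r \<longrightarrow>
      (\<forall>f :: int \<Rightarrow> complex. l2norm (\<lambda>x. ennreal (norm (f x))) < \<infinity> \<longrightarrow>
        l2norm (\<lambda>x. variation r (avg_times (card D) s) (\<lambda>M. digit_avg d D M f x))
          \<le> ennreal (C * (r / (r - 2))) * l2norm (\<lambda>x. ennreal (norm (f x)))))"
proof -
  interpret digit_system d D by unfold_locales (use assms in auto)
  show ?thesis by (rule variation_l2_bound)
qed

end
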